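(* Let $h\in(0,1]$ be fixed, and let $V$, $H$, $F$, $G$, $B$, $R$, $\mathcal{L}_r$ be as defined in the context. Let $(u_h,\eta_h,\lambda_h)\in V\times H\times H$ be a saddle point of $\mathcal{L}_r$ on $V\times H\times H$. Suppose that for all $n$ $$0<\rho_n=\rho<r\,\frac{1+\sqrt5}{2},$$ and let $(u_h^n,\eta_h^n,\lambda_h^n)\in V\times H\times H$ be the iterates given by Algorithm 2 (described in the context). Then, as $n\to\infty$, \begin{align*} \eta_h^n&\to\eta_h=Bu_h\text{ in } H,\\ \lambda_h^{n+1}-\lambda_h^n&\to0\text{ in } H, \end{align*} and the sequence $(\lambda_h^n)$ is bounded in $H$. Moreover, \begin{align*} u_h^n&\to u_h\text{ in } V,\\ [\![u_h^n-u_h]\!]&\to0\text{ in } L^2(\Gamma_{int}),\\ u_h^n&\to u_h\text{ in } L^2(\partial\Omega),\\ R(u_h^n)&\to R(u_h)\text{ in } H,\\ \nabla u_h^n&\to\nabla u_h\text{ in } H. \end{align*}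
   Context: **Setting.** $\Omega\subset\mathbb{R}^N$ is a bounded connected polygonal (polyhedral) domain with Lipschitz boundary. $p:\overline\Omega\to[p_1,2]$ with $1<p_1\le2$ is $\log$-Hölder continuous, i.e. $|p(x)-p(y)|\le C_{log}/\log(e+1/|x-y|)$ for some constant $C_{log}$ and all $x,y\in\overline\Omega$. $p'(x)$ is the conjugate exponent, $1/p(x)+1/p'(x)=1$. $\xi\in L^2(\Omega)$ and $u_D\in W^{1,p(\cdot)}(\Omega)$ (that is, $u_D$ and $\nabla u_D$ have finite modular $\int_\Omega|\cdot|^{p(x)}dx$) has trace in $L^2(\partial\Omega)$. **Mesh.** $\mathcal{T}_h$ is a member of a family $(\mathcal{T}_h)_{h\in(0,1]}$ of partitions of $\overline\Omega$ into closed polyhedral elements $\kappa$ with $\operatorname{diam}(\kappa)\le h$, each $\kappa$ being the image under an invertible affine map of one of finitely many reference polyhedra (independent of $h$). Set $\mathcal{E}_h=\{\kappa\cap\kappa':\dim_H(\kappa\cap\kappa')=N-1\}\cup\{\kappa\cap\partial\Omega:\dim_H(\kappa\cap\partial\Omega)=N-1\}$ (with $\dim_H$ the Hausdorff dimension, $\kappa\neq\kappa'$ in $\mathcal T_h$), $\Gamma_{int}=\bigcup\{e\in\mathcal{E}_h:\dim_H(e\cap\partial\Omega)<N-1\}$. With $h_\kappa=\operatorname{diam}(\kappa)$, $h_e=\operatorname{diam}(e)$, there are positive constants independent of $h$ such that: (a) $C_1h_\kappa^N\le|\kappa|\le C_2h_\kappa^N$; (b) for every $e\in\mathcal{E}_h$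 there are $x_e\in e$ and $\rho_e\ge C_1\operatorname{diam}(e)$ with $B_{\rho_e}(x_e)\cap A_e\subset e$, $A_e$ being the affine hyperplane spanned by $e$; and $ch_\kappa\le h_e\le Ch_\kappa$, $ch_{\kappa'}\le h_e\le Ch_{\kappa'}$ when $e=\kappa\cap\kappa'$. $\mathbf{h}(x)=\operatorname{diam}(e)$ for $x\in e\in\mathcal{E}_h$. **Spaces and operators.** $S^j(\mathcal{T}_h)=\{u\in L^1(\Omega):u|_\kappa\in P^j\ \forall\kappa\in\mathcal{T}_h\}$, $P^j$ being the polynomials of degree at most $j$. Fix $k,l\in\mathbb{N}_0$ with $l\ge k-1$; $V=S^k(\mathcal{T}_h)$ with the $L^2(\Omega)$ norm, and $H=S^l(\mathcal{T}_h)^N$ with the $L^2(\Omega)^N$ norm $\|\cdot\|$ and inner product $\langle\cdot,\cdot\rangle$. $\nabla v$ is the elementwise gradient. On an interior face with neighbouring elements $\kappa^\pm$ and outward unit normals $\nu^\pm$, $[\![u]\!]=u^+\nu^++u^-\nu^-$ and $\{\phi\}=(\phi^++\phi^-)/2$. The lifting operator $R=R_h$ takes values in $S^l(\mathcal{T}_h)^N$ and is defined by $\int_\Omega R(u)\cdot\phi\,dx=-\int_{\Gamma_{int}}[\![u]\!]\cdot\{\phi\}\,dS$ for all $\phi\in S^l(\mathcal{T}_h)^N$. **Functionals.** $F:H\to\mathbb{R}$, $F(q)=\int_\Omega|q|^{p(x)}dx$; $G:V\to\mathbb{R}$, $$G(v)=\int_\Omega|v-\xi|^2dx+\int_{\Gamma_{int}}|[\![v]\!]|^2\mathbf{h}^{-2/p'(x)}dS+\int_{\partial\Omega}|v-u_D|^2\mathbf{h}^{-2/p'(x)}dS;$$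 $B:V\to H$, $Bv=R(v)+\nabla v$. For $r\ge0$, $$\mathcal{L}_r(v,q,\mu)=F(q)+G(v)+\langle\mu,Bv-q\rangle+\tfrac r2\|Bv-q\|^2,\qquad (v,q,\mu)\in V\times H\times H.$$ $(u,\eta,\lambda)$ is a saddle point of $\mathcal{L}_r$ if $\mathcal{L}_r(u,\eta,\mu)\le\mathcal{L}_r(u,\eta,\lambda)\le\mathcal{L}_r(v,q,\lambda)$ for all $(v,q,\mu)\in V\times H\times H$. **Algorithm 2.** Let $(\eta_h^0,\lambda_h^1)\in H\times H$ be arbitrary. For $n\ge1$, given $(\eta_h^{n-1},\lambda_h^n)$, define $(u_h^n,\eta_h^n,\lambda_h^{n+1})\in V\times H\times H$ by \begin{align*} G(v)-G(u_h^n)+\langle\lambda_h^n,B(v-u_h^n)\rangle+r\langle Bu_h^n-\eta_h^{n-1},B(v-u_h^n)\rangle&\ge0\quad\forall v\in V,\\ F(q)-F(\eta_h^n)-\langle\lambda_h^n,q-\eta_h^n\rangle+r\langle\eta_h^n-Bu_h^n,q-\eta_h^n\rangle&\ge0\quad\forall q\in H,\\ \lambda_h^{n+1}=\lambda_h^n+\rho_n(Bu_h^n-\eta_h^n),\quad\rho_n&>0. \end{align*} *)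

theory Defs
  imports "HOL-Analysis.Analysis"
begin

section \<open>Hausdorff measure and dimension\<close>

text \<open>
  The Hausdorff measure of dimension \<open>s\<close> carries the usual constant
  \<open>unit_ball_vol s / 2 powr s\<close>, so that the \<open>(N - 1)\<close>-dimensional one is
  the surface measure \<open>dS\<close> on (subsets of) hyperplanes. The case \<open>s = 0\<close> is
  singled out because \<open>0 powr 0 = 0\<close>; boundedness of the covering sets is demanded
  because \<open>diameter\<close> is unspecified on unbounded sets.
\<close>

definition hausdorff_gauge :: "real \<Rightarrow> 'a::metric_space set \<Rightarrow> ennreal" where
  "hausdorff_gauge s U =
     (if U = {} then 0
      else ennreal (unit_ball_vol s / 2 powr s * (if s = 0 then 1 else diameter U powr s)))"

definition hausdorff_pre :: "real \<Rightarrow> real \<Rightarrow> 'a::metric_space set \<Rightarrow> ennreal" where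
  "hausdorff_pre s \<delta> A =
     (INF U \<in> {U :: nat \<Rightarrow> 'a set. A \<subseteq> (\<Union>i. U i) \<and> (\<forall>i. bounded (U i) \<and> diameter (U i) \<le> \<delta>)}.
        (\<Sum>i. hausdorff_gauge s (U i)))"

definition hausdorff_outer :: "real \<Rightarrow> 'a::metric_space set \<Rightarrow> ennreal" where
  "hausdorff_outer s A = (SUP \<delta> \<in> {0<..}. hausdorff_pre s \<delta> A)"

definition hausdorff_measure :: "real \<Rightarrow> 'a::metric_space measure" where
  "hausdorff_measure s = measure_of UNIV (sets borel) (hausdorff_outer s)"

definition hausdorff_dim :: "'a::metric_space set \<Rightarrow> real" where
  "hausdorff_dim A = Inf {s. 0 \<le> s \<and> hausdorff_outer s A = 0}"

definition surface_on :: "(real^'n) set \<Rightarrow> (real^'n) measure" where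
  "surface_on S = restrict_space (hausdorff_measure (real CARD('n) - 1)) S"


section \<open>Square integrable functions\<close>

definition L2 :: "'a measure \<Rightarrow> ('a \<Rightarrow> 'b::euclidean_space) set" where
  "L2 M = {f \<in> borel_measurable M. integrable M (\<lambda>x. (norm (f x))\<^sup>2)}"

definition L2_norm :: "'a measure \<Rightarrow> ('a \<Rightarrow> 'b::euclidean_space) \<Rightarrow> real" where
  "L2_norm M f = sqrt (LINT x|M. (norm (f x))\<^sup>2)"

definition L2_inner :: "'a measure \<Rightarrow> ('a \<Rightarrow> 'b::euclidean_space) \<Rightarrow> ('a \<Rightarrow> 'b) \<Rightarrow> real" where
  "L2_inner M f g = (LINT x|M. f x \<bullet> g x)"

definition L2_tendsto ::
  "'a measure \<Rightarrow> (nat \<Rightarrow> 'a \<Rightarrow> 'b::euclidean_space) \<Rightarrow> ('a \<Rightarrow> 'b) \<Rightarrow> bool" where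
  "L2_tendsto M f g \<longleftrightarrow>
     g \<in> L2 M \<and> (\<forall>\<^sub>F n in sequentially. f n \<in> L2 M) \<and>
     (\<lambda>n. L2_norm M (\<lambda>x. f n x - g x)) \<longlonglongrightarrow> 0"


section \<open>Domain, exponent and Sobolev functions\<close>

text \<open>Polyhedra need not be convex.\<close>

definition polyhedral_body :: "(real^'n) set \<Rightarrow> bool" where
  "polyhedral_body K \<longleftrightarrow>
     (\<exists>\<P>. finite \<P> \<and> (\<forall>P\<in>\<P>. polytope P) \<and> K = \<Union>\<P>) \<and>
     closure (interior K) = K \<and> K \<noteq> {}"

text \<open>
  Locally, in a coordinate system with last axis \<open>d\<close>, the set lies strictly below the
  graph of a Lipschitz function on the orthogonal complement of \<open>d\<close>.
\<close>

definition lipschitz_boundary :: "(real^'n) set \<Rightarrow> bool" where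
  "lipschitz_boundary \<Omega> \<longleftrightarrow>
     (\<forall>x\<in>frontier \<Omega>. \<exists>d \<delta> L g. norm d = 1 \<and> 0 < \<delta> \<and>
        L-lipschitz_on {z. d \<bullet> z = 0} g \<and>
        (\<forall>y\<in>ball x \<delta>. y \<in> \<Omega> \<longleftrightarrow> d \<bullet> y < g (y - (d \<bullet> y) *\<^sub>R d)))"

definition polyhedral_domain :: "(real^'n) set \<Rightarrow> bool" where
  "polyhedral_domain \<Omega> \<longleftrightarrow>
     open \<Omega> \<and> bounded \<Omega> \<and> connected \<Omega> \<and> \<Omega> \<noteq> {} \<and>
     polyhedral_body (closure \<Omega>) \<and> lipschitz_boundary \<Omega>"

definition log_hoelder_on :: "(real^'n) set \<Rightarrow> (real^'n \<Rightarrow> real) \<Rightarrow> bool" where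
  "log_hoelder_on S p \<longleftrightarrow>
     (\<exists>C. \<forall>x\<in>S. \<forall>y\<in>S. x \<noteq> y \<longrightarrow> \<bar>p x - p y\<bar> \<le> C / ln (exp 1 + 1 / norm (x - y)))"

definition conj_exponent :: "(real^'n \<Rightarrow> real) \<Rightarrow> real^'n \<Rightarrow> real" where
  "conj_exponent p x = p x / (p x - 1)"

definition partial :: "'n \<Rightarrow> (real^'n \<Rightarrow> real) \<Rightarrow> real^'n \<Rightarrow> real" where
  "partial i f x = frechet_derivative f (at x) (axis i 1)"

definition grad :: "(real^'n \<Rightarrow> real) \<Rightarrow> real^'n \<Rightarrow> real^'n" where
  "grad f x = (\<chi> i. partial i f x)"

primrec C_k :: "nat \<Rightarrow> (real^'n \<Rightarrow> real) \<Rightarrow> bool" where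
  "C_k 0 f \<longleftrightarrow> continuous_on UNIV f"
| "C_k (Suc m) f \<longleftrightarrow> (\<forall>x. f differentiable (at x)) \<and> (\<forall>i. C_k m (partial i f))"

definition smooth :: "(real^'n \<Rightarrow> real) \<Rightarrow> bool" where
  "smooth f \<longleftrightarrow> (\<forall>m. C_k m f)"

definition test_function :: "(real^'n) set \<Rightarrow> (real^'n \<Rightarrow> real) \<Rightarrow> bool" where
  "test_function \<Omega> \<phi> \<longleftrightarrow>
     smooth \<phi> \<and> compact (closure {x. \<phi> x \<noteq> 0}) \<and> closure {x. \<phi> x \<noteq> 0} \<subseteq> \<Omega>"

definition weak_gradient ::
  "(real^'n) set \<Rightarrow> (real^'n \<Rightarrow> real) \<Rightarrow> (real^'n \<Rightarrow> real^'n) \<Rightarrow> bool" where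
  "weak_gradient \<Omega> u w \<longleftrightarrow>
     integrable (lebesgue_on \<Omega>) u \<and> integrable (lebesgue_on \<Omega>) w \<and>
     (\<forall>\<phi> i. test_function \<Omega> \<phi> \<longrightarrow>
        (LINT x|lebesgue_on \<Omega>. u x * partial i \<phi> x) = - (LINT x|lebesgue_on \<Omega>. w x $ i * \<phi> x))"

definition finite_modular ::
  "(real^'n) set \<Rightarrow> (real^'n \<Rightarrow> real) \<Rightarrow> (real^'n \<Rightarrow> 'b::euclidean_space) \<Rightarrow> bool" where
  "finite_modular \<Omega> p f \<longleftrightarrow>
     f \<in> borel_measurable (lebesgue_on \<Omega>) \<and> integrable (lebesgue_on \<Omega>) (\<lambda>x. norm (f x) powr p x)"

definition W1p :: "(real^'n) set \<Rightarrow> (real^'n \<Rightarrow> real) \<Rightarrow> (real^'n \<Rightarrow> real) set" where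
  "W1p \<Omega> p = {u. \<exists>w. weak_gradient \<Omega> u w \<and> finite_modular \<Omega> p u \<and> finite_modular \<Omega> p w}"

text \<open>
  \<open>g\<close> is the trace of \<open>u\<close> on the boundary: the trace operator is the continuous
  extension of restriction from smooth functions to \<open>W\<^sup>1\<^sup>,\<^sup>1\<close>, which contains
  \<open>W1p \<Omega> p\<close> for bounded \<open>\<Omega>\<close> and \<open>p \<ge> 1\<close>.
\<close>

definition has_trace ::
  "(real^'n) set \<Rightarrow> (real^'n \<Rightarrow> real) \<Rightarrow> (real^'n \<Rightarrow> real) \<Rightarrow> bool" where
  "has_trace \<Omega> u g \<longleftrightarrow>
     integrable (surface_on (frontier \<Omega>)) g \<and>
     (\<exists>w \<phi>. weak_gradient \<Omega> u w \<and> (\<forall>m::nat. smooth (\<phi> m)) \<and>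
        (\<lambda>m. LINT x|lebesgue_on \<Omega>. \<bar>\<phi> m x - u x\<bar>) \<longlonglongrightarrow> 0 \<and>
        (\<lambda>m. LINT x|lebesgue_on \<Omega>. norm (grad (\<phi> m) x - w x)) \<longlonglongrightarrow> 0 \<and>
        (\<lambda>m. LINT x|surface_on (frontier \<Omega>). \<bar>\<phi> m x - g x\<bar>) \<longlonglongrightarrow> 0)"


section \<open>Meshes\<close>

definition interior_faces_of :: "(real^'n) set set \<Rightarrow> (real^'n) set set" where
  "interior_faces_of \<T> =
     {\<kappa> \<inter> \<kappa>' | \<kappa> \<kappa>'. \<kappa> \<in> \<T> \<and> \<kappa>' \<in> \<T> \<and> \<kappa> \<noteq> \<kappa>' \<and> hausdorff_dim (\<kappa> \<inter> \<kappa>') = real CARD('n) - 1}"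

definition mesh_faces :: "(real^'n) set \<Rightarrow> (real^'n) set set \<Rightarrow> (real^'n) set set" where
  "mesh_faces \<Omega> \<T> =
     interior_faces_of \<T> \<union>
     {\<kappa> \<inter> frontier \<Omega> | \<kappa>. \<kappa> \<in> \<T> \<and> hausdorff_dim (\<kappa> \<inter> frontier \<Omega>) = real CARD('n) - 1}"

definition Gamma_int :: "(real^'n) set \<Rightarrow> (real^'n) set set \<Rightarrow> (real^'n) set" where
  "Gamma_int \<Omega> \<T> =
     \<Union>{e \<in> mesh_faces \<Omega> \<T>. hausdorff_dim (e \<inter> frontier \<Omega>) < real CARD('n) - 1}"

definition partition_of_domain :: "(real^'n) set \<Rightarrow> (real^'n) set set \<Rightarrow> bool" where
  "partition_of_domain \<Omega> \<T> \<longleftrightarrow>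
     finite \<T> \<and> \<Union>\<T> = closure \<Omega> \<and>
     (\<forall>\<kappa>\<in>\<T>. \<forall>\<kappa>'\<in>\<T>. \<kappa> \<noteq> \<kappa>' \<longrightarrow> interior \<kappa> \<inter> interior \<kappa>' = {})"

definition affine_image_of :: "(real^'n) set \<Rightarrow> (real^'n) set \<Rightarrow> bool" where
  "affine_image_of K \<kappa> \<longleftrightarrow> (\<exists>a A. linear A \<and> bij A \<and> \<kappa> = (\<lambda>x. a + A x) ` K)"

text \<open>
  In the fourth clause, \<open>A\<close> is the hyperplane spanned by the face \<open>e\<close>: if \<open>e\<close> is
  contained in a hyperplane, then \<open>A = affine hull e\<close> is forced. The inclusion
  \<open>A \<subseteq> affine hull e\<close> also admits an element whose intersection with the boundary
  consists of several flat pieces (say, at a corner of the domain).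
\<close>

definition mesh_family :: "(real^'n) set \<Rightarrow> (real \<Rightarrow> (real^'n) set set) \<Rightarrow> bool" where
  "mesh_family \<Omega> T \<longleftrightarrow>
     (\<exists>Ref C1 C2 c C.
        finite Ref \<and> (\<forall>K\<in>Ref. polyhedral_body K) \<and> 0 < C1 \<and> 0 < C2 \<and> 0 < c \<and> 0 < C \<and>
        (\<forall>h\<in>{0<..1}.
           partition_of_domain \<Omega> (T h) \<and>
           (\<forall>\<kappa>\<in>T h. diameter \<kappa> \<le> h \<and> (\<exists>K\<in>Ref. affine_image_of K \<kappa>)) \<and>
           (\<forall>\<kappa>\<in>T h. C1 * diameter \<kappa> ^ CARD('n) \<le> measure lebesgue \<kappa> \<and>
                     measure lebesgue \<kappa> \<le> C2 * diameter \<kappa> ^ CARD('n)) \<and>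
           (\<forall>e\<in>mesh_faces \<Omega> (T h). \<exists>A x \<rho>.
              affine A \<and> aff_dim A = int CARD('n) - 1 \<and> A \<subseteq> affine hull e \<and>
              x \<in> e \<and> x \<in> A \<and> C1 * diameter e \<le> \<rho> \<and> 0 < \<rho> \<and> ball x \<rho> \<inter> A \<subseteq> e) \<and>
           (\<forall>\<kappa>\<in>T h. \<forall>\<kappa>'\<in>T h. \<kappa> \<noteq> \<kappa>' \<and> \<kappa> \<inter> \<kappa>' \<in> interior_faces_of (T h) \<longrightarrow>
              c * diameter \<kappa> \<le> diameter (\<kappa> \<inter> \<kappa>') \<and> diameter (\<kappa> \<inter> \<kappa>') \<le> C * diameter \<kappa> \<and>
              c * diameter \<kappa>' \<le> diameter (\<kappa> \<inter> \<kappa>') \<and> diameter (\<kappa> \<inter> \<kappa>') \<le> C * diameter \<kappa>')))"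

text \<open>
  The face containing a point of the skeleton is unique up to a null set of the surface
  measure, so the choice made on the overlaps is immaterial.
\<close>

definition face_size :: "(real^'n) set \<Rightarrow> (real^'n) set set \<Rightarrow> real^'n \<Rightarrow> real" where
  "face_size \<Omega> \<T> x = diameter (SOME e. e \<in> mesh_faces \<Omega> \<T> \<and> x \<in> e)"

text \<open>
  The outward unit normal exists at surface-almost every boundary point of a polyhedron,
  namely wherever the polyhedron is locally a half space.
\<close>

definition is_outward_normal :: "(real^'n) set \<Rightarrow> real^'n \<Rightarrow> real^'n \<Rightarrow> bool" where
  "is_outward_normal K x \<nu> \<longleftrightarrow>
     norm \<nu> = 1 \<and> (\<exists>\<delta>>0. K \<inter> ball x \<delta> = {y \<in> ball x \<delta>. \<nu> \<bullet> (y - x) \<le> 0})"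

definition outward_normal :: "(real^'n) set \<Rightarrow> real^'n \<Rightarrow> real^'n" where
  "outward_normal K x =
     (if \<exists>\<nu>. is_outward_normal K x \<nu> then (THE \<nu>. is_outward_normal K x \<nu>) else 0)"


section \<open>Broken polynomial spaces and operators\<close>

definition polys :: "nat \<Rightarrow> (real^'n \<Rightarrow> real) set" where
  "polys j = {P. \<exists>a. P = (\<lambda>x. \<Sum>\<alpha>\<in>{\<alpha> :: 'n \<Rightarrow> nat. sum \<alpha> UNIV \<le> j}. a \<alpha> * (\<Prod>i\<in>UNIV. x $ i ^ \<alpha> i))}"

definition broken_polys ::
  "nat \<Rightarrow> (real^'n) set \<Rightarrow> (real^'n) set set \<Rightarrow> (real^'n \<Rightarrow> real) set" where
  "broken_polys j \<Omega> \<T> =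
     {u. integrable (lebesgue_on \<Omega>) u \<and>
         (\<forall>\<kappa>\<in>\<T>. \<exists>P\<in>polys j. AE x in lebesgue_on \<kappa>. u x = P x)}"

definition broken_vpolys ::
  "nat \<Rightarrow> (real^'n) set \<Rightarrow> (real^'n) set set \<Rightarrow> (real^'n \<Rightarrow> real^'n) set" where
  "broken_vpolys j \<Omega> \<T> = {\<phi>. \<forall>i. (\<lambda>x. \<phi> x $ i) \<in> broken_polys j \<Omega> \<T>}"

text \<open>
  Elements of the broken spaces are determined only almost everywhere. All pointwise
  operations (trace from an element, gradient) go through the unique polynomial with
  which the function agrees almost everywhere on the element.
\<close>

definition on_elem :: "(real^'n) set \<Rightarrow> (real^'n \<Rightarrow> real) \<Rightarrow> real^'n \<Rightarrow> real" where
  "on_elem \<kappa> u = (THE P. (\<exists>j. P \<in> polys j) \<and> (AE x in lebesgue_on \<kappa>. u x = P x))"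

definition von_elem :: "(real^'n) set \<Rightarrow> (real^'n \<Rightarrow> real^'n) \<Rightarrow> real^'n \<Rightarrow> real^'n" where
  "von_elem \<kappa> \<phi> x = (\<chi> i. on_elem \<kappa> (\<lambda>y. \<phi> y $ i) x)"

text \<open>
  An element containing \<open>x\<close>; it is unique for almost every point of the domain and for
  surface-almost every point of its boundary.
\<close>

definition elem_at :: "(real^'n) set set \<Rightarrow> real^'n \<Rightarrow> (real^'n) set" where
  "elem_at \<T> x = (SOME \<kappa>. \<kappa> \<in> \<T> \<and> x \<in> \<kappa>)"

definition broken_grad :: "(real^'n) set set \<Rightarrow> (real^'n \<Rightarrow> real) \<Rightarrow> real^'n \<Rightarrow> real^'n" where
  "broken_grad \<T> u x = grad (on_elem (elem_at \<T> x) u) x"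

definition bdry_trace :: "(real^'n) set set \<Rightarrow> (real^'n \<Rightarrow> real) \<Rightarrow> real^'n \<Rightarrow> real" where
  "bdry_trace \<T> u x = on_elem (elem_at \<T> x) u x"

text \<open>
  At surface-almost every point of \<open>Gamma_int\<close> exactly two elements meet, and the sums
  below are \<open>u\<^sup>+ \<nu>\<^sup>+ + u\<^sup>- \<nu>\<^sup>-\<close> and \<open>(\<phi>\<^sup>+ + \<phi>\<^sup>-) / 2\<close>.
\<close>

definition jump :: "(real^'n) set set \<Rightarrow> (real^'n \<Rightarrow> real) \<Rightarrow> real^'n \<Rightarrow> real^'n" where
  "jump \<T> u x = (\<Sum>\<kappa>\<in>{\<kappa>\<in>\<T>. x \<in> \<kappa>}. on_elem \<kappa> u x *\<^sub>R outward_normal \<kappa> x)"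

definition average :: "(real^'n) set set \<Rightarrow> (real^'n \<Rightarrow> real^'n) \<Rightarrow> real^'n \<Rightarrow> real^'n" where
  "average \<T> \<phi> x = (1/2) *\<^sub>R (\<Sum>\<kappa>\<in>{\<kappa>\<in>\<T>. x \<in> \<kappa>}. von_elem \<kappa> \<phi> x)"

definition lifting ::
  "nat \<Rightarrow> (real^'n) set \<Rightarrow> (real^'n) set set \<Rightarrow> (real^'n \<Rightarrow> real) \<Rightarrow> real^'n \<Rightarrow> real^'n" where
  "lifting l \<Omega> \<T> u =
     (SOME w. w \<in> broken_vpolys l \<Omega> \<T> \<and>
        (\<forall>\<phi>\<in>broken_vpolys l \<Omega> \<T>.
           (LINT x|lebesgue_on \<Omega>. w x \<bullet> \<phi> x) =
           - (LINT x|surface_on (Gamma_int \<Omega> \<T>). jump \<T> u x \<bullet> average \<T> \<phi> x)))"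

definition dg_grad ::
  "nat \<Rightarrow> (real^'n) set \<Rightarrow> (real^'n) set set \<Rightarrow> (real^'n \<Rightarrow> real) \<Rightarrow> real^'n \<Rightarrow> real^'n" where
  "dg_grad l \<Omega> \<T> v x = lifting l \<Omega> \<T> v x + broken_grad \<T> v x"


section \<open>Functionals, saddle points and the algorithm\<close>

definition energy_F ::
  "(real^'n) set \<Rightarrow> (real^'n \<Rightarrow> real) \<Rightarrow> (real^'n \<Rightarrow> real^'n) \<Rightarrow> real" where
  "energy_F \<Omega> p q = (LINT x|lebesgue_on \<Omega>. norm (q x) powr p x)"

text \<open>\<open>g\<close> is the trace of the Dirichlet datum.\<close>

definition energy_G ::
  "(real^'n) set \<Rightarrow> (real^'n) set set \<Rightarrow> (real^'n \<Rightarrow> real) \<Rightarrow> (real^'n \<Rightarrow> real) \<Rightarrow>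
   (real^'n \<Rightarrow> real) \<Rightarrow> (real^'n \<Rightarrow> real) \<Rightarrow> real" where
  "energy_G \<Omega> \<T> p \<xi> g v =
     (LINT x|lebesgue_on \<Omega>. \<bar>v x - \<xi> x\<bar>\<^sup>2) +
     (LINT x|surface_on (Gamma_int \<Omega> \<T>).
        (norm (jump \<T> v x))\<^sup>2 * face_size \<Omega> \<T> x powr (- 2 / conj_exponent p x)) +
     (LINT x|surface_on (frontier \<Omega>).
        \<bar>bdry_trace \<T> v x - g x\<bar>\<^sup>2 * face_size \<Omega> \<T> x powr (- 2 / conj_exponent p x))"

definition aug_lagrangian ::
  "(real^'n) set \<Rightarrow> ((real^'n \<Rightarrow> real^'n) \<Rightarrow> real) \<Rightarrow> ((real^'n \<Rightarrow> real) \<Rightarrow> real) \<Rightarrow>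
   ((real^'n \<Rightarrow> real) \<Rightarrow> real^'n \<Rightarrow> real^'n) \<Rightarrow> real \<Rightarrow>
   (real^'n \<Rightarrow> real) \<Rightarrow> (real^'n \<Rightarrow> real^'n) \<Rightarrow> (real^'n \<Rightarrow> real^'n) \<Rightarrow> real" where
  "aug_lagrangian \<Omega> F G B r v q \<mu> =
     F q + G v + L2_inner (lebesgue_on \<Omega>) \<mu> (\<lambda>x. B v x - q x) +
     r / 2 * (L2_norm (lebesgue_on \<Omega>) (\<lambda>x. B v x - q x))\<^sup>2"

definition saddle_point ::
  "'v set \<Rightarrow> 'q set \<Rightarrow> ('v \<Rightarrow> 'q \<Rightarrow> 'q \<Rightarrow> real) \<Rightarrow> 'v \<Rightarrow> 'q \<Rightarrow> 'q \<Rightarrow> bool" where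
  "saddle_point V H L u \<eta> \<mu>0 \<longleftrightarrow>
     u \<in> V \<and> \<eta> \<in> H \<and> \<mu>0 \<in> H \<and>
     (\<forall>v\<in>V. \<forall>q\<in>H. \<forall>\<mu>\<in>H. L u \<eta> \<mu> \<le> L u \<eta> \<mu>0 \<and> L u \<eta> \<mu>0 \<le> L v q \<mu>0)"

text \<open>
  \<open>un 0\<close> and \<open>lam 0\<close> are not used. The multiplier update is an identity in \<open>H\<close>,
  that is, almost everywhere.
\<close>

definition algorithm2 ::
  "(real^'n) set \<Rightarrow> (real^'n \<Rightarrow> real) set \<Rightarrow> (real^'n \<Rightarrow> real^'n) set \<Rightarrow>
   ((real^'n \<Rightarrow> real^'n) \<Rightarrow> real) \<Rightarrow> ((real^'n \<Rightarrow> real) \<Rightarrow> real) \<Rightarrow>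
   ((real^'n \<Rightarrow> real) \<Rightarrow> real^'n \<Rightarrow> real^'n) \<Rightarrow> real \<Rightarrow> (nat \<Rightarrow> real) \<Rightarrow>
   (nat \<Rightarrow> real^'n \<Rightarrow> real) \<Rightarrow> (nat \<Rightarrow> real^'n \<Rightarrow> real^'n) \<Rightarrow> (nat \<Rightarrow> real^'n \<Rightarrow> real^'n) \<Rightarrow> bool" where
  "algorithm2 \<Omega> V H F G B r \<rho> un \<eta>n lam \<longleftrightarrow>
     \<eta>n 0 \<in> H \<and> lam 1 \<in> H \<and>
     (\<forall>n\<ge>1.
        un n \<in> V \<and> \<eta>n n \<in> H \<and> lam (Suc n) \<in> H \<and> 0 < \<rho> n \<and>
        (\<forall>v\<in>V.
           G v - G (un n)
           + L2_inner (lebesgue_on \<Omega>) (lam n) (B (\<lambda>x. v x - un n x))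
           + r * L2_inner (lebesgue_on \<Omega>) (\<lambda>x. B (un n) x - \<eta>n (n - 1) x) (B (\<lambda>x. v x - un n x)) \<ge> 0) \<and>
        (\<forall>q\<in>H.
           F q - F (\<eta>n n)
           - L2_inner (lebesgue_on \<Omega>) (lam n) (\<lambda>x. q x - \<eta>n n x)
           + r * L2_inner (lebesgue_on \<Omega>) (\<lambda>x. \<eta>n n x - B (un n) x) (\<lambda>x. q x - \<eta>n n x) \<ge> 0) \<and>
        (AE x in lebesgue_on \<Omega>. lam (Suc n) x = lam n x + \<rho> n *\<^sub>R (B (un n) x - \<eta>n n x)))"

end

theory Submission
  imports Defs "HOL-Library.Function_Algebras"
begin

text \<open>
  Along the iteration, a combination of \<open>\<parallel>\<lambda>\<^sup>n - \<lambda>\<parallel>\<^sup>2\<close>, \<open>\<parallel>\<eta>\<^sup>n - \<eta>\<parallel>\<^sup>2\<close> and the squared residual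
  \<open>\<parallel>B u\<^sup>n - \<eta>\<^sup>n\<parallel>\<^sup>2\<close> decreases by at least a multiple of \<open>\<parallel>u\<^sup>n - u\<parallel>\<^sup>2 + \<parallel>B u\<^sup>n - \<eta>\<^sup>n\<parallel>\<^sup>2\<close>: the term in
  \<open>u\<^sup>n - u\<close> comes from the strong convexity of \<open>G\<close>, the residual from Glowinski's argument for step
  sizes below the golden ratio times \<open>r\<close>. Hence \<open>u\<^sup>n \<rightarrow> u\<close> in \<open>L\<^sup>2\<close> and the multipliers are bounded.

  Jumps, traces, lifting and elementwise gradient are bounded operators on \<open>V\<close> because on each of
  the finitely many elements all norms on polynomials of bounded degree are equivalent, so that
  \<open>\<bar>P x\<bar>\<close> and \<open>\<bar>\<nabla>P x\<bar>\<close> are at most a constant times the \<open>L\<^sup>2\<close> norm of \<open>P\<close> over the element, and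
  because the faces have finite surface measure. This gives the remaining limits. Whether the
  Hausdorff outer measure is a measure plays no role: a measure built from an outer measure that
  fails to be one is zero, so the outer measure is an upper bound in any case.
\<close>

section \<open>Semi-inner products\<close>

text \<open>Elements of the spaces are functions, not classes, and \<open>lifting\<close> chooses
  among functions that agree almost everywhere. So \<open>dg_grad\<close> is linear, and the
  multiplier update holds, only after pairing with a vector of the space. This is why the abstract
  part works with a semidefinite form on a subspace and why its hypotheses are stated for pairings.
  Only convexity is available for \<open>F\<close>, so \<open>F\<close> yields no estimate of
  \<open>\<eta>n n - \<eta>\<close>; that error has to come from \<open>B (un n) - B u\<close> and
  the residual. The strong convexity of \<open>G\<close> is used twice, in the inequality of the
  algorithm and in that of the saddle point, whence the factor 2 in front of \<open>s n\<close>. The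
  parameter \<open>r\<close> drops out of the saddle point inequalities: the residual of the saddle
  point is null, so along a segment the augmentation is of second order.\<close>

instantiation "fun" :: (type, real_vector) real_vector
begin

definition "c *\<^sub>R f = (\<lambda>x. c *\<^sub>R f x)"

instance
  by standard (simp_all add: scaleR_fun_def fun_eq_iff algebra_simps)

end

lemma scaleR_fun_apply [simp]: "(c *\<^sub>R f) x = c *\<^sub>R f x"
  by (simp add: scaleR_fun_def)

lemma sum_fun_apply: "(\<Sum>i\<in>I. f i) x = (\<Sum>i\<in>I. f i x)"
  for f :: "'i \<Rightarrow> 'a \<Rightarrow> 'b::comm_monoid_add"
  by (induction I rule: infinite_finite_induct) auto

text \<open>The laws are asked on \<open>V\<close> only, because the integral of a nonintegrable
  function is 0 by default and additivity breaks down there. Definiteness is left out: a nonzero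
  function can vanish almost everywhere.\<close>

locale semi_inner =
  fixes V :: "'a::real_vector set" and ip :: "'a \<Rightarrow> 'a \<Rightarrow> real"
  assumes subspace_V: "subspace V"
    and ip_add_left: "\<And>x y z. \<lbrakk>x \<in> V; y \<in> V; z \<in> V\<rbrakk> \<Longrightarrow> ip (x + y) z = ip x z + ip y z"
    and ip_scaleR_left: "\<And>c x y. \<lbrakk>x \<in> V; y \<in> V\<rbrakk> \<Longrightarrow> ip (c *\<^sub>R x) y = c * ip x y"
    and ip_commute: "\<And>x y. \<lbrakk>x \<in> V; y \<in> V\<rbrakk> \<Longrightarrow> ip x y = ip y x"
    and ip_nonneg: "\<And>x. x \<in> V \<Longrightarrow> 0 \<le> ip x x"
begin

lemma mem_closed:
  shows mem_zero: "0 \<in> V"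
    and mem_add: "x \<in> V \<Longrightarrow> y \<in> V \<Longrightarrow> x + y \<in> V"
    and mem_diff: "x \<in> V \<Longrightarrow> y \<in> V \<Longrightarrow> x - y \<in> V"
    and mem_scaleR: "x \<in> V \<Longrightarrow> c *\<^sub>R x \<in> V"
    and mem_uminus: "x \<in> V \<Longrightarrow> - x \<in> V"
    and mem_sum: "(\<And>i. i \<in> I \<Longrightarrow> f i \<in> V) \<Longrightarrow> sum f I \<in> V"
  using subspace_V
  by (auto intro: subspace_0 subspace_add subspace_diff subspace_scale subspace_neg subspace_sum)

lemma ip_add_right: "\<lbrakk>x \<in> V; y \<in> V; z \<in> V\<rbrakk> \<Longrightarrow> ip x (y + z) = ip x y + ip x z"
  by (metis ip_add_left ip_commute mem_add)

lemma ip_scaleR_right: "\<lbrakk>x \<in> V; y \<in> V\<rbrakk> \<Longrightarrow> ip x (c *\<^sub>R y) = c * ip x y"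
  by (metis ip_scaleR_left ip_commute mem_scaleR)

lemma ip_diff_left: "\<lbrakk>x \<in> V; y \<in> V; z \<in> V\<rbrakk> \<Longrightarrow> ip (x - y) z = ip x z - ip y z"
  using ip_add_left[of x "-1 *\<^sub>R y" z] ip_scaleR_left[of y z "-1"] by (simp add: mem_closed)

lemma ip_diff_right: "\<lbrakk>x \<in> V; y \<in> V; z \<in> V\<rbrakk> \<Longrightarrow> ip x (y - z) = ip x y - ip x z"
  by (metis ip_diff_left ip_commute mem_diff)

lemma ip_zero_left: "x \<in> V \<Longrightarrow> ip 0 x = 0"
  using ip_scaleR_left[of 0 x 0] mem_zero by simp

lemma ip_sum_left: "\<lbrakk>\<And>i. i \<in> I \<Longrightarrow> f i \<in> V; x \<in> V\<rbrakk> \<Longrightarrow> ip (sum f I) x = (\<Sum>i\<in>I. ip (f i) x)"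
  by (induction I rule: infinite_finite_induct) (auto simp: ip_zero_left ip_add_left mem_sum)

lemmas ip_bilinear =
  ip_add_left ip_add_right ip_scaleR_left ip_scaleR_right ip_diff_left ip_diff_right

text \<open>The usual discriminant argument, with a separate case for the nonzero null vectors that
  a semidefinite form allows.\<close>

lemma Cauchy_Schwarz_ip:
  assumes x: "x \<in> V" and y: "y \<in> V"
  shows "(ip x y)\<^sup>2 \<le> ip x x * ip y y"
proof -
  have exp: "ip (s *\<^sub>R x + t *\<^sub>R y) (s *\<^sub>R x + t *\<^sub>R y)
      = s\<^sup>2 * ip x x + 2 * s * t * ip x y + t\<^sup>2 * ip y y" for s t
    using x y by (simp add: ip_bilinear mem_closed ip_commute[of y x] power2_eq_square algebra_simps)
  have nn: "0 \<le> s\<^sup>2 * ip x x + 2 * s * t * ip x y + t\<^sup>2 * ip y y" for s t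
    unfolding exp[symmetric] by (rule ip_nonneg) (simp add: x y mem_closed)
  show ?thesis
  proof (cases "ip y y = 0")
    case True
    have "ip x y = 0"
    proof (rule ccontr)
      assume "ip x y \<noteq> 0"
      \<comment> \<open>This coefficient makes the quadratic in \<open>nn\<close> equal to
        -1.\<close>
      then show False
        using nn[of 1 "- (ip x x + 1) / (2 * ip x y)"] True by (simp add: field_simps)
    qed
    then show ?thesis using True by simp
  next
    case False
    then have pos: "ip y y > 0" using ip_nonneg[OF y] by simp
    \<comment> \<open>The coefficients are those of the component of \<open>x\<close> orthogonal to
      \<open>y\<close>, multiplied by \<open>ip y y\<close> to avoid a division.\<close>
    have "0 \<le> (ip y y)\<^sup>2 * ip x x - (ip x y)\<^sup>2 * ip y y"
      using nn[of "ip y y" "- ip x y"] by (simp add: power2_eq_square algebra_simps)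
    then have "0 \<le> ip y y * (ip y y * ip x x - (ip x y)\<^sup>2)"
      by (simp add: power2_eq_square algebra_simps)
    then show ?thesis
      using pos by (simp add: zero_le_mult_iff algebra_simps)
  qed
qed

lemma abs_ip_le:
  assumes "x \<in> V" "y \<in> V"
  shows "\<bar>ip x y\<bar> \<le> sqrt (ip x x) * sqrt (ip y y)"
  using Cauchy_Schwarz_ip[OF assms] by (metis real_sqrt_abs real_sqrt_le_iff real_sqrt_mult)

lemma ip_null_left: "\<lbrakk>x \<in> V; y \<in> V; ip x x = 0\<rbrakk> \<Longrightarrow> ip x y = 0"
  using abs_ip_le[of x y] by simp

lemma sqrt_ip_triangle:
  assumes x: "x \<in> V" and y: "y \<in> V"
  shows "sqrt (ip (x + y) (x + y)) \<le> sqrt (ip x x) + sqrt (ip y y)"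
proof -
  have "ip (x + y) (x + y) = ip x x + 2 * ip x y + ip y y"
    using x y by (simp add: ip_bilinear mem_closed ip_commute[of y x])
  also have "\<dots> \<le> (sqrt (ip x x) + sqrt (ip y y))\<^sup>2"
    using abs_ip_le[OF x y] by (simp add: power2_sum ip_nonneg x y)
  finally have "sqrt (ip (x + y) (x + y)) \<le> \<bar>sqrt (ip x x) + sqrt (ip y y)\<bar>"
    using real_le_lsqrt real_sqrt_le_iff real_sqrt_abs by (metis real_sqrt_le_mono)
  then show ?thesis by (simp add: ip_nonneg x y)
qed

text \<open>Gram-Schmidt along the finite set \<open>S\<close>, one vector at a time. Definiteness
  lets a nonzero remainder be normalized; a zero remainder adds nothing to the basis.\<close>

lemma orthonormal_expansion:
  assumes definite: "\<And>x. x \<in> V \<Longrightarrow> ip x x = 0 \<Longrightarrow> x = 0"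
    and "finite S" "S \<subseteq> V"
  shows "\<exists>E. finite E \<and> E \<subseteq> V \<and> (\<forall>e\<in>E. \<forall>e'\<in>E. ip e e' = (if e = e' then 1 else 0)) \<and>
    (\<forall>x\<in>span S. x = (\<Sum>e\<in>E. ip x e *\<^sub>R e))"
  using assms(2,3)
proof (induction S)
  case empty
  then show ?case by (intro exI[of _ "{}"]) auto
next
  case (insert s S)
  then obtain E where E: "finite E" "E \<subseteq> V"
    "\<And>e e'. e \<in> E \<Longrightarrow> e' \<in> E \<Longrightarrow> ip e e' = (if e = e' then 1 else 0)"
    and rep: "\<And>x. x \<in> span S \<Longrightarrow> x = (\<Sum>e\<in>E. ip x e *\<^sub>R e)"
    by (metis insert_subset)
  have sV: "s \<in> V" using insert.prems by auto
  define w where "w = s - (\<Sum>e\<in>E. ip s e *\<^sub>R e)"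
  have eV: "e \<in> V" if "e \<in> E" for e using E(2) that by auto
  have wV: "w \<in> V" by (simp add: w_def mem_closed sV eV)
  have w_orth: "ip w e = 0" if "e \<in> E" for e
  proof -
    have "ip (\<Sum>e'\<in>E. ip s e' *\<^sub>R e') e = (\<Sum>e'\<in>E. ip s e' * ip e' e)"
      using that eV by (subst ip_sum_left) (auto simp: ip_scaleR_left mem_closed)
    also have "\<dots> = (\<Sum>e'\<in>E. if e' = e then ip s e' else 0)"
      using that by (intro sum.cong) (auto simp: E(3))
    also have "\<dots> = ip s e" using that E(1) by simp
    finally show ?thesis
      using that sV eV by (simp add: w_def ip_diff_left mem_closed)
  qed
  define E' where "E' = (if w = 0 then E else insert ((1 / sqrt (ip w w)) *\<^sub>R w) E)"
  have pos: "ip w w > 0" if "w \<noteq> 0"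
    using definite[OF wV] ip_nonneg[OF wV] that by force
  let ?f = "(1 / sqrt (ip w w)) *\<^sub>R w"
  have f1: "ip ?f ?f = 1" if "w \<noteq> 0"
    using pos[OF that] wV by (simp add: ip_bilinear mem_closed)
  have f0: "ip ?f e = 0" "ip e ?f = 0" if "e \<in> E" for e
    using w_orth[OF that] eV[OF that] wV ip_commute[of w e] by (auto simp: ip_bilinear mem_closed)
  have fE: "?f \<notin> E" if "w \<noteq> 0" using f0(1) f1[OF that] by force
  have E': "finite E'" "E' \<subseteq> V"
    "\<And>e e'. e \<in> E' \<Longrightarrow> e' \<in> E' \<Longrightarrow> ip e e' = (if e = e' then 1 else 0)"
    using E f1 f0 fE wV by (auto simp: E'_def mem_closed split: if_splits)
  \<comment> \<open>The vectors that equal their own expansion form a subspace. It contains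
    \<open>E'\<close> by orthonormality, hence all of \<open>span E'\<close>, which in turn contains
    \<open>s\<close> and \<open>S\<close>.\<close>
  let ?W = "{x\<in>V. x = (\<Sum>e\<in>E'. ip x e *\<^sub>R e)}"
  have e'V: "e \<in> V" if "e \<in> E'" for e using E'(2) that by auto
  have sub: "subspace ?W"
    unfolding subspace_def
  proof (intro conjI ballI allI)
    show "0 \<in> ?W" using e'V by (auto simp: mem_closed ip_zero_left)
    show "x + y \<in> ?W" if "x \<in> ?W" "y \<in> ?W" for x y
    proof -
      have "(\<Sum>e\<in>E'. ip (x + y) e *\<^sub>R e) = (\<Sum>e\<in>E'. ip x e *\<^sub>R e) + (\<Sum>e\<in>E'. ip y e *\<^sub>R e)"
        using that e'V by (auto simp: ip_add_left scaleR_add_left sum.distrib)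
      then show ?thesis using that by (auto simp: mem_closed)
    qed
    show "c *\<^sub>R x \<in> ?W" if "x \<in> ?W" for c x
    proof -
      have xV: "x \<in> V" using that by simp
      have "(\<Sum>e\<in>E'. ip (c *\<^sub>R x) e *\<^sub>R e) = c *\<^sub>R (\<Sum>e\<in>E'. ip x e *\<^sub>R e)"
        by (simp add: ip_scaleR_left e'V xV scaleR_sum_right cong: sum.cong)
      then show ?thesis using that by (auto simp: mem_closed)
    qed
  qed
  have EW: "E' \<subseteq> ?W"
  proof
    fix e assume e: "e \<in> E'"
    have "(\<Sum>e'\<in>E'. ip e e' *\<^sub>R e') = (\<Sum>e'\<in>E'. if e' = e then e' else 0)"
      using e by (intro sum.cong) (auto simp: E'(3))
    then show "e \<in> ?W" using e e'V E'(1) by simp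
  qed
  have spW: "span E' \<subseteq> ?W" by (rule span_minimal[OF EW sub])
  have "E \<subseteq> E'" by (auto simp: E'_def)
  have "w \<in> span E'"
  proof (cases "w = 0")
    case False
    then have "?f \<in> span E'" by (intro span_base) (simp add: E'_def)
    from span_scale[OF this, of "sqrt (ip w w)"] show ?thesis using pos[OF False] by simp
  qed (simp add: span_zero)
  moreover have "(\<Sum>e\<in>E. ip s e *\<^sub>R e) \<in> span E'"
    using \<open>E \<subseteq> E'\<close> by (intro span_sum span_scale) (auto intro: span_base)
  ultimately have "s \<in> span E'"
    by (metis w_def add.commute diff_add_cancel span_add)
  moreover have "S \<subseteq> span E'"
  proof
    fix x assume "x \<in> S"
    then have "x = (\<Sum>e\<in>E. ip x e *\<^sub>R e)" using rep by (simp add: span_base)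
    also have "\<dots> \<in> span E'"
      using \<open>E \<subseteq> E'\<close> by (intro span_sum span_scale) (auto intro: span_base)
    finally show "x \<in> span E'" .
  qed
  ultimately have "span (insert s S) \<subseteq> span E'" by (simp add: span_minimal)
  then show ?case using E' spW by (intro exI[of _ E']) auto
qed

section \<open>Convergence of the alternating direction method\<close>

text \<open>A decreasing sequence bounded below converges, so its decrements tend to 0, and with
  them whatever lies between 0 and the decrements.\<close>

lemma tendsto_zero_if_le_decrease:
  fixes X f :: "nat \<Rightarrow> real"
  assumes X: "\<And>n. 0 \<le> X n" and f: "\<And>n. 0 \<le> f n" "\<And>n. f n \<le> X n - X (Suc n)"
  shows "f \<longlonglongrightarrow> 0"
proof -
  have "decseq X" using f by (intro decseq_SucI) (smt (verit))
  then obtain L where L: "X \<longlonglongrightarrow> L" using decseq_convergent[of X 0] X by blast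
  then have "(\<lambda>n. X n - X (Suc n)) \<longlonglongrightarrow> L - L"
    by (intro tendsto_diff) (auto simp: LIMSEQ_Suc)
  then have g: "(\<lambda>n. X n - X (Suc n)) \<longlonglongrightarrow> 0" by simp
  show ?thesis by (rule tendsto_sandwich[OF _ _ tendsto_const g]) (auto simp: f)
qed

text \<open>
  The variables are the errors \<open>b n = B u\<^sup>n - B u\<close>, \<open>e n = \<eta>\<^sup>n - \<eta>\<close> and
  \<open>m n = \<lambda>\<^sup>n - \<lambda>\<close>, and \<open>s n\<close> is the squared error of \<open>u\<^sup>n\<close>. The Lyapunov function
  is Glowinski's energy of the multiplier and the auxiliary variable, augmented by a multiple
  of the last residual; the multiple pays for the cross term between consecutive
  steps exactly when \<open>\<rho>\<close> is below the golden ratio times \<open>r\<close>. The multiplier update is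
  tested against vectors because it holds only almost everywhere.
\<close>

lemma alternating_direction_decay:
  fixes b e m :: "nat \<Rightarrow> 'a" and s :: "nat \<Rightarrow> real" and r \<rho> :: real
  assumes r: "0 < r" and rho: "0 < \<rho>" "\<rho>\<^sup>2 < r\<^sup>2 + r * \<rho>"
    and mem: "\<And>n. 1 \<le> n \<Longrightarrow> b n \<in> V" "\<And>n. e n \<in> V" "\<And>n. 1 \<le> n \<Longrightarrow> m n \<in> V"
    and s: "\<And>n. 1 \<le> n \<Longrightarrow> 0 \<le> s n"
    and vi_b: "\<And>n. 1 \<le> n \<Longrightarrow>
      2 * s n \<le> - ip (m n) (b n) - r * ip (b n - e (n - 1)) (b n)"
    and vi_e: "\<And>n. 1 \<le> n \<Longrightarrow> 0 \<le> ip (m n) (e n) - r * ip (e n - b n) (e n)"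
    and vi_e_step: "\<And>n. 1 \<le> n \<Longrightarrow>
      0 \<le> ip (m (Suc n) - m n) (e (Suc n) - e n)
        + r * ip ((b (Suc n) - e (Suc n)) - (b n - e n)) (e (Suc n) - e n)"
    and update: "\<And>n x. 1 \<le> n \<Longrightarrow> x \<in> V \<Longrightarrow>
      ip (m (Suc n)) x = ip (m n) x + \<rho> * ip (b n - e n) x"
  shows "s \<longlonglongrightarrow> 0"
    and "(\<lambda>n. ip (b n - e n) (b n - e n)) \<longlonglongrightarrow> 0"
    and "\<exists>C. \<forall>n\<ge>1. ip (m n) (m n) \<le> C"
proof -
  define d where "d n = b n - e n" for n
  \<comment> \<open>\<open>\<beta>\<close> is the coefficient of the old residual in the square
    completed at \<open>sq\<close>; \<open>c\<close> is what remains of the coefficient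
    \<open>\<rho> * (2 * r - \<rho>)\<close> of the new residual once \<open>\<beta>\<close> is
    paid. Positivity of \<open>c\<close> is the golden ratio condition.\<close>
  define \<beta> where "\<beta> = \<rho> * (r - \<rho>)\<^sup>2 / r"
  define c where "c = \<rho> * (2 * r - \<rho>) - \<beta>"
  have c: "0 < c"
  proof -
    have "r * c = \<rho> * (r\<^sup>2 + r * \<rho> - \<rho>\<^sup>2)"
      using r by (simp add: c_def \<beta>_def power2_eq_square field_simps)
    also have "\<dots> > 0" using rho by simp
    finally show ?thesis using r by (simp add: zero_less_mult_iff)
  qed
  have \<beta>: "0 \<le> \<beta>" using r rho by (simp add: \<beta>_def)
  have dV: "d n \<in> V" if "1 \<le> n" for n using mem that by (simp add: d_def mem_closed)
  \<comment> \<open>The multiplier error enters with index \<open>n\<close>, the other two errors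
    with index \<open>n - 1\<close>: these are known when step \<open>n\<close> starts. Since
    \<open>b 0\<close> need not lie in \<open>V\<close>, the energy is used from index 2 on.\<close>
  define X where "X n = ip (m n) (m n) + \<rho> * r * ip (e (n - 1)) (e (n - 1))
    + \<beta> * ip (d (n - 1)) (d (n - 1))" for n
  have X_nonneg: "0 \<le> X n" if "2 \<le> n" for n
    using that mem dV r rho \<beta> by (auto simp: X_def intro!: add_nonneg_nonneg mult_nonneg_nonneg ip_nonneg)
  have decay: "4 * \<rho> * s (Suc n) + c * ip (d (Suc n)) (d (Suc n)) \<le> X (Suc n) - X (Suc (Suc n))"
    if n: "1 \<le> n" for n
  proof -
    let ?k = "Suc n"
    define D where "D = e ?k - e n"
    have V: "b ?k \<in> V" "e ?k \<in> V" "e n \<in> V" "m ?k \<in> V" "m n \<in> V" "d n \<in> V" "d ?k \<in> V"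
      "m (Suc ?k) \<in> V" "b n \<in> V" "D \<in> V"
      using mem dV n by (auto simp: D_def mem_closed)
    have upd: "ip (m (Suc ?k)) x = ip (m ?k) x + \<rho> * ip (d ?k) x" if "x \<in> V" for x
      using update[of ?k x] that by (simp add: d_def)
    have "ip (m (Suc ?k)) (m (Suc ?k)) = ip (m ?k) (m (Suc ?k)) + \<rho> * ip (d ?k) (m (Suc ?k))"
      using V upd by simp
    also have "\<dots> = ip (m (Suc ?k)) (m ?k) + \<rho> * ip (m (Suc ?k)) (d ?k)"
      using V ip_commute by simp
    finally have lam: "ip (m (Suc ?k)) (m (Suc ?k))
        = ip (m ?k) (m ?k) + 2 * \<rho> * ip (m ?k) (d ?k) + \<rho>\<^sup>2 * ip (d ?k) (d ?k)"
      using V upd ip_commute[of "d ?k" "m ?k"] by (simp add: power2_eq_square algebra_simps)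
    \<comment> \<open>Sum of \<open>vi_b\<close> and \<open>vi_e\<close> at \<open>?k\<close>. With
      \<open>d = b - e\<close> the quadratic terms collapse to the squared residual and one pairing
      with the increment \<open>D\<close>.\<close>
    have A: "2 * s ?k + r * ip (d ?k) (d ?k) + r * ip D (b ?k) \<le> - ip (m ?k) (d ?k)"
    proof -
      have "2 * s ?k \<le> - ip (m ?k) (b ?k) - r * ip (b ?k - e n) (b ?k)"
        "0 \<le> ip (m ?k) (e ?k) - r * ip (e ?k - b ?k) (e ?k)"
        using vi_b[of ?k] vi_e[of ?k] by auto
      then show ?thesis
        using V(1-5) ip_commute[of "e ?k" "b ?k"]
        by (simp add: d_def D_def ip_bilinear mem_closed algebra_simps)
    qed
    \<comment> \<open>Write \<open>b ?k = d ?k + e ?k\<close>; the pairing of \<open>D\<close> with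
      \<open>e ?k\<close> telescopes by polarization.\<close>
    have Bb: "2 * ip D (b ?k) = 2 * ip (d ?k) D + ip (e ?k) (e ?k) - ip (e n) (e n) + ip D D"
      using V(1-3) ip_commute[of "e ?k" "b ?k"] ip_commute[of "e n" "b ?k"] ip_commute[of "e n" "e ?k"]
      by (simp add: d_def D_def ip_bilinear mem_closed algebra_simps)
    \<comment> \<open>Monotonicity between consecutive steps. The multiplier increment is
      \<open>\<rho>\<close> times the old residual, so the pairing of the new residual with
      \<open>D\<close> is bounded below by one of the old residual.\<close>
    have Cc: "(r - \<rho>) * ip (d n) D \<le> r * ip (d ?k) D"
    proof -
      have "ip (m ?k - m n) D = \<rho> * ip (d n) D"
        using V update[OF n, of D] by (simp add: ip_diff_left d_def)
      moreover have "ip (d ?k - d n) D = ip (d ?k) D - ip (d n) D"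
        using V by (simp add: ip_diff_left)
      ultimately show ?thesis
        using vi_e_step[OF n, folded d_def D_def] by (simp add: right_diff_distrib left_diff_distrib)
    qed
    \<comment> \<open>This square, scaled by \<open>\<rho> / r\<close>, absorbs the cross term of
      unknown sign into \<open>\<rho> * r * ip D D\<close> and the old residual.\<close>
    have "0 \<le> ip (r *\<^sub>R D + (r - \<rho>) *\<^sub>R d n) (r *\<^sub>R D + (r - \<rho>) *\<^sub>R d n)"
      by (rule ip_nonneg) (simp add: V mem_closed)
    also have "\<dots> = r\<^sup>2 * ip D D + 2 * r * (r - \<rho>) * ip (d n) D + (r - \<rho>)\<^sup>2 * ip (d n) (d n)"
      using V(6,10) ip_commute[of D "d n"]
      by (simp add: ip_bilinear mem_closed power2_eq_square algebra_simps)
    finally have "0 \<le> (\<rho> / r) *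
        (r\<^sup>2 * ip D D + 2 * r * (r - \<rho>) * ip (d n) D + (r - \<rho>)\<^sup>2 * ip (d n) (d n))"
      using r rho by (intro mult_nonneg_nonneg) auto
    also have "\<dots> = \<rho> * r * ip D D + 2 * \<rho> * ((r - \<rho>) * ip (d n) D) + \<beta> * ip (d n) (d n)"
      using r by (simp add: \<beta>_def power2_eq_square field_simps)
    finally have sq: "0 \<le> \<rho> * r * ip D D + 2 * \<rho> * ((r - \<rho>) * ip (d n) D) + \<beta> * ip (d n) (d n)" .
    have A': "2 * \<rho> * (2 * s ?k + r * ip (d ?k) (d ?k) + r * ip D (b ?k)) \<le> 2 * \<rho> * (- ip (m ?k) (d ?k))"
      using rho by (intro mult_left_mono[OF A]) simp
    have C': "2 * \<rho> * ((r - \<rho>) * ip (d n) D) \<le> 2 * \<rho> * (r * ip (d ?k) D)"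
      using rho by (intro mult_left_mono[OF Cc]) simp
    have B': "2 * \<rho> * (r * ip D (b ?k)) =
       2 * \<rho> * (r * ip (d ?k) D) + \<rho> * r * ip (e ?k) (e ?k) - \<rho> * r * ip (e n) (e n) + \<rho> * r * ip D D"
    proof -
      have "2 * \<rho> * (r * ip D (b ?k)) = \<rho> * r * (2 * ip D (b ?k))" by simp
      also have "\<dots> = \<rho> * r * (2 * ip (d ?k) D + ip (e ?k) (e ?k) - ip (e n) (e n) + ip D D)"
        by (simp only: Bb)
      finally show ?thesis by (simp add: algebra_simps)
    qed
    show ?thesis
      using lam A' B' C' sq by (simp add: X_def c_def power2_eq_square algebra_simps)
  qed
  have s2: "0 \<le> s (Suc (Suc n))" "0 \<le> ip (d (Suc (Suc n))) (d (Suc (Suc n)))" for n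
    using s dV by (auto intro: ip_nonneg)
  have dec: "4 * \<rho> * s (Suc (Suc n)) + c * ip (d (Suc (Suc n))) (d (Suc (Suc n)))
      \<le> X (Suc (Suc n)) - X (Suc (Suc (Suc n)))" for n
    by (rule decay) simp
  have pos: "0 \<le> 4 * \<rho> * s (Suc (Suc n))" "0 \<le> c * ip (d (Suc (Suc n))) (d (Suc (Suc n)))" for n
    using s2[of n] c rho by auto
  have lim: "(\<lambda>n. 4 * \<rho> * s (Suc (Suc n)) + c * ip (d (Suc (Suc n))) (d (Suc (Suc n)))) \<longlonglongrightarrow> 0"
    by (rule tendsto_zero_if_le_decrease[where X = "\<lambda>n. X (Suc (Suc n))"])
      (use X_nonneg dec pos in \<open>auto intro: add_nonneg_nonneg\<close>)
  have "(\<lambda>n. 4 * \<rho> * s (Suc (Suc n))) \<longlonglongrightarrow> 0"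
    by (rule tendsto_sandwich[OF _ _ tendsto_const lim]) (auto simp: pos)
  from tendsto_mult_left[OF this, of "1 / (4 * \<rho>)"] have "(\<lambda>n. s (Suc (Suc n))) \<longlonglongrightarrow> 0"
    using rho by simp
  then show "s \<longlonglongrightarrow> 0" using filterlim_sequentially_Suc[of s] filterlim_sequentially_Suc[of "\<lambda>n. s (Suc n)"] by simp
  have "(\<lambda>n. c * ip (d (Suc (Suc n))) (d (Suc (Suc n)))) \<longlonglongrightarrow> 0"
    by (rule tendsto_sandwich[OF _ _ tendsto_const lim]) (auto simp: pos)
  from tendsto_mult_left[OF this, of "1 / c"] have "(\<lambda>n. ip (d (Suc (Suc n))) (d (Suc (Suc n)))) \<longlonglongrightarrow> 0"
    using c by simp
  then have "(\<lambda>n. ip (d n) (d n)) \<longlonglongrightarrow> 0"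
    using filterlim_sequentially_Suc[of "\<lambda>n. ip (d n) (d n)"]
      filterlim_sequentially_Suc[of "\<lambda>n. ip (d (Suc n)) (d (Suc n))"] by simp
  then show "(\<lambda>n. ip (b n - e n) (b n - e n)) \<longlonglongrightarrow> 0" by (simp add: d_def)
  have "X (Suc (Suc (Suc n))) \<le> X (Suc (Suc n))" for n
    using dec[of n] pos[of n] by linarith
  then have "decseq (\<lambda>n. X (Suc (Suc n)))" by (intro decseq_SucI)
  then have X_le: "X (Suc (Suc n)) \<le> X (Suc (Suc 0))" for n
    using decseqD[of "\<lambda>n. X (Suc (Suc n))" 0 n] by simp
  \<comment> \<open>The first multiplier precedes the range on which the energy decreases, hence the
    maximum.\<close>
  have "ip (m n) (m n) \<le> max (ip (m 1) (m 1)) (X (Suc (Suc 0)))" if "1 \<le> n" for n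
  proof (cases "n = 1")
    case False
    define j where "j = n - 2"
    have j: "n = Suc (Suc j)" using that False by (simp add: j_def)
    have "0 \<le> \<rho> * r * ip (e (n - 1)) (e (n - 1)) + \<beta> * ip (d (n - 1)) (d (n - 1))"
      using j mem dV r rho \<beta> by (auto intro!: add_nonneg_nonneg mult_nonneg_nonneg ip_nonneg)
    then have "ip (m n) (m n) \<le> X n" by (simp add: X_def)
    then show ?thesis using X_le[of j] j by simp
  qed simp
  then show "\<exists>C. \<forall>n\<ge>1. ip (m n) (m n) \<le> C" by blast
qed

end

section \<open>Surface measure of polyhedral boundaries\<close>

text \<open>The finite family is padded to a sequence by empty sets. Their gauge is 0 by definition,
  even for \<open>s = 0\<close>, and their diameter is 0, which is admissible because
  \<open>\<delta>\<close> is nonnegative.\<close>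

lemma hausdorff_pre_le_finite_cover:
  assumes "finite \<U>" "A \<subseteq> \<Union>\<U>" "0 \<le> \<delta>"
    and "\<And>U. U \<in> \<U> \<Longrightarrow> bounded U \<and> diameter U \<le> \<delta>"
  shows "hausdorff_pre s \<delta> A \<le> (\<Sum>U\<in>\<U>. hausdorff_gauge s U)"
proof -
  obtain f where f: "bij_betw f {0..<card \<U>} \<U>"
    using ex_bij_betw_nat_finite[OF assms(1)] by blast
  define W where "W i = (if i < card \<U> then f i else {})" for i
  have W: "W i \<in> \<U>" if "i < card \<U>" for i
    using f that by (auto simp: W_def bij_betw_def)
  have "(\<Sum>i. hausdorff_gauge s (W i)) = (\<Sum>i\<in>{0..<card \<U>}. hausdorff_gauge s (W i))"
    by (rule suminf_finite) (auto simp: W_def hausdorff_gauge_def)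
  also have "\<dots> = (\<Sum>i\<in>{0..<card \<U>}. hausdorff_gauge s (f i))"
    by (intro sum.cong) (auto simp: W_def)
  also have "\<dots> = (\<Sum>U\<in>\<U>. hausdorff_gauge s U)"
    by (rule sum.reindex_bij_betw[OF f])
  finally have eq: "(\<Sum>i. hausdorff_gauge s (W i)) = (\<Sum>U\<in>\<U>. hausdorff_gauge s U)" .
  have "A \<subseteq> (\<Union>i. W i)"
  proof
    fix x assume "x \<in> A"
    then obtain U where "U \<in> \<U>" "x \<in> U" using assms(2) by auto
    moreover then obtain i where "i < card \<U>" "f i = U"
      using bij_betw_imp_surj_on[OF f] by (metis atLeastLessThan_iff imageE)
    ultimately show "x \<in> (\<Union>i. W i)" by (auto simp: W_def intro!: exI[of _ i])
  qed
  moreover have "bounded (W i) \<and> diameter (W i) \<le> \<delta>" for i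
    using assms(3,4) W[of i] by (cases "i < card \<U>") (auto simp: W_def)
  ultimately have "hausdorff_pre s \<delta> A \<le> (\<Sum>i. hausdorff_gauge s (W i))"
    unfolding hausdorff_pre_def by (intro INF_lower) auto
  then show ?thesis using eq by simp
qed

text \<open>One constant must serve all scales \<open>\<delta>\<close>, and the covers are finite.
  This certificate of finite outer measure passes to subsets and finite unions by plain set
  manipulation, without subadditivity of \<open>hausdorff_outer\<close>.\<close>

definition finite_content :: "real \<Rightarrow> 'a::metric_space set \<Rightarrow> bool" where
  "finite_content s A \<longleftrightarrow>
     (\<exists>C. \<forall>\<delta>>0. \<exists>\<U>. finite \<U> \<and> A \<subseteq> \<Union>\<U> \<and> (\<forall>U\<in>\<U>. bounded U \<and> diameter U \<le> \<delta>) \<and>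
        (\<Sum>U\<in>\<U>. hausdorff_gauge s U) \<le> ennreal C)"

lemma hausdorff_outer_finite:
  assumes "finite_content s A"
  shows "hausdorff_outer s A < \<infinity>"
proof -
  obtain C where C: "\<And>\<delta>. 0 < \<delta> \<Longrightarrow> \<exists>\<U>. finite \<U> \<and> A \<subseteq> \<Union>\<U> \<and>
      (\<forall>U\<in>\<U>. bounded U \<and> diameter U \<le> \<delta>) \<and> (\<Sum>U\<in>\<U>. hausdorff_gauge s U) \<le> ennreal C"
    using assms unfolding finite_content_def by blast
  have "hausdorff_pre s \<delta> A \<le> ennreal C" if pos: "0 < \<delta>" for \<delta>
  proof -
    obtain \<U> where U: "finite \<U>" "A \<subseteq> \<Union>\<U>" "\<forall>U\<in>\<U>. bounded U \<and> diameter U \<le> \<delta>"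
      "(\<Sum>U\<in>\<U>. hausdorff_gauge s U) \<le> ennreal C" using C[OF pos] by blast
    have "hausdorff_pre s \<delta> A \<le> (\<Sum>U\<in>\<U>. hausdorff_gauge s U)"
      using U pos by (intro hausdorff_pre_le_finite_cover) auto
    then show ?thesis using U(4) by (rule order_trans)
  qed
  then have "hausdorff_outer s A \<le> ennreal C"
    unfolding hausdorff_outer_def by (intro SUP_least) auto
  then show ?thesis by (simp add: le_less_trans)
qed

lemma finite_content_empty: "finite_content s {}"
  unfolding finite_content_def by (auto intro!: exI[of _ "0::real"] exI[of _ "{}"])

lemma finite_content_subset: "finite_content s B \<Longrightarrow> A \<subseteq> B \<Longrightarrow> finite_content s A"
  unfolding finite_content_def by (meson order_trans)

lemma finite_content_Un:
  assumes "finite_content s A" "finite_content s B"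
  shows "finite_content s (A \<union> B)"
proof -
  obtain C where C: "\<And>\<delta>. 0 < \<delta> \<Longrightarrow> \<exists>\<U>. finite \<U> \<and> A \<subseteq> \<Union>\<U> \<and>
      (\<forall>U\<in>\<U>. bounded U \<and> diameter U \<le> \<delta>) \<and> (\<Sum>U\<in>\<U>. hausdorff_gauge s U) \<le> ennreal C"
    using assms(1) unfolding finite_content_def by blast
  obtain D where D: "\<And>\<delta>. 0 < \<delta> \<Longrightarrow> \<exists>\<U>. finite \<U> \<and> B \<subseteq> \<Union>\<U> \<and>
      (\<forall>U\<in>\<U>. bounded U \<and> diameter U \<le> \<delta>) \<and> (\<Sum>U\<in>\<U>. hausdorff_gauge s U) \<le> ennreal D"
    using assms(2) unfolding finite_content_def by blast
  show ?thesis unfolding finite_content_def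
  \<comment> \<open>\<open>C\<close> and \<open>D\<close> may be negative, where
    \<open>ennreal\<close> truncates to 0 and is not additive.\<close>
  proof (intro exI[of _ "max 0 C + max 0 D"] allI impI)
    fix \<delta> :: real assume "0 < \<delta>"
    obtain \<U> where U: "finite \<U>" "A \<subseteq> \<Union>\<U>" "\<forall>U\<in>\<U>. bounded U \<and> diameter U \<le> \<delta>"
      "(\<Sum>U\<in>\<U>. hausdorff_gauge s U) \<le> ennreal C" using C[OF \<open>0 < \<delta>\<close>] by blast
    obtain \<W> where W: "finite \<W>" "B \<subseteq> \<Union>\<W>" "\<forall>U\<in>\<W>. bounded U \<and> diameter U \<le> \<delta>"
      "(\<Sum>U\<in>\<W>. hausdorff_gauge s U) \<le> ennreal D" using D[OF \<open>0 < \<delta>\<close>] by blast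
    have "(\<Sum>U\<in>\<U> \<union> \<W>. hausdorff_gauge s U)
        \<le> (\<Sum>U\<in>\<U> \<union> \<W>. hausdorff_gauge s U) + (\<Sum>U\<in>\<U> \<inter> \<W>. hausdorff_gauge s U)" by simp
    also have "\<dots> = (\<Sum>U\<in>\<U>. hausdorff_gauge s U) + (\<Sum>U\<in>\<W>. hausdorff_gauge s U)"
      by (rule sum.union_inter[OF U(1) W(1)])
    also have "\<dots> \<le> ennreal (max 0 C) + ennreal (max 0 D)"
      using U(4) W(4) by (intro add_mono) (auto simp: max_def ennreal_neg split: if_splits)
    also have "\<dots> = ennreal (max 0 C + max 0 D)" by simp
    finally show "\<exists>\<U>. finite \<U> \<and> A \<union> B \<subseteq> \<Union>\<U> \<and> (\<forall>U\<in>\<U>. bounded U \<and> diameter U \<le> \<delta>) \<and>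
        (\<Sum>U\<in>\<U>. hausdorff_gauge s U) \<le> ennreal (max 0 C + max 0 D)"
      using U(1-3) W(1-3) by (intro exI[of _ "\<U> \<union> \<W>"]) auto
  qed
qed

lemma finite_content_UN:
  assumes "finite I" "\<And>i. i \<in> I \<Longrightarrow> finite_content s (A i)"
  shows "finite_content s (\<Union>i\<in>I. A i)"
  using assms by (induction I) (auto intro: finite_content_empty finite_content_Un)

text \<open>
  A hyperplane is a Lipschitz graph over a coordinate hyperplane; the covering sets are
  the parts of the graph over the cells of a cubic grid.
\<close>

lemma finite_content_hyperplane:
  fixes A :: "(real^'n) set"
  assumes a: "a \<noteq> 0" and A: "A \<subseteq> {x. a \<bullet> x = b}" "bounded A"
  shows "finite_content (real CARD('n) - 1) A"
proof -
  obtain i0 where i0: "a $ i0 \<noteq> 0" using a by (metis vec_eq_iff zero_index)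
  \<comment> \<open>Solving the equation of the hyperplane for coordinate \<open>i0\<close> bounds
    its variation by the second summand times that of the other coordinates. The added 1 lets
    \<open>K\<close> serve for these as well.\<close>
  define K where "K = 1 + (\<Sum>i\<in>UNIV. \<bar>a $ i\<bar>) / \<bar>a $ i0\<bar>"
  have K: "1 \<le> K" by (simp add: K_def sum_nonneg)
  obtain M where M: "0 < M" "\<And>x. x \<in> A \<Longrightarrow> norm x \<le> M"
    using A(2) by (meson bounded_pos)
  \<comment> \<open>With grid width \<open>M / m\<close>, two points over the same cell differ in
    the l1 norm by at most \<open>CARD('n) * K * (M / m)\<close>, that is
    \<open>L / m\<close>.\<close>
  define L where "L = real CARD('n) * K * M"
  have L: "0 < L" using K M by (simp add: L_def)
  define d where "d = CARD('n) - 1"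
  have d: "real CARD('n) - 1 = real d" by (simp add: d_def of_nat_diff)
  define c where "c = unit_ball_vol (real d) / 2 powr real d"
  have c: "0 \<le> c" by (simp add: c_def)
  show ?thesis unfolding finite_content_def d
  \<comment> \<open>There are \<open>(2 * m + 1) ^ d\<close> cells, at most
    \<open>(3 * m) ^ d\<close>, each of gauge at most \<open>c * (L / m) ^ d\<close>: the grid
    parameter \<open>m\<close> cancels.\<close>
  proof (intro exI[of _ "c * (3 * L) ^ d"] allI impI)
    fix \<delta> :: real assume \<delta>: "0 < \<delta>"
    define m where "m = nat \<lceil>L / \<delta>\<rceil> + 1"
    have m: "1 \<le> m" "L / \<delta> \<le> real m" by (simp_all add: m_def) linarith
    define t where "t = M / m"
    have t: "0 < t" using M m by (simp add: t_def)
    define G where "G = Pi\<^sub>E (UNIV - {i0}) (\<lambda>_. {- int m..int m})"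
    define U where "U g = {x \<in> A. \<forall>i. i \<noteq> i0 \<longrightarrow> \<lfloor>x $ i / t\<rfloor> = g i}" for g :: "'n \<Rightarrow> int"
    have finG: "finite G" unfolding G_def by (intro finite_PiE) auto
    have cardG: "card G = (2 * m + 1) ^ d"
    proof -
      have "card {- int m..int m} = 2 * m + 1" by (simp add: nat_add_distrib nat_mult_distrib)
      then show ?thesis unfolding G_def
        by (subst card_PiE) (simp_all only: finite_UNIV finite_Diff finite prod_constant
            card_Diff_singleton UNIV_I d_def)
    qed
    have cover: "A \<subseteq> \<Union>(U ` G)"
    proof
      fix x assume x: "x \<in> A"
      have "\<lfloor>x $ i / t\<rfloor> \<in> {- int m..int m}" for i
      proof -
        have "\<bar>x $ i\<bar> \<le> M" using M(2)[OF x] component_le_norm_cart[of x i] by linarith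
        then have "\<bar>x $ i\<bar> / t \<le> M / t" using t by (intro divide_right_mono) auto
        then have "\<bar>x $ i / t\<bar> \<le> real m"
          using M(1) t m by (simp add: t_def abs_divide abs_mult)
        then have "- real m \<le> x $ i / t" "x $ i / t \<le> real m" by linarith+
        then show ?thesis by (auto simp: le_floor_iff floor_le_iff)
      qed
      then have "(\<lambda>i\<in>UNIV - {i0}. \<lfloor>x $ i / t\<rfloor>) \<in> G" by (auto simp: G_def)
      moreover have "x \<in> U (\<lambda>i\<in>UNIV - {i0}. \<lfloor>x $ i / t\<rfloor>)" using x by (auto simp: U_def)
      ultimately show "x \<in> \<Union>(U ` G)" by blast
    qed
    have close: "norm (x - y) \<le> L / m" if "x \<in> U g" "y \<in> U g" for x y g
    proof -
      have *: "\<bar>x $ i - y $ i\<bar> \<le> t" if "i \<noteq> i0" for i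
      proof -
        have "\<lfloor>x $ i / t\<rfloor> = \<lfloor>y $ i / t\<rfloor>" using \<open>x \<in> U g\<close> \<open>y \<in> U g\<close> that by (simp add: U_def)
        then have "\<bar>x $ i / t - y $ i / t\<bar> \<le> 1" by linarith
        moreover have "x $ i / t - y $ i / t = (x $ i - y $ i) / t" by (simp add: diff_divide_distrib)
        ultimately show ?thesis using t by (simp add: abs_divide)
      qed
      have "a \<bullet> x = b" "a \<bullet> y = b" using that A(1) by (auto simp: U_def)
      then have "a \<bullet> (x - y) = 0" by (simp add: inner_diff_right)
      then have "(\<Sum>i\<in>UNIV. a $ i * (x $ i - y $ i)) = 0" by (simp add: inner_vec_def)
      then have "a $ i0 * (x $ i0 - y $ i0) = - (\<Sum>i\<in>UNIV - {i0}. a $ i * (x $ i - y $ i))"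
        by (subst (asm) sum.remove[of _ i0]) auto
      then have "\<bar>a $ i0\<bar> * \<bar>x $ i0 - y $ i0\<bar> = \<bar>\<Sum>i\<in>UNIV - {i0}. a $ i * (x $ i - y $ i)\<bar>"
        by (metis abs_minus_cancel abs_mult)
      also have "\<dots> \<le> (\<Sum>i\<in>UNIV - {i0}. \<bar>a $ i\<bar> * t)"
        using * by (intro order_trans[OF sum_abs] sum_mono) (auto simp: abs_mult intro: mult_left_mono)
      also have "\<dots> \<le> (\<Sum>i\<in>UNIV. \<bar>a $ i\<bar> * t)"
        using t by (intro sum_mono2) auto
      also have "\<dots> = (\<Sum>i\<in>UNIV. \<bar>a $ i\<bar>) * t" by (simp add: sum_distrib_right)
      finally have "\<bar>x $ i0 - y $ i0\<bar> \<le> (\<Sum>i\<in>UNIV. \<bar>a $ i\<bar>) / \<bar>a $ i0\<bar> * t"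
        using i0 by (simp add: field_simps)
      also have "\<dots> \<le> K * t" using t by (intro mult_right_mono) (auto simp: K_def)
      finally have 0: "\<bar>x $ i0 - y $ i0\<bar> \<le> K * t" .
      have "\<bar>(x - y) $ i\<bar> \<le> K * t" for i
      proof (cases "i = i0")
        case False
        have "t \<le> K * t" using K t by simp
        then show ?thesis using *[OF False] by simp
      qed (use 0 in simp)
      then have "(\<Sum>i\<in>UNIV. \<bar>(x - y) $ i\<bar>) \<le> (\<Sum>i\<in>(UNIV::'n set). K * t)" by (intro sum_mono)
      also have "\<dots> = L / m" by (simp add: L_def t_def)
      finally show ?thesis using norm_le_l1_cart[of "x - y"] by linarith
    qed
    have diam: "diameter (U g) \<le> L / m" for g
      using L m close by (intro diameter_le) auto
    have "L / m \<le> \<delta>" using m \<delta> by (simp add: field_simps)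
    have bdd: "bounded (U g)" for g by (rule bounded_subset[OF A(2)]) (auto simp: U_def)
    have gauge: "hausdorff_gauge (real d) (U g) \<le> ennreal (c * (L / m) ^ d)" for g
    proof (cases "U g = {}")
      case False
      have "(if real d = 0 then 1 else diameter (U g) powr real d) \<le> (L / m) ^ d"
      proof (cases "d = 0")
        case d0: False
        have "diameter (U g) powr real d \<le> (L / m) powr real d"
          using diam diameter_ge_0[OF bdd] by (intro powr_mono2) auto
        then show ?thesis using d0 L m by (simp add: powr_realpow)
      qed simp
      then show ?thesis
        using False mult_left_mono[OF _ c]
        by (simp only: hausdorff_gauge_def c_def[symmetric] if_False ennreal_leI)
    qed (simp add: hausdorff_gauge_def)
    have "(\<Sum>V\<in>U ` G. hausdorff_gauge (real d) V) \<le> (\<Sum>g\<in>G. hausdorff_gauge (real d) (U g))"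
      using sum_image_le[OF finG, of "hausdorff_gauge (real d)" U] by (simp add: o_def)
    also have "\<dots> \<le> (\<Sum>g\<in>G. ennreal (c * (L / m) ^ d))" by (intro sum_mono gauge)
    also have "\<dots> = ennreal (real (card G) * (c * (L / m) ^ d))"
      using c L by (simp add: ennreal_mult ennreal_of_nat_eq_real_of_nat)
    also have "\<dots> \<le> ennreal (c * (3 * L) ^ d)"
    proof (rule ennreal_leI)
      have "real (card G) \<le> (3 * real m) ^ d"
        unfolding cardG of_nat_power using m by (intro power_mono) auto
      then have "real (card G) * (c * (L / m) ^ d) \<le> (3 * real m) ^ d * (c * (L / m) ^ d)"
        using c L by (intro mult_right_mono) auto
      also have "\<dots> = c * ((3 * real m) * (L / m)) ^ d" by (simp only: power_mult_distrib mult_ac)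
      also have "(3 * real m) * (L / m) = 3 * L" using m by simp
      finally show "real (card G) * (c * (L / m) ^ d) \<le> c * (3 * L) ^ d" .
    qed
    finally show "\<exists>\<U>. finite \<U> \<and> A \<subseteq> \<Union>\<U> \<and> (\<forall>U\<in>\<U>. bounded U \<and> diameter U \<le> \<delta>) \<and>
        (\<Sum>U\<in>\<U>. hausdorff_gauge (real d) U) \<le> ennreal (c * (3 * L) ^ d)"
      using finG cover bdd diam \<open>L / m \<le> \<delta>\<close>
      by (intro exI[of _ "U ` G"]) (auto intro: order_trans)
  qed
qed

text \<open>Containment in the hyperplanes, not equality, so that subsets inherit the property. It
  yields Lebesgue measure zero and, for bounded sets, finite surface measure.\<close>

definition flat :: "'a::euclidean_space set \<Rightarrow> bool" where
  "flat S \<longleftrightarrow> (\<exists>\<H>. finite \<H> \<and> (\<forall>(a, b)\<in>\<H>. a \<noteq> 0) \<and> S \<subseteq> (\<Union>(a, b)\<in>\<H>. {x. a \<bullet> x = b}))"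

lemma flat_hyperplane: "a \<noteq> 0 \<Longrightarrow> S \<subseteq> {x. a \<bullet> x = b} \<Longrightarrow> flat S"
  unfolding flat_def by (intro exI[of _ "{(a, b)}"]) auto

lemma flat_subset: "flat S \<Longrightarrow> T \<subseteq> S \<Longrightarrow> flat T"
  unfolding flat_def by (meson order_trans)

lemma flat_UN:
  assumes "finite I" "\<And>i. i \<in> I \<Longrightarrow> flat (S i)"
  shows "flat (\<Union>i\<in>I. S i)"
proof -
  have "\<forall>i\<in>I. \<exists>\<H>. finite \<H> \<and> (\<forall>(a, b)\<in>\<H>. a \<noteq> 0) \<and> S i \<subseteq> (\<Union>(a, b)\<in>\<H>. {x. a \<bullet> x = b})"
    using assms(2) unfolding flat_def by blast
  then obtain \<H> where \<H>: "\<forall>i\<in>I. finite (\<H> i) \<and> (\<forall>(a, b)\<in>\<H> i. a \<noteq> 0) \<and>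
      S i \<subseteq> (\<Union>(a, b)\<in>\<H> i. {x. a \<bullet> x = b})"
    by (auto dest!: bchoice)
  show ?thesis unfolding flat_def
  proof (rule exI[of _ "\<Union>i\<in>I. \<H> i"], intro conjI)
    show "finite (\<Union>i\<in>I. \<H> i)" "\<forall>(a, b)\<in>(\<Union>i\<in>I. \<H> i). a \<noteq> 0"
      using \<H> assms(1) by blast+
    show "(\<Union>i\<in>I. S i) \<subseteq> (\<Union>(a, b)\<in>(\<Union>i\<in>I. \<H> i). {x. a \<bullet> x = b})"
      using \<H> by blast
  qed
qed

lemma negligible_flat:
  assumes "flat S" shows "negligible S"
proof -
  obtain \<H> where \<H>: "finite \<H>" "\<forall>(a, b)\<in>\<H>. a \<noteq> 0" "S \<subseteq> (\<Union>(a, b)\<in>\<H>. {x. a \<bullet> x = b})"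
    using assms unfolding flat_def by blast
  have "negligible (\<Union>(a, b)\<in>\<H>. {x. a \<bullet> x = b})"
    using \<H>(1,2) by (intro negligible_Union) (auto intro: negligible_hyperplane)
  then show ?thesis using \<H>(3) by (rule negligible_subset)
qed

lemma hausdorff_outer_flat:
  fixes S :: "(real^'n) set"
  assumes "flat S" "bounded S"
  shows "hausdorff_outer (real CARD('n) - 1) S < \<infinity>"
proof (rule hausdorff_outer_finite)
  obtain \<H> where \<H>: "finite \<H>" "\<forall>(a, b)\<in>\<H>. a \<noteq> 0" "S \<subseteq> (\<Union>(a, b)\<in>\<H>. {x. a \<bullet> x = b})"
    using assms(1) unfolding flat_def by blast
  have "finite_content (real CARD('n) - 1) (\<Union>h\<in>\<H>. S \<inter> {x. fst h \<bullet> x = snd h})"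
  proof (rule finite_content_UN[OF \<H>(1)])
    fix h assume "h \<in> \<H>"
    then have "fst h \<noteq> 0" using \<H>(2) by auto
    then show "finite_content (real CARD('n) - 1) (S \<inter> {x. fst h \<bullet> x = snd h})"
      by (rule finite_content_hyperplane[where b = "snd h"]) (use assms(2) in \<open>auto intro: bounded_Int\<close>)
  qed
  moreover have "S \<subseteq> (\<Union>h\<in>\<H>. S \<inter> {x. fst h \<bullet> x = snd h})"
  proof
    fix x assume x: "x \<in> S"
    then have "x \<in> (\<Union>(a, b)\<in>\<H>. {x. a \<bullet> x = b})" using \<H>(3) by blast
    then obtain h where "h \<in> \<H>" "fst h \<bullet> x = snd h" unfolding case_prod_beta by blast
    then show "x \<in> (\<Union>h\<in>\<H>. S \<inter> {x. fst h \<bullet> x = snd h})" using x by blast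
  qed
  ultimately show "finite_content (real CARD('n) - 1) S" by (rule finite_content_subset)
qed

text \<open>A polytope of lower dimension lies in a single hyperplane. Otherwise its frontier is the
  relative frontier, the union of finitely many facets, each of lower dimension.\<close>

lemma flat_frontier_polytope:
  fixes P :: "'a::euclidean_space set"
  assumes "polytope P"
  shows "flat (frontier P)"
proof (cases "aff_dim P < DIM('a)")
  case True
  then obtain a b where "a \<noteq> 0" "P \<subseteq> {x. a \<bullet> x = b}" by (rule aff_lowdim_subset_hyperplane)
  then have "flat P" by (rule flat_hyperplane)
  then show ?thesis
    by (rule flat_subset) (simp add: assms frontier_subset_closed polytope_imp_closed)
next
  case False
  then have full: "aff_dim P = DIM('a)" using aff_dim_le_DIM[of P] by linarith
  then have "frontier P = rel_frontier P" by (simp add: aff_dim_eq_full rel_frontier_frontier)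
  also have "\<dots> = (\<Union>F\<in>{F. F facet_of P}. F)"
    by (simp add: assms polytope_imp_polyhedron rel_frontier_of_polyhedron)
  finally have eq: "frontier P = (\<Union>F\<in>{F. F facet_of P}. F)" .
  show ?thesis unfolding eq
  proof (rule flat_UN)
    show "finite {F. F facet_of P}" by (rule finite_polytope_facets[OF assms])
    fix F assume "F \<in> {F. F facet_of P}"
    then have "aff_dim F < DIM('a)" using full by (simp add: facet_of_def)
    then obtain a b where "a \<noteq> 0" "F \<subseteq> {x. a \<bullet> x = b}" by (rule aff_lowdim_subset_hyperplane)
    then show "flat F" by (rule flat_hyperplane)
  qed
qed

text \<open>The frontier of a finite union lies in the union of the frontiers.\<close>

lemma flat_frontier_polyhedral_body:
  assumes "polyhedral_body K"
  shows "flat (frontier K)"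
proof -
  obtain \<P> where \<P>: "finite \<P>" "\<forall>P\<in>\<P>. polytope P" "K = \<Union>\<P>"
    using assms unfolding polyhedral_body_def by blast
  have "flat (\<Union>P\<in>\<P>. frontier P)" using \<P> by (intro flat_UN flat_frontier_polytope) auto
  then show ?thesis by (rule flat_subset) (simp add: \<P> frontier_Union_subset)
qed

lemma compact_polyhedral_body: "polyhedral_body K \<Longrightarrow> compact K"
  unfolding polyhedral_body_def using compact_Union polytope_imp_compact by blast

lemma interior_polyhedral_body: "polyhedral_body K \<Longrightarrow> interior K \<noteq> {}"
  unfolding polyhedral_body_def by (metis closure_empty)

text \<open>An invertible affine map commutes with interior and closure and maps polytopes to
  polytopes.\<close>

lemma polyhedral_body_affine_image:
  assumes "polyhedral_body K" "affine_image_of K \<kappa>"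
  shows "polyhedral_body \<kappa>"
proof -
  obtain \<P> where \<P>: "finite \<P>" "\<forall>P\<in>\<P>. polytope P" "K = \<Union>\<P>"
    and cl: "closure (interior K) = K" and ne: "K \<noteq> {}"
    using assms(1) unfolding polyhedral_body_def by blast
  obtain a A where A: "linear A" "bij A" and \<kappa>: "\<kappa> = (\<lambda>x. a + A x) ` K"
    using assms(2) unfolding affine_image_of_def by blast
  have img: "(\<lambda>x. a + A x) ` S = (+) a ` (A ` S)" for S by (simp add: image_image)
  have "closure (interior \<kappa>) = (+) a ` (A ` closure (interior K))"
    unfolding \<kappa> img using A
    by (simp add: interior_translation closure_translation interior_injective_linear_image
        closure_injective_linear_image bij_is_inj)
  then have "closure (interior \<kappa>) = \<kappa>" by (simp add: cl \<kappa> img)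
  moreover have "\<kappa> = \<Union>((\<lambda>P. (+) a ` (A ` P)) ` \<P>)" by (auto simp: \<kappa> \<P>(3))
  moreover have "\<forall>P\<in>(\<lambda>P. (+) a ` (A ` P)) ` \<P>. polytope P"
    using \<P>(2) A(1) by (auto simp: polytope_translation_eq intro: polytope_linear_image)
  ultimately show ?thesis
    unfolding polyhedral_body_def using \<P>(1) ne \<kappa> by (metis finite_imageI image_is_empty)
qed

text \<open>A point of \<open>K'\<close> is a limit of interior points of \<open>K'\<close> by
  regularity, and the open set \<open>interior K\<close> contains none of these.\<close>

lemma Int_polyhedral_subset_frontier:
  assumes "polyhedral_body K'" "interior K \<inter> interior K' = {}"
  shows "K \<inter> K' \<subseteq> frontier K"
proof
  fix x assume x: "x \<in> K \<inter> K'"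
  have "x \<in> closure (interior K')" using assms(1) x by (simp add: polyhedral_body_def)
  moreover have "interior K \<inter> closure (interior K') = {}"
    using assms(2) open_Int_closure_eq_empty[of "interior K" "interior K'"] by simp
  ultimately have "x \<notin> interior K" by blast
  then show "x \<in> frontier K" using x by (simp add: frontier_def closure_subset[THEN subsetD])
qed

text \<open>A Lipschitz domain lies on one side of its boundary.\<close>

lemma frontier_subset_frontier_closure:
  assumes "open \<Omega>" "lipschitz_boundary \<Omega>"
  shows "frontier \<Omega> \<subseteq> frontier (closure \<Omega>)"
proof
  fix x assume x: "x \<in> frontier \<Omega>"
  obtain d \<delta> L g where d: "norm d = 1" and \<delta>: "0 < \<delta>" and g: "L-lipschitz_on {z. d \<bullet> z = 0} g"
    and loc: "\<And>y. y \<in> ball x \<delta> \<Longrightarrow> y \<in> \<Omega> \<longleftrightarrow> d \<bullet> y < g (y - (d \<bullet> y) *\<^sub>R d)"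
    using assms(2) x unfolding lipschitz_boundary_def by metis
  have dd: "d \<bullet> d = 1" using d by (simp add: norm_eq_1)
  have orth: "d \<bullet> (y - (d \<bullet> y) *\<^sub>R d) = 0" for y by (simp add: inner_diff_right dd)
  have cont: "continuous_on UNIV (\<lambda>y. g (y - (d \<bullet> y) *\<^sub>R d))"
    by (rule continuous_on_compose2[OF lipschitz_on_continuous_on[OF g]])
      (auto intro!: continuous_intros simp: orth)
  have xn: "x \<notin> \<Omega>" using x assms(1) by (auto simp: frontier_def interior_open)
  then have gx: "g (x - (d \<bullet> x) *\<^sub>R d) \<le> d \<bullet> x" using loc[of x] \<delta> by simp
  \<comment> \<open>Moving from \<open>x\<close> in the direction \<open>d\<close> keeps the
    projection to the complement of \<open>d\<close>. It leads strictly above the graph, into an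
    open set disjoint from the domain.\<close>
  have out: "x + t *\<^sub>R d \<notin> closure \<Omega>" if t: "0 < t" "t < \<delta>" for t
  proof -
    let ?W = "{y. g (y - (d \<bullet> y) *\<^sub>R d) < d \<bullet> y} \<inter> ball x \<delta>"
    have "open ?W" using cont by (intro open_Int open_Collect_less continuous_intros) auto
    moreover have "?W \<inter> \<Omega> = {}" using loc by force
    ultimately have "?W \<inter> closure \<Omega> = {}" by (simp add: open_Int_closure_eq_empty)
    moreover have "x + t *\<^sub>R d \<in> ?W"
    proof -
      have eq: "x + t *\<^sub>R d - (d \<bullet> (x + t *\<^sub>R d)) *\<^sub>R d = x - (d \<bullet> x) *\<^sub>R d"
        by (simp add: inner_add_right dd algebra_simps)
      have "d \<bullet> (x + t *\<^sub>R d) = d \<bullet> x + t" by (simp add: inner_add_right dd)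
      then show ?thesis
        unfolding Int_iff mem_Collect_eq eq using gx t d by (simp add: dist_norm)
    qed
    ultimately show ?thesis by blast
  qed
  have "x \<notin> interior (closure \<Omega>)"
  proof
    assume "x \<in> interior (closure \<Omega>)"
    then obtain e where e: "0 < e" "ball x e \<subseteq> closure \<Omega>" by (meson mem_interior)
    define t where "t = min e \<delta> / 2"
    have "0 < t" "t < \<delta>" "t < e" using e \<delta> by (auto simp: t_def)
    then have "x + t *\<^sub>R d \<in> ball x e" using d by (simp add: dist_norm)
    then show False using out[of t] \<open>0 < t\<close> \<open>t < \<delta>\<close> e(2) by blast
  qed
  then show "x \<in> frontier (closure \<Omega>)" using x by (simp add: frontier_def)
qed

section \<open>The surface measure on Borel sets\<close>

lemma sets_hausdorff_measure [simp]: "sets (hausdorff_measure s) = sets borel"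
  using sets.sigma_sets_eq[of "borel :: 'a measure"] by (simp add: hausdorff_measure_def sets_measure_of_conv)

lemma space_hausdorff_measure [simp]: "space (hausdorff_measure s) = UNIV"
  by (simp add: hausdorff_measure_def space_measure_of_conv)

lemma space_surface_on [simp]: "space (surface_on S) = S"
  by (simp add: surface_on_def space_restrict_space)

lemma measurable_surface_on: "f \<in> borel_measurable borel \<Longrightarrow> f \<in> borel_measurable (surface_on S)"
  unfolding surface_on_def
  by (rule measurable_restrict_space1) (simp add: measurable_def)

lemma finite_measure_surface_on:
  fixes S :: "(real^'n) set"
  assumes "S \<in> sets borel" "hausdorff_outer (real CARD('n) - 1) S < \<infinity>"
  shows "finite_measure (surface_on S)"
proof
  have "emeasure (hausdorff_measure (real CARD('n) - 1)) S \<le> hausdorff_outer (real CARD('n) - 1) S"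
    by (simp add: hausdorff_measure_def emeasure_measure_of_conv)
  moreover have "emeasure (surface_on S) S = emeasure (hausdorff_measure (real CARD('n) - 1)) S"
    using assms(1) unfolding surface_on_def by (subst emeasure_restrict_space) auto
  ultimately show "emeasure (surface_on S) (space (surface_on S)) \<noteq> \<infinity>"
    using assms(2) by (auto simp: top_unique)
qed

section \<open>Outward normals\<close>

text \<open>A short step from \<open>x\<close> in the direction \<open>\<nu> - \<mu>\<close> stays
  in the half space of \<open>\<mu>\<close>, hence in \<open>K\<close>, hence in the half space of
  \<open>\<nu>\<close>. This forces the inner product of the two unit vectors to be 1.\<close>

lemma is_outward_normal_unique:
  assumes "is_outward_normal K x \<nu>" "is_outward_normal K x \<mu>"
  shows "\<nu> = \<mu>"
proof -
  obtain \<delta> \<epsilon> where n: "norm \<nu> = 1" "norm \<mu> = 1" and pos: "0 < \<delta>" "0 < \<epsilon>"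
    and K: "K \<inter> ball x \<delta> = {y \<in> ball x \<delta>. \<nu> \<bullet> (y - x) \<le> 0}"
      "K \<inter> ball x \<epsilon> = {y \<in> ball x \<epsilon>. \<mu> \<bullet> (y - x) \<le> 0}"
    using assms unfolding is_outward_normal_def by blast
  \<comment> \<open>The difference of two unit vectors has norm at most 2, so a third of the smaller
    radius keeps the test point in both balls.\<close>
  define t where "t = min \<delta> \<epsilon> / 3"
  have t: "0 < t" "3 * t \<le> \<delta>" "3 * t \<le> \<epsilon>" using pos by (auto simp: t_def)
  let ?z = "\<nu> - \<mu>" and ?y = "x + t *\<^sub>R (\<nu> - \<mu>)"
  have "norm (t *\<^sub>R ?z) \<le> t * 2" using t n norm_triangle_ineq4[of \<nu> \<mu>] by simp
  then have "norm (t *\<^sub>R ?z) < \<delta>" "norm (t *\<^sub>R ?z) < \<epsilon>" using t by linarith+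
  then have ball: "?y \<in> ball x \<delta>" "?y \<in> ball x \<epsilon>" by (simp_all add: dist_norm)
  have 1: "\<mu> \<bullet> \<nu> \<le> 1" using Cauchy_Schwarz_ineq2[of \<mu> \<nu>] n by simp
  have dd: "\<nu> \<bullet> \<nu> = 1" "\<mu> \<bullet> \<mu> = 1" using n by (simp_all add: norm_eq_1)
  have "\<mu> \<bullet> (?y - x) \<le> 0" using 1 t dd by (simp add: inner_diff_right mult_le_0_iff)
  then have "?y \<in> K" using ball(2) K(2) by blast
  then have "\<nu> \<bullet> (?y - x) \<le> 0" using ball(1) K(1) by blast
  then have "\<nu> \<bullet> \<mu> \<ge> 1" using t dd by (simp add: inner_diff_right mult_le_0_iff)
  then have "(\<nu> - \<mu>) \<bullet> (\<nu> - \<mu>) \<le> 0" using dd by (simp add: inner_diff_left inner_diff_right inner_commute)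
  then have "(\<nu> - \<mu>) \<bullet> (\<nu> - \<mu>) = 0" using inner_ge_zero[of "\<nu> - \<mu>"] by linarith
  then show ?thesis by simp
qed

lemma outward_normal_eq:
  assumes "is_outward_normal K x \<nu>" shows "outward_normal K x = \<nu>"
proof -
  have "(THE \<nu>. is_outward_normal K x \<nu>) = \<nu>"
    by (rule the_equality) (rule assms, erule is_outward_normal_unique[OF _ assms])
  then show ?thesis using assms by (auto simp: outward_normal_def)
qed

lemma norm_outward_normal_le: "norm (outward_normal K x) \<le> 1"
proof (cases "\<exists>\<nu>. is_outward_normal K x \<nu>")
  case True
  then obtain \<nu> where "is_outward_normal K x \<nu>" by blast
  then show ?thesis using outward_normal_eq[of K x \<nu>] by (simp add: is_outward_normal_def)
qed (simp add: outward_normal_def)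

text \<open>Near \<open>x\<close> the set is a half space, so nearby frontier points lie on its
  bounding hyperplane, and around them the same half space describes \<open>K\<close>.\<close>

lemma outward_normal_local:
  fixes K :: "(real^'n) set"
  assumes "closed K" and x: "is_outward_normal K x \<nu>"
  obtains \<delta> where "0 < \<delta>" "\<And>y. y \<in> ball x \<delta> \<Longrightarrow> y \<in> frontier K \<Longrightarrow> is_outward_normal K y \<nu>"
proof -
  obtain \<delta> where n: "norm \<nu> = 1" and pos: "0 < \<delta>"
    and K: "K \<inter> ball x \<delta> = {y \<in> ball x \<delta>. \<nu> \<bullet> (y - x) \<le> 0}"
    using x unfolding is_outward_normal_def by blast
  have "is_outward_normal K y \<nu>" if y: "y \<in> ball x \<delta>" "y \<in> frontier K" for y
  proof -
    have "y \<in> K" using y(2) assms(1) frontier_subset_closed by blast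
    then have le: "\<nu> \<bullet> (y - x) \<le> 0" using K y(1) by blast
    have eq: "\<nu> \<bullet> (y - x) = 0"
    proof (rule ccontr)
      assume "\<nu> \<bullet> (y - x) \<noteq> 0"
      then have "y \<in> {y. \<nu> \<bullet> (y - x) < 0} \<inter> ball x \<delta>" using le y by auto
      moreover have "open ({y. \<nu> \<bullet> (y - x) < 0} \<inter> ball x \<delta>)"
        by (intro open_Int open_Collect_less continuous_intros open_ball)
      moreover have "{y. \<nu> \<bullet> (y - x) < 0} \<inter> ball x \<delta> \<subseteq> K"
      proof
        fix z assume "z \<in> {y. \<nu> \<bullet> (y - x) < 0} \<inter> ball x \<delta>"
        then have "z \<in> {y \<in> ball x \<delta>. \<nu> \<bullet> (y - x) \<le> 0}" by simp
        then show "z \<in> K" unfolding K[symmetric] by simp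
      qed
      ultimately have "y \<in> interior K" using interior_maximal by blast
      then show False using y(2) by (simp add: frontier_def)
    qed
    obtain \<epsilon> where e: "0 < \<epsilon>" "ball y \<epsilon> \<subseteq> ball x \<delta>" using y(1) by (meson open_ball open_contains_ball)
    have shift: "\<nu> \<bullet> (z - y) = \<nu> \<bullet> (z - x)" for z using eq by (simp add: inner_diff_right)
    have "K \<inter> ball y \<epsilon> = (K \<inter> ball x \<delta>) \<inter> ball y \<epsilon>" using e(2) by blast
    also have "\<dots> = {z \<in> ball y \<epsilon>. \<nu> \<bullet> (z - y) \<le> 0}" unfolding K shift using e(2) by blast
    finally have "K \<inter> ball y \<epsilon> = {z \<in> ball y \<epsilon>. \<nu> \<bullet> (z - y) \<le> 0}" .
    then show ?thesis using n e(1) by (auto simp: is_outward_normal_def)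
  qed
  then show ?thesis using pos that by blast
qed

text \<open>\<open>x\<close> belongs to \<open>K\<close>, but an arbitrarily short step along the
  normal leaves \<open>K\<close>.\<close>

lemma is_outward_normal_frontier:
  fixes K :: "(real^'n) set"
  assumes x: "is_outward_normal K x \<nu>"
  shows "x \<in> frontier K"
proof -
  obtain \<delta> where n: "norm \<nu> = 1" and pos: "0 < \<delta>"
    and K: "K \<inter> ball x \<delta> = {y \<in> ball x \<delta>. \<nu> \<bullet> (y - x) \<le> 0}"
    using x unfolding is_outward_normal_def by blast
  have "x \<in> {y \<in> ball x \<delta>. \<nu> \<bullet> (y - x) \<le> 0}" using pos by simp
  then have "x \<in> K" unfolding K[symmetric] by simp
  moreover have "x \<notin> interior K"
  proof
    assume "x \<in> interior K"
    then obtain e where e: "0 < e" "ball x e \<subseteq> K" by (meson mem_interior)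
    define t where "t = min e \<delta> / 2"
    have t: "0 < t" "t < \<delta>" "t < e" using e pos by (auto simp: t_def)
    then have "x + t *\<^sub>R \<nu> \<in> ball x e" "x + t *\<^sub>R \<nu> \<in> ball x \<delta>" using n by (simp_all add: dist_norm)
    then have "x + t *\<^sub>R \<nu> \<in> K \<inter> ball x \<delta>" using e(2) by blast
    then have "\<nu> \<bullet> (t *\<^sub>R \<nu>) \<le> 0" unfolding K by simp
    then show False using t n by (simp add: norm_eq_1 mult_le_0_iff)
  qed
  ultimately show ?thesis by (simp add: frontier_def closure_subset[THEN subsetD])
qed

text \<open>
  The normal is locally constant on the set where it exists, and this set is relatively
  open in the boundary.
\<close>

lemma measurable_outward_normal:
  fixes K :: "(real^'n) set"
  assumes "closed K"
  shows "outward_normal K \<in> borel_measurable borel"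
proof -
  define D where "D = {x. \<exists>\<nu>. is_outward_normal K x \<nu>}"
  have "\<forall>x\<in>D. \<exists>\<delta>>0. \<forall>y\<in>ball x \<delta> \<inter> frontier K. y \<in> D \<and> outward_normal K y = outward_normal K x"
  proof
    fix x assume "x \<in> D"
    then obtain \<nu> where x: "is_outward_normal K x \<nu>" by (auto simp: D_def)
    from assms x obtain \<delta> where \<delta>: "0 < \<delta>"
      "\<And>y. y \<in> ball x \<delta> \<Longrightarrow> y \<in> frontier K \<Longrightarrow> is_outward_normal K y \<nu>"
      by (rule outward_normal_local) blast
    have "y \<in> D \<and> outward_normal K y = outward_normal K x" if "y \<in> ball x \<delta> \<inter> frontier K" for y
    proof -
      have "is_outward_normal K y \<nu>" using that \<delta>(2) by blast
      then show ?thesis using outward_normal_eq[OF x] outward_normal_eq[of K y \<nu>] by (auto simp: D_def)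
    qed
    then show "\<exists>\<delta>>0. \<forall>y\<in>ball x \<delta> \<inter> frontier K. y \<in> D \<and> outward_normal K y = outward_normal K x"
      using \<delta>(1) by blast
  qed
  then obtain \<delta> where \<delta>: "\<And>x. x \<in> D \<Longrightarrow> 0 < \<delta> x"
    "\<And>x y. \<lbrakk>x \<in> D; y \<in> ball x (\<delta> x); y \<in> frontier K\<rbrakk> \<Longrightarrow> y \<in> D \<and> outward_normal K y = outward_normal K x"
    by (metis IntI)
  have DF: "D \<subseteq> frontier K" by (auto simp: D_def is_outward_normal_frontier)
  have "D = frontier K \<inter> (\<Union>x\<in>D. ball x (\<delta> x))"
    using DF \<delta> by (auto intro: centre_in_ball[THEN iffD2])
  then have D: "D \<in> sets borel"
    by (metis (no_types, lifting) borel_closed borel_open frontier_closed open_UN open_ball sets.Int)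
  have cont: "continuous_on D (outward_normal K)"
    unfolding continuous_on_eq_continuous_within
  proof
    fix x assume x: "x \<in> D"
    have "\<forall>\<^sub>F y in at x within D. outward_normal K y = outward_normal K x"
      unfolding eventually_at
    proof (intro exI[of _ "\<delta> x"] conjI ballI impI)
      fix y assume "y \<in> D" "y \<noteq> x \<and> dist y x < \<delta> x"
      then show "outward_normal K y = outward_normal K x"
        using \<delta>(2)[OF x, of y] DF by (auto simp: dist_commute)
    qed (rule \<delta>(1)[OF x])
    then show "continuous (at x within D) (outward_normal K)"
      unfolding continuous_within by (rule tendsto_eventually)
  qed
  \<comment> \<open>Off \<open>D\<close> the normal is 0 by default, so the indicator changes
    nothing.\<close>
  have "(\<lambda>x. indicator D x *\<^sub>R outward_normal K x) \<in> borel_measurable borel"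
    by (rule borel_measurable_continuous_on_indicator[OF D cont])
  moreover have "indicator D x *\<^sub>R outward_normal K x = outward_normal K x" for x
    by (auto simp: indicator_def D_def outward_normal_def)
  ultimately show ?thesis by simp
qed

section \<open>Polynomials\<close>

definition monomial :: "('n::finite \<Rightarrow> nat) \<Rightarrow> real^'n \<Rightarrow> real" where
  "monomial \<alpha> x = (\<Prod>i\<in>UNIV. x $ i ^ \<alpha> i)"

lemma finite_multiindices: "finite {\<alpha> :: 'n::finite \<Rightarrow> nat. sum \<alpha> UNIV \<le> j}"
proof (rule finite_subset)
  show "{\<alpha> :: 'n \<Rightarrow> nat. sum \<alpha> UNIV \<le> j} \<subseteq> Pi\<^sub>E UNIV (\<lambda>_. {..j})"
  proof
    fix \<alpha> :: "'n \<Rightarrow> nat" assume "\<alpha> \<in> {\<alpha>. sum \<alpha> UNIV \<le> j}"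
    then have "\<alpha> i \<le> j" for i using member_le_sum[of i UNIV \<alpha>] by simp
    then show "\<alpha> \<in> Pi\<^sub>E UNIV (\<lambda>_. {..j})" by auto
  qed
  show "finite (Pi\<^sub>E (UNIV::'n set) (\<lambda>_. {..j}))" by (intro finite_PiE) auto
qed

lemma mem_polys_iff: "P \<in> polys j \<longleftrightarrow> (\<exists>a. P = (\<Sum>\<alpha>\<in>{\<alpha>. sum \<alpha> UNIV \<le> j}. a \<alpha> *\<^sub>R monomial \<alpha>))"
  by (simp add: polys_def fun_eq_iff sum_fun_apply monomial_def)

lemma subspace_polys: "subspace (polys j)"
  unfolding subspace_def
proof (intro conjI ballI allI)
  show "0 \<in> polys j" unfolding mem_polys_iff by (rule exI[of _ "\<lambda>_. 0"]) simp
  show "P + Q \<in> polys j" if PQ: "P \<in> polys j" "Q \<in> polys j" for P Q :: "real^'a \<Rightarrow> real"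
  proof -
    obtain a b where "P = (\<Sum>\<alpha>\<in>{\<alpha>. sum \<alpha> UNIV \<le> j}. a \<alpha> *\<^sub>R monomial \<alpha>)"
      "Q = (\<Sum>\<alpha>\<in>{\<alpha>. sum \<alpha> UNIV \<le> j}. b \<alpha> *\<^sub>R monomial \<alpha>)"
      using PQ unfolding mem_polys_iff by blast
    then show ?thesis unfolding mem_polys_iff
      by (intro exI[of _ "\<lambda>\<alpha>. a \<alpha> + b \<alpha>"]) (simp add: sum.distrib scaleR_add_left)
  qed
  show "c *\<^sub>R P \<in> polys j" if P: "P \<in> polys j" for c and P :: "real^'a \<Rightarrow> real"
  proof -
    obtain a where "P = (\<Sum>\<alpha>\<in>{\<alpha>. sum \<alpha> UNIV \<le> j}. a \<alpha> *\<^sub>R monomial \<alpha>)"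
      using P unfolding mem_polys_iff by blast
    then show ?thesis unfolding mem_polys_iff
      by (intro exI[of _ "\<lambda>\<alpha>. c * a \<alpha>"]) (simp add: scaleR_sum_right)
  qed
qed

lemma monomial_mem_polys: "sum \<alpha> UNIV \<le> j \<Longrightarrow> monomial \<alpha> \<in> polys j"
  unfolding mem_polys_iff
proof (rule exI[of _ "\<lambda>\<beta>. if \<beta> = \<alpha> then 1 else 0"])
  assume "sum \<alpha> UNIV \<le> j"
  then show "monomial \<alpha> = (\<Sum>\<beta>\<in>{\<beta>. sum \<beta> UNIV \<le> j}. (if \<beta> = \<alpha> then 1 else 0) *\<^sub>R monomial \<beta>)"
    by (simp add: finite_multiindices if_distrib[of "\<lambda>c. c *\<^sub>R _"] sum.delta cong: if_cong)
qed

text \<open>The form in which Gram-Schmidt and arguments about spans of a finite set apply.\<close>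

lemma polys_eq_span: "polys j = span (monomial ` {\<alpha>. sum \<alpha> UNIV \<le> j})"
proof
  show "polys j \<subseteq> span (monomial ` {\<alpha> :: 'a \<Rightarrow> nat. sum \<alpha> UNIV \<le> j})"
  proof
    fix P :: "real^'a \<Rightarrow> real" assume "P \<in> polys j"
    then obtain a where "P = (\<Sum>\<alpha>\<in>{\<alpha>. sum \<alpha> UNIV \<le> j}. a \<alpha> *\<^sub>R monomial \<alpha>)"
      unfolding mem_polys_iff by blast
    then show "P \<in> span (monomial ` {\<alpha>. sum \<alpha> UNIV \<le> j})"
      by (simp only:) (intro span_sum span_scale span_base imageI, assumption)
  qed
  show "span (monomial ` {\<alpha> :: 'a \<Rightarrow> nat. sum \<alpha> UNIV \<le> j}) \<subseteq> polys j"
    by (rule span_minimal) (auto simp: monomial_mem_polys subspace_polys)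
qed

lemma polys_mono: "i \<le> j \<Longrightarrow> polys i \<subseteq> polys j"
  unfolding polys_eq_span by (intro span_mono image_mono) auto

lemma real_polynomial_function_polys:
  assumes "P \<in> polys j"
  shows "real_polynomial_function P"
  using assms finite_multiindices[of j] unfolding polys_def
  by (auto intro!: real_polynomial_function_sum real_polynomial_function.intros(4)
      real_polynomial_function_prod real_polynomial_function_power
      intro: real_polynomial_function.intros(1) bounded_linear_vec_nth)

lemma continuous_on_polys: "P \<in> polys j \<Longrightarrow> continuous_on S P"
  using continuous_real_polymonial_function[OF real_polynomial_function_polys]
  by (blast intro: continuous_at_imp_continuous_on)

lemma differentiable_polys: "P \<in> polys j \<Longrightarrow> P differentiable (at x)"
  using differentiable_at_real_polynomial_function[OF real_polynomial_function_polys] .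

section \<open>Derivatives of polynomials\<close>

lemma partial_add:
  assumes "P differentiable (at x)" "Q differentiable (at x)"
  shows "partial i (P + Q) x = partial i P x + partial i Q x"
proof -
  have "((P + Q) has_derivative (\<lambda>y. frechet_derivative P (at x) y + frechet_derivative Q (at x) y)) (at x)"
    unfolding plus_fun_def using assms by (intro has_derivative_add) (auto simp: frechet_derivative_works)
  from frechet_derivative_at[OF this, symmetric] show ?thesis by (simp add: partial_def)
qed

lemma partial_scaleR:
  assumes "P differentiable (at x)"
  shows "partial i (c *\<^sub>R P) x = c * partial i P x"
proof -
  have "((c *\<^sub>R P) has_derivative (\<lambda>y. c *\<^sub>R frechet_derivative P (at x) y)) (at x)"
    unfolding scaleR_fun_def using assms
    by (intro has_derivative_scaleR_right) (auto simp: frechet_derivative_works)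
  from frechet_derivative_at[OF this, symmetric] show ?thesis by (simp add: partial_def)
qed

lemma partial_zero: "partial i 0 x = 0"
proof -
  have "(0 has_derivative (\<lambda>y. 0)) (at x)" unfolding zero_fun_def by simp
  from fun_cong[OF frechet_derivative_at[OF this], of "axis i 1"] show ?thesis by (simp add: partial_def)
qed

lemma grad_add:
  assumes "P differentiable (at x)" "Q differentiable (at x)"
  shows "grad (P + Q) x = grad P x + grad Q x"
  using assms by (simp add: grad_def vec_eq_iff partial_add)

lemma grad_scaleR:
  assumes "P differentiable (at x)"
  shows "grad (c *\<^sub>R P) x = c *\<^sub>R grad P x"
  using assms by (simp add: grad_def vec_eq_iff partial_scaleR)

text \<open>If \<open>\<alpha> i = 0\<close>, the truncated subtraction leaves the exponent at 0,
  but the factor \<open>real (\<alpha> i)\<close> makes both sides vanish.\<close>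

lemma partial_monomial: "partial i (monomial \<alpha>) = real (\<alpha> i) *\<^sub>R monomial (\<alpha>(i := \<alpha> i - 1))"
proof
  fix x :: "real^'a"
  have "((\<lambda>x. \<Prod>k\<in>UNIV. x $ k ^ \<alpha> k) has_derivative
      (\<lambda>y. \<Sum>k\<in>UNIV. (real (\<alpha> k) * (y $ k * x $ k ^ (\<alpha> k - 1))) * (\<Prod>l\<in>UNIV - {k}. x $ l ^ \<alpha> l))) (at x)"
  proof (rule has_derivative_prod)
    fix k :: 'a
    have nth: "((\<lambda>x. x $ k) has_derivative (\<lambda>y. y $ k)) (at x)"
      by (rule bounded_linear_imp_has_derivative) (rule bounded_linear_vec_nth)
    show "((\<lambda>x. x $ k ^ \<alpha> k) has_derivative (\<lambda>y. real (\<alpha> k) * (y $ k * x $ k ^ (\<alpha> k - 1)))) (at x)"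
      using has_derivative_power[OF nth, of "\<alpha> k"] by (simp add: mult_ac)
  qed
  then have "(monomial \<alpha> has_derivative
      (\<lambda>y. \<Sum>k\<in>UNIV. (real (\<alpha> k) * (y $ k * x $ k ^ (\<alpha> k - 1))) * (\<Prod>l\<in>UNIV - {k}. x $ l ^ \<alpha> l))) (at x)"
    by (simp add: monomial_def[abs_def])
  from frechet_derivative_at[OF this, symmetric]
  have "partial i (monomial \<alpha>) x = (\<Sum>k\<in>UNIV. (real (\<alpha> k) * (axis i 1 $ k * x $ k ^ (\<alpha> k - 1)))
      * (\<Prod>l\<in>UNIV - {k}. x $ l ^ \<alpha> l))"
    by (simp add: partial_def)
  also have "\<dots> = (\<Sum>k\<in>UNIV. if k = i then (real (\<alpha> k) * x $ k ^ (\<alpha> k - 1)) * (\<Prod>l\<in>UNIV - {k}. x $ l ^ \<alpha> l) else 0)"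
    by (intro sum.cong) (auto simp: axis_def)
  also have "\<dots> = real (\<alpha> i) * (x $ i ^ (\<alpha> i - 1) * (\<Prod>l\<in>UNIV - {i}. x $ l ^ \<alpha> l))" by simp
  also have "(\<Prod>l\<in>UNIV - {i}. x $ l ^ \<alpha> l) = (\<Prod>l\<in>UNIV - {i}. x $ l ^ (\<alpha>(i := \<alpha> i - 1)) l)"
    by (intro prod.cong) auto
  also have "x $ i ^ (\<alpha> i - 1) * (\<Prod>l\<in>UNIV - {i}. x $ l ^ (\<alpha>(i := \<alpha> i - 1)) l)
      = (\<Prod>l\<in>UNIV. x $ l ^ (\<alpha>(i := \<alpha> i - 1)) l)"
    by (subst prod.remove[of UNIV i]) auto
  finally show "partial i (monomial \<alpha>) x = (real (\<alpha> i) *\<^sub>R monomial (\<alpha>(i := \<alpha> i - 1))) x"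
    unfolding scaleR_fun_apply real_scaleR_def monomial_def[of "\<alpha>(i := \<alpha> i - 1)"] .
qed

lemma partial_monomial_mem_polys:
  assumes "sum \<alpha> UNIV \<le> j"
  shows "partial i (monomial \<alpha>) \<in> polys (j - 1)"
proof (cases "\<alpha> i = 0")
  case True
  then have "partial i (monomial \<alpha>) = 0" by (simp add: partial_monomial)
  then show ?thesis using subspace_polys subspace_0 by auto
next
  case False
  have "sum (\<alpha>(i := \<alpha> i - 1)) UNIV + 1 = sum \<alpha> UNIV"
    using False by (simp add: sum.remove[of UNIV i])
  then have "sum (\<alpha>(i := \<alpha> i - 1)) UNIV \<le> j - 1" using assms by linarith
  then show ?thesis
    unfolding partial_monomial by (intro subspace_scale[OF subspace_polys] monomial_mem_polys)
qed

text \<open>The polynomials whose derivative has the asserted degree form a subspace that contains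
  the monomials. For \<open>j = 0\<close> the truncated bound stays 0 and the derivative is the zero
  polynomial.\<close>

lemma partial_polys:
  assumes "P \<in> polys j"
  shows "partial i P \<in> polys (j - 1)"
proof -
  let ?W = "{P \<in> polys j. partial i P \<in> polys (j - 1)}"
  have add: "partial i (P + Q) = partial i P + partial i Q" if "P \<in> polys j" "Q \<in> polys j"
    for P Q :: "real^'a \<Rightarrow> real"
    using partial_add[OF differentiable_polys[OF that(1)] differentiable_polys[OF that(2)]] by (intro ext) simp
  have scale: "partial i (c *\<^sub>R P) = c *\<^sub>R partial i P" if "P \<in> polys j"
    for c and P :: "real^'a \<Rightarrow> real"
    using partial_scaleR[OF differentiable_polys[OF that]] by (intro ext) simp
  have zero: "partial i 0 = (0 :: real^'a \<Rightarrow> real)" by (intro ext) (simp add: partial_zero)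
  have "span (monomial ` {\<alpha>. sum \<alpha> UNIV \<le> j}) \<subseteq> ?W"
  proof (rule span_minimal)
    show "monomial ` {\<alpha>. sum \<alpha> UNIV \<le> j} \<subseteq> ?W"
      using partial_monomial_mem_polys by (auto simp: monomial_mem_polys simp del: One_nat_def)
    show "subspace ?W" unfolding subspace_def
      by (auto simp: add scale zero subspace_0[OF subspace_polys] subspace_add[OF subspace_polys]
          subspace_scale[OF subspace_polys])
  qed
  then show ?thesis using assms unfolding polys_eq_span[symmetric] by blast
qed

text \<open>By completeness of Lebesgue measure every subset of a null set is measurable, so
  \<open>P\<close> may be arbitrary.\<close>

lemma AE_lebesgue_on_iff_negligible:
  assumes "S \<in> sets lebesgue"
  shows "(AE x in lebesgue_on S. P x) \<longleftrightarrow> negligible {x \<in> S. \<not> P x}"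
proof -
  have "(AE x in lebesgue_on S. P x) \<longleftrightarrow> (AE x in lebesgue. x \<in> S \<longrightarrow> P x)"
    using assms by (subst AE_restrict_space_iff) auto
  also have "\<dots> \<longleftrightarrow> {x. \<not> (x \<in> S \<longrightarrow> P x)} \<in> null_sets lebesgue"
    by (subst eventually_ae_filter) (auto simp: null_sets_completion_subset[of lborel] intro: completion.complete2)
  finally show ?thesis by (simp add: negligible_iff_null_sets)
qed

text \<open>An open null set is empty, so \<open>P\<close> vanishes on the interior of
  \<open>\<kappa>\<close>. On the line from an interior point to any \<open>y\<close> it is a
  polynomial in one variable with infinitely many zeros.\<close>

lemma polys_eq_0_if_AE:
  fixes P :: "real^'n \<Rightarrow> real"
  assumes P: "P \<in> polys j" and \<kappa>: "\<kappa> \<in> sets lebesgue" "interior \<kappa> \<noteq> {}"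
    and AE: "AE x in lebesgue_on \<kappa>. P x = 0"
  shows "P = 0"
proof -
  have "negligible {x \<in> \<kappa>. P x \<noteq> 0}" using AE \<kappa>(1) by (simp add: AE_lebesgue_on_iff_negligible)
  then have neg: "negligible (interior \<kappa> \<inter> {x. P x \<noteq> 0})"
    by (rule negligible_subset) (use interior_subset in blast)
  have "open {x. P x \<noteq> 0}"
    using continuous_on_polys[OF P, of UNIV] by (intro open_Collect_neq continuous_on_const)
  then have "interior \<kappa> \<inter> {x. P x \<noteq> 0} = {}"
    using neg open_not_negligible[of "interior \<kappa> \<inter> {x. P x \<noteq> 0}"] by blast
  then have zero: "P x = 0" if "x \<in> interior \<kappa>" for x using that by blast
  obtain x0 where x0: "x0 \<in> interior \<kappa>" using \<kappa>(2) by blast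
  obtain e where e: "0 < e" "ball x0 e \<subseteq> interior \<kappa>" using x0 by (meson open_contains_ball open_interior)
  show ?thesis
  proof
    fix y
    define f where "f t = x0 + t *\<^sub>R (y - x0)" for t :: real
    have "polynomial_function f" unfolding f_def
      by (intro polynomial_function_add polynomial_function_const polynomial_function_mult
          polynomial_function_bounded_linear bounded_linear_ident)
    from real_polynomial_function_compose[OF this real_polynomial_function_polys[OF P]]
    obtain a n where a: "P \<circ> f = (\<lambda>t. \<Sum>i\<le>n. a i * t ^ i)"
      using real_polynomial_function_imp_sum by blast
    \<comment> \<open>Parameters below this bound keep the line in the ball around
      \<open>x0\<close>; the 1 in the denominator covers \<open>y = x0\<close>.\<close>
    define \<delta> where "\<delta> = e / (1 + norm (y - x0))"
    have pos: "0 < 1 + norm (y - x0)" using norm_ge_zero[of "y - x0"] by linarith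
    have \<delta>: "0 < \<delta>" using e pos by (simp add: \<delta>_def)
    have "{0<..<\<delta>} \<subseteq> {t. (\<Sum>i\<le>n. a i * t ^ i) = 0}"
    proof
      fix t assume t: "t \<in> {0<..<\<delta>}"
      have "norm (t *\<^sub>R (y - x0)) \<le> t * (1 + norm (y - x0))" using t by (simp add: distrib_left)
      also have "\<dots> < \<delta> * (1 + norm (y - x0))" using t pos by (intro mult_strict_right_mono) auto
      also have "\<dots> = e" using pos by (simp add: \<delta>_def)
      finally have "f t \<in> interior \<kappa>" using e(2) by (auto simp: f_def dist_norm)
      then have "(P \<circ> f) t = 0" by (simp add: zero)
      then show "t \<in> {t. (\<Sum>i\<le>n. a i * t ^ i) = 0}" by (simp add: a)
    qed
    then have "infinite {t. (\<Sum>i\<le>n. a i * t ^ i) = 0}"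
      using infinite_Ioo[OF \<delta>] finite_subset by blast
    then have "\<forall>i\<le>n. a i = 0" using polyfun_finite_roots[where n = n and c = a] by blast
    then have "(P \<circ> f) 1 = 0" unfolding a by simp
    then show "P y = 0 y" by (simp add: f_def)
  qed
qed

section \<open>Square integrable functions on bounded sets\<close>

lemma L2_norm_eq_sqrt_inner: "L2_norm M f = sqrt (L2_inner M f f)"
  by (simp add: L2_norm_def L2_inner_def power2_norm_eq_inner)

lemma L2_norm_nonneg [simp]: "0 \<le> L2_norm M f"
  by (simp add: L2_norm_def)

lemma integrable_lebesgue_on_bounded:
  fixes f :: "'a::euclidean_space \<Rightarrow> 'b::euclidean_space"
  assumes "S \<in> lmeasurable" "f \<in> borel_measurable (lebesgue_on S)" "AE x in lebesgue_on S. norm (f x) \<le> C"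
  shows "integrable (lebesgue_on S) f"
proof -
  interpret finite_measure "lebesgue_on S" using assms(1) by (rule finite_measure_lebesgue_on)
  show ?thesis using assms(3,2) by (rule integrable_const_bound)
qed

lemma borel_measurable_lebesgue_on: "f \<in> borel_measurable borel \<Longrightarrow> f \<in> borel_measurable (lebesgue_on S)"
  by (intro measurable_restrict_space1 measurable_completion) simp

lemma integrable_polys_mult:
  assumes "compact \<kappa>" "P \<in> polys j" "Q \<in> polys j"
  shows "integrable (lebesgue_on \<kappa>) (\<lambda>x. P x * Q x)"
proof -
  have c: "continuous_on S (\<lambda>x. P x * Q x)" for S
    using assms by (intro continuous_intros continuous_on_polys)
  have "bounded ((\<lambda>x. P x * Q x) ` \<kappa>)"
    using assms(1) c by (intro compact_imp_bounded compact_continuous_image)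
  then obtain C where C: "\<And>x. x \<in> \<kappa> \<Longrightarrow> norm (P x * Q x) \<le> C" by (auto simp: bounded_iff)
  have "(\<lambda>x. P x * Q x) \<in> borel_measurable borel" using c by (intro borel_measurable_continuous_onI)
  then show ?thesis
    using assms(1) C
    by (intro integrable_lebesgue_on_bounded[of _ _ C])
      (auto intro: lmeasurable_compact borel_measurable_lebesgue_on AE_I2)
qed

lemma semi_inner_polys:
  assumes "compact \<kappa>"
  shows "semi_inner (polys j) (L2_inner (lebesgue_on \<kappa>))"
proof
  show "subspace (polys j)" by (rule subspace_polys)
next
  fix P Q S :: "real^'a \<Rightarrow> real" assume "P \<in> polys j" "Q \<in> polys j" "S \<in> polys j"
  then show "L2_inner (lebesgue_on \<kappa>) (P + Q) S = L2_inner (lebesgue_on \<kappa>) P S + L2_inner (lebesgue_on \<kappa>) Q S"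
    using assms by (simp add: L2_inner_def distrib_right integrable_polys_mult)
next
  fix c and P Q :: "real^'a \<Rightarrow> real" assume "P \<in> polys j" "Q \<in> polys j"
  then show "L2_inner (lebesgue_on \<kappa>) (c *\<^sub>R P) Q = c * L2_inner (lebesgue_on \<kappa>) P Q"
    by (simp add: L2_inner_def mult.assoc)
next
  fix P Q :: "real^'a \<Rightarrow> real"
  show "L2_inner (lebesgue_on \<kappa>) P Q = L2_inner (lebesgue_on \<kappa>) Q P"
    by (simp add: L2_inner_def mult.commute)
next
  fix P :: "real^'a \<Rightarrow> real"
  show "0 \<le> L2_inner (lebesgue_on \<kappa>) P P" by (simp add: L2_inner_def)
qed

text \<open>Here the nonempty interior of an element enters: it turns the semidefinite form into an
  inner product on polynomials, as Gram-Schmidt requires.\<close>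

lemma L2_inner_polys_definite:
  fixes P :: "real^'n \<Rightarrow> real"
  assumes "compact \<kappa>" "interior \<kappa> \<noteq> {}" "P \<in> polys j" "L2_inner (lebesgue_on \<kappa>) P P = 0"
  shows "P = 0"
proof (rule polys_eq_0_if_AE[OF assms(3) _ assms(2)])
  show "\<kappa> \<in> sets lebesgue" using assms(1) by (simp add: lmeasurable_compact fmeasurableD)
  have "AE x in lebesgue_on \<kappa>. P x * P x = 0"
    using assms(4) integrable_polys_mult[OF assms(1,3,3)]
    by (subst (asm) L2_inner_def) (simp add: integral_nonneg_eq_0_iff_AE)
  then show "AE x in lebesgue_on \<kappa>. P x = 0" by simp
qed

lemma polys_orthonormal_basis:
  fixes \<kappa> :: "(real^'n) set"
  assumes "compact \<kappa>" "interior \<kappa> \<noteq> {}"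
  obtains E where "finite E" "E \<subseteq> polys j"
    "\<And>e e'. e \<in> E \<Longrightarrow> e' \<in> E \<Longrightarrow> L2_inner (lebesgue_on \<kappa>) e e' = (if e = e' then 1 else 0)"
    "\<And>P. P \<in> polys j \<Longrightarrow> P = (\<Sum>e\<in>E. L2_inner (lebesgue_on \<kappa>) P e *\<^sub>R e)"
proof -
  interpret semi_inner "polys j" "L2_inner (lebesgue_on \<kappa>)" using assms(1) by (rule semi_inner_polys)
  have "\<exists>E. finite E \<and> E \<subseteq> polys j \<and>
      (\<forall>e\<in>E. \<forall>e'\<in>E. L2_inner (lebesgue_on \<kappa>) e e' = (if e = e' then 1 else 0)) \<and>
      (\<forall>P\<in>span (monomial ` {\<alpha>::'n \<Rightarrow> nat. sum \<alpha> UNIV \<le> j}). P = (\<Sum>e\<in>E. L2_inner (lebesgue_on \<kappa>) P e *\<^sub>R e))"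
    using assms finite_multiindices
    by (intro orthonormal_expansion) (auto intro: L2_inner_polys_definite simp: monomial_mem_polys)
  then obtain E where "finite E" "E \<subseteq> polys j"
    "\<forall>e\<in>E. \<forall>e'\<in>E. L2_inner (lebesgue_on \<kappa>) e e' = (if e = e' then 1 else 0)"
    "\<forall>P\<in>polys j. P = (\<Sum>e\<in>E. L2_inner (lebesgue_on \<kappa>) P e *\<^sub>R e)"
    unfolding polys_eq_span[symmetric] by blast
  then show ?thesis by (intro that[of E]) blast+
qed

text \<open>In an orthonormal basis each coefficient of \<open>P\<close> is at most its norm, so the
  bounds follow from those of finitely many basis polynomials on \<open>K\<close>. The set
  \<open>K\<close> is separate from \<open>\<kappa>\<close> because it will be the closure of the
  whole domain.\<close>

lemma polys_sup_bound:
  fixes \<kappa> K :: "(real^'n) set"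
  assumes \<kappa>: "compact \<kappa>" "interior \<kappa> \<noteq> {}" and K: "compact K"
  obtains C where "0 \<le> C" "\<And>P x. P \<in> polys j \<Longrightarrow> x \<in> K \<Longrightarrow> \<bar>P x\<bar> \<le> C * L2_norm (lebesgue_on \<kappa>) P"
    "\<And>P x. P \<in> polys j \<Longrightarrow> x \<in> K \<Longrightarrow> norm (grad P x) \<le> C * L2_norm (lebesgue_on \<kappa>) P"
proof -
  let ?ip = "L2_inner (lebesgue_on \<kappa>)"
  interpret semi_inner "polys j" ?ip using \<kappa>(1) by (rule semi_inner_polys)
  obtain E where E: "finite E" "E \<subseteq> polys j"
    "\<And>e e'. e \<in> E \<Longrightarrow> e' \<in> E \<Longrightarrow> ?ip e e' = (if e = e' then 1 else 0)"
    "\<And>P. P \<in> polys j \<Longrightarrow> P = (\<Sum>e\<in>E. ?ip P e *\<^sub>R e)"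
    using polys_orthonormal_basis[OF \<kappa>] by blast
  have bdd: "\<exists>C. \<forall>x\<in>K. \<bar>P x\<bar> \<le> C" if "P \<in> polys m" for P :: "real^'n \<Rightarrow> real" and m
  proof -
    have "bounded (P ` K)"
      using K continuous_on_polys[OF that] by (intro compact_imp_bounded compact_continuous_image)
    then show ?thesis by (auto simp: bounded_iff)
  qed
  have coeff: "\<bar>?ip P e\<bar> \<le> L2_norm (lebesgue_on \<kappa>) P" if "P \<in> polys j" "e \<in> E" for P e
    using abs_ip_le[of P e] that E(2,3) by (auto simp: L2_norm_eq_sqrt_inner)
  have nn: "0 \<le> L2_norm (lebesgue_on \<kappa>) P" for P :: "real^'n \<Rightarrow> real" by (simp add: L2_norm_def)
  have "\<forall>e\<in>E. \<exists>C. \<forall>x\<in>K. \<bar>e x\<bar> + (\<Sum>i\<in>UNIV. \<bar>partial i e x\<bar>) \<le> C"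
  proof
    fix e assume "e \<in> E"
    then have e: "e \<in> polys j" using E(2) by blast
    have "\<forall>i. \<exists>C. \<forall>x\<in>K. \<bar>partial i e x\<bar> \<le> C" using bdd[OF partial_polys[OF e]] by blast
    then obtain D where D: "\<And>i x. x \<in> K \<Longrightarrow> \<bar>partial i e x\<bar> \<le> D i" by metis
    obtain C where C: "\<And>x. x \<in> K \<Longrightarrow> \<bar>e x\<bar> \<le> C" using bdd[OF e] by blast
    have "\<forall>x\<in>K. \<bar>e x\<bar> + (\<Sum>i\<in>UNIV. \<bar>partial i e x\<bar>) \<le> C + (\<Sum>i\<in>UNIV. D i)"
      using C D by (auto intro!: add_mono sum_mono)
    then show "\<exists>C. \<forall>x\<in>K. \<bar>e x\<bar> + (\<Sum>i\<in>UNIV. \<bar>partial i e x\<bar>) \<le> C" by blast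
  qed
  then obtain D where D: "\<And>e x. e \<in> E \<Longrightarrow> x \<in> K \<Longrightarrow> \<bar>e x\<bar> + (\<Sum>i\<in>UNIV. \<bar>partial i e x\<bar>) \<le> D e"
    by metis
  define C where "C = (\<Sum>e\<in>E. \<bar>D e\<bar>)"
  have val: "\<bar>e x\<bar> \<le> \<bar>D e\<bar>" "norm (grad e x) \<le> \<bar>D e\<bar>" if "e \<in> E" "x \<in> K" for e x
  proof -
    have "0 \<le> (\<Sum>i\<in>UNIV. \<bar>partial i e x\<bar>)" by (simp add: sum_nonneg)
    then show "\<bar>e x\<bar> \<le> \<bar>D e\<bar>" using D[OF that] by linarith
    have "norm (grad e x) \<le> (\<Sum>i\<in>UNIV. \<bar>partial i e x\<bar>)"
      using norm_le_l1_cart[of "grad e x"] by (simp add: grad_def)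
    then show "norm (grad e x) \<le> \<bar>D e\<bar>" using D[OF that] by linarith
  qed
  show ?thesis
  proof
    show "0 \<le> C" by (simp add: C_def sum_nonneg)
    fix P :: "real^'n \<Rightarrow> real" and x assume P: "P \<in> polys j" and x: "x \<in> K"
    have "P x = (\<Sum>e\<in>E. ?ip P e *\<^sub>R e) x" using E(4)[OF P] by simp
    also have "\<dots> = (\<Sum>e\<in>E. ?ip P e * e x)" by (simp add: sum_fun_apply)
    finally have "\<bar>P x\<bar> \<le> (\<Sum>e\<in>E. \<bar>?ip P e * e x\<bar>)" by (simp add: sum_abs)
    also have "\<dots> \<le> (\<Sum>e\<in>E. \<bar>D e\<bar> * L2_norm (lebesgue_on \<kappa>) P)"
      unfolding abs_mult using coeff[OF P] val(1) x nn
      by (intro sum_mono) (metis abs_ge_zero mult.commute mult_mono)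
    finally show "\<bar>P x\<bar> \<le> C * L2_norm (lebesgue_on \<kappa>) P" by (simp add: C_def sum_distrib_right)
    \<comment> \<open>\<open>grad\<close> is additive only for differentiable functions, hence an
      induction in which every partial sum is known to be a polynomial.\<close>
    have gsum: "grad (\<Sum>e\<in>F. c e *\<^sub>R e) x = (\<Sum>e\<in>F. c e *\<^sub>R grad e x)" if "F \<subseteq> E" for F c
      using finite_subset[OF that E(1)] that
    proof (induction F)
      case empty
      then show ?case by (simp add: grad_def partial_zero partial_zero[unfolded zero_fun_def] vec_eq_iff)
    next
      case (insert e F)
      have e: "e \<in> polys j" and F: "(\<Sum>e\<in>F. c e *\<^sub>R e) \<in> polys j"
        using insert.prems E(2) by (auto intro!: mem_sum mem_scaleR)
      have "grad (c e *\<^sub>R e + (\<Sum>e\<in>F. c e *\<^sub>R e)) x = grad (c e *\<^sub>R e) x + grad (\<Sum>e\<in>F. c e *\<^sub>R e) x"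
        by (rule grad_add[OF differentiable_polys[OF mem_scaleR[OF e]] differentiable_polys[OF F]])
      also have "grad (c e *\<^sub>R e) x = c e *\<^sub>R grad e x"
        by (rule grad_scaleR[OF differentiable_polys[OF e]])
      also have "grad (\<Sum>e\<in>F. c e *\<^sub>R e) x = (\<Sum>e\<in>F. c e *\<^sub>R grad e x)"
        using insert.IH insert.prems by blast
      finally show ?case unfolding sum.insert[OF insert.hyps] .
    qed
    have "grad P x = grad (\<Sum>e\<in>E. ?ip P e *\<^sub>R e) x" using E(4)[OF P] by simp
    also have "\<dots> = (\<Sum>e\<in>E. ?ip P e *\<^sub>R grad e x)" by (rule gsum) simp
    finally have "norm (grad P x) \<le> (\<Sum>e\<in>E. norm (?ip P e *\<^sub>R grad e x))" by (simp only: norm_sum)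
    also have "\<dots> \<le> (\<Sum>e\<in>E. \<bar>D e\<bar> * L2_norm (lebesgue_on \<kappa>) P)"
      unfolding norm_scaleR using coeff[OF P] val(2) x nn
      by (intro sum_mono) (metis abs_ge_zero mult.commute mult_mono norm_ge_zero)
    finally show "norm (grad P x) \<le> C * L2_norm (lebesgue_on \<kappa>) P" by (simp add: C_def sum_distrib_right)
  qed
qed

text \<open>In finite dimension the representing polynomial is explicit: its coefficients in an
  orthonormal basis are the values of \<open>f\<close> there. It will produce the lifting.\<close>

lemma polys_riesz:
  fixes \<kappa> :: "(real^'n) set" and f :: "(real^'n \<Rightarrow> real) \<Rightarrow> real"
  assumes \<kappa>: "compact \<kappa>" "interior \<kappa> \<noteq> {}"
    and f: "\<And>P Q. P \<in> polys j \<Longrightarrow> Q \<in> polys j \<Longrightarrow> f (P + Q) = f P + f Q"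
      "\<And>c P. P \<in> polys j \<Longrightarrow> f (c *\<^sub>R P) = c * f P"
  shows "\<exists>W\<in>polys j. \<forall>P\<in>polys j. L2_inner (lebesgue_on \<kappa>) W P = f P"
proof -
  let ?ip = "L2_inner (lebesgue_on \<kappa>)"
  interpret semi_inner "polys j" ?ip using \<kappa>(1) by (rule semi_inner_polys)
  obtain E where E: "finite E" "E \<subseteq> polys j"
    and "\<And>e e'. e \<in> E \<Longrightarrow> e' \<in> E \<Longrightarrow> ?ip e e' = (if e = e' then 1 else 0)"
    and expansion: "\<And>P. P \<in> polys j \<Longrightarrow> P = (\<Sum>e\<in>E. ?ip P e *\<^sub>R e)"
    using polys_orthonormal_basis[OF \<kappa>] by blast
  have eV: "e \<in> polys j" if "e \<in> E" for e using that E(2) by blast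
  have f0: "f 0 = 0" using f(2)[of 0 0] mem_zero by simp
  have fsum: "f (\<Sum>e\<in>F. c e *\<^sub>R e) = (\<Sum>e\<in>F. c e * f e)" if "F \<subseteq> E" for F c
    using finite_subset[OF that E(1)] that
  proof (induction F)
    case (insert e F)
    have e: "e \<in> polys j" and F: "(\<Sum>e\<in>F. c e *\<^sub>R e) \<in> polys j"
      using insert.prems E(2) by (auto intro!: mem_sum mem_scaleR)
    have "f (\<Sum>e\<in>F. c e *\<^sub>R e) = (\<Sum>e\<in>F. c e * f e)"
      using insert.IH insert.prems by blast
    then show ?case
      unfolding sum.insert[OF insert.hyps] f(1)[OF mem_scaleR[OF e] F] f(2)[OF e] by simp
  qed (simp add: f0)
  let ?W = "\<Sum>e\<in>E. f e *\<^sub>R e"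
  have "?ip ?W P = f P" if P: "P \<in> polys j" for P
  proof -
    have "?ip ?W P = (\<Sum>e\<in>E. f e * ?ip e P)"
      using P eV by (subst ip_sum_left) (auto simp: ip_scaleR_left mem_scaleR)
    also have "\<dots> = (\<Sum>e\<in>E. ?ip P e * f e)"
      using P eV by (intro sum.cong) (auto simp: ip_commute)
    also have "\<dots> = f (\<Sum>e\<in>E. ?ip P e *\<^sub>R e)" by (rule fsum[symmetric]) simp
    also have "\<dots> = f P" using expansion[OF P] by simp
    finally show ?thesis .
  qed
  moreover have "?W \<in> polys j" using eV by (simp add: mem_sum mem_scaleR)
  ultimately show ?thesis by blast
qed

section \<open>Broken polynomials on a fixed mesh\<close>

text \<open>The facts about one mesh on which the operators rest;
  \<open>broken_mesh_of_mesh_family\<close> derives them from the geometry.\<close>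

locale broken_mesh =
  fixes \<Omega> :: "(real^'n) set" and \<T> :: "(real^'n) set set"
  assumes open_domain: "open \<Omega>" and bounded_domain: "bounded \<Omega>"
    and finite_mesh: "finite \<T>" and Union_mesh: "\<Union>\<T> = closure \<Omega>"
    and compact_elem: "\<kappa> \<in> \<T> \<Longrightarrow> compact \<kappa>"
    and interior_elem: "\<kappa> \<in> \<T> \<Longrightarrow> interior \<kappa> \<noteq> {}"
    and negligible_overlap: "\<kappa> \<in> \<T> \<Longrightarrow> \<kappa>' \<in> \<T> \<Longrightarrow> \<kappa> \<noteq> \<kappa>' \<Longrightarrow> negligible (\<kappa> \<inter> \<kappa>')"
    and negligible_boundary: "negligible (frontier \<Omega>)"
    and hausdorff_boundary: "hausdorff_outer (real CARD('n) - 1) (frontier \<Omega>) < \<infinity>"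
    and hausdorff_Gamma_int: "hausdorff_outer (real CARD('n) - 1) (Gamma_int \<Omega> \<T>) < \<infinity>"
begin

abbreviation "M\<Omega> \<equiv> lebesgue_on \<Omega>"

lemma sets_domain: "\<Omega> \<in> sets lebesgue" using open_domain by (simp add: borel_open)

lemma lmeasurable_domain: "\<Omega> \<in> lmeasurable" using open_domain bounded_domain by (rule lmeasurable_open[rotated])

lemma sets_elem: "\<kappa> \<in> \<T> \<Longrightarrow> \<kappa> \<in> sets lebesgue"
  using compact_elem by (simp add: lmeasurable_compact fmeasurableD)

lemma compact_closure_domain: "compact (closure \<Omega>)" using bounded_domain by (simp add: compact_closure)

lemma elem_subset: "\<kappa> \<in> \<T> \<Longrightarrow> \<kappa> \<subseteq> closure \<Omega>" using Union_mesh by blast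

lemma closed_elem: "\<kappa> \<in> \<T> \<Longrightarrow> closed \<kappa>" using compact_elem compact_imp_closed by blast

lemma domain_subset: "\<Omega> \<subseteq> \<Union>\<T>" using Union_mesh closure_subset by metis

lemma AE_domain_if_AE_elem:
  assumes "\<And>\<kappa>. \<kappa> \<in> \<T> \<Longrightarrow> AE x in lebesgue_on \<kappa>. P \<kappa> x"
  shows "AE x in M\<Omega>. \<forall>\<kappa>\<in>\<T>. x \<in> \<kappa> \<longrightarrow> P \<kappa> x"
proof -
  have "negligible (\<Union>((\<lambda>\<kappa>. {x \<in> \<kappa>. \<not> P \<kappa> x}) ` \<T>))"
    using assms sets_elem finite_mesh by (intro negligible_Union) (auto simp: AE_lebesgue_on_iff_negligible)
  then show ?thesis
    unfolding AE_lebesgue_on_iff_negligible[OF sets_domain] by (rule negligible_subset) blast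
qed

text \<open>Elements are closed and may reach the boundary, which must therefore be null for this
  direction.\<close>

lemma AE_elem_if_AE_domain:
  assumes "\<kappa> \<in> \<T>" "AE x in M\<Omega>. P x"
  shows "AE x in lebesgue_on \<kappa>. P x"
proof -
  have "negligible ({x \<in> \<Omega>. \<not> P x} \<union> frontier \<Omega>)"
    using assms(2) negligible_boundary
    unfolding AE_lebesgue_on_iff_negligible[OF sets_domain] by (rule negligible_Un)
  moreover have "\<kappa> \<subseteq> \<Omega> \<union> frontier \<Omega>"
    using elem_subset[OF assms(1)] open_domain by (auto simp: frontier_def interior_open)
  then have "{x \<in> \<kappa>. \<not> P x} \<subseteq> {x \<in> \<Omega>. \<not> P x} \<union> frontier \<Omega>" by blast
  ultimately show ?thesis
    unfolding AE_lebesgue_on_iff_negligible[OF sets_elem[OF assms(1)]] by (rule negligible_subset)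
qed

lemma elem_at_mem: "x \<in> closure \<Omega> \<Longrightarrow> elem_at \<T> x \<in> \<T> \<and> x \<in> elem_at \<T> x"
  unfolding elem_at_def Union_mesh[symmetric] by (rule someI_ex) blast

text \<open>The choice in \<open>elem_at\<close> is ambiguous only on overlaps, and these form a
  finite union of null sets.\<close>

lemma AE_elem_at: "AE x in M\<Omega>. \<forall>\<kappa>\<in>\<T>. x \<in> \<kappa> \<longrightarrow> elem_at \<T> x = \<kappa>"
proof -
  have "negligible (\<Union>(\<kappa>, \<kappa>')\<in>{(\<kappa>, \<kappa>') \<in> \<T> \<times> \<T>. \<kappa> \<noteq> \<kappa>'}. \<kappa> \<inter> \<kappa>')"
  proof (rule negligible_Union)
    show "finite ((\<lambda>(\<kappa>, \<kappa>'). \<kappa> \<inter> \<kappa>') ` {(\<kappa>, \<kappa>') \<in> \<T> \<times> \<T>. \<kappa> \<noteq> \<kappa>'})"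
      by (rule finite_imageI, rule finite_subset[of _ "\<T> \<times> \<T>"]) (use finite_mesh in auto)
  qed (auto intro: negligible_overlap)
  then show ?thesis
    unfolding AE_lebesgue_on_iff_negligible[OF sets_domain]
  proof (rule negligible_subset)
    show "{x \<in> \<Omega>. \<not> (\<forall>\<kappa>\<in>\<T>. x \<in> \<kappa> \<longrightarrow> elem_at \<T> x = \<kappa>)}
      \<subseteq> (\<Union>(\<kappa>, \<kappa>')\<in>{(\<kappa>, \<kappa>') \<in> \<T> \<times> \<T>. \<kappa> \<noteq> \<kappa>'}. \<kappa> \<inter> \<kappa>')"
    proof
      fix x assume "x \<in> {x \<in> \<Omega>. \<not> (\<forall>\<kappa>\<in>\<T>. x \<in> \<kappa> \<longrightarrow> elem_at \<T> x = \<kappa>)}"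
      then obtain \<kappa> where "x \<in> \<Omega>" "\<kappa> \<in> \<T>" "x \<in> \<kappa>" "elem_at \<T> x \<noteq> \<kappa>" by blast
      moreover have "elem_at \<T> x \<in> \<T> \<and> x \<in> elem_at \<T> x"
        using \<open>x \<in> \<Omega>\<close> closure_subset by (intro elem_at_mem) blast
      ultimately show "x \<in> (\<Union>(\<kappa>, \<kappa>')\<in>{(\<kappa>, \<kappa>') \<in> \<T> \<times> \<T>. \<kappa> \<noteq> \<kappa>'}. \<kappa> \<inter> \<kappa>')"
        by (intro UN_I[of "(elem_at \<T> x, \<kappa>)"]) auto
    qed
  qed
qed

text \<open>Off the null overlaps exactly one element contains a given point of the domain, so the
  sum of the \<open>g \<kappa>\<close>, each extended by 0, has at most one nonzero term. All
  integrals are moved to the whole space for the comparison.\<close>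

lemma integral_broken:
  fixes f :: "real^'n \<Rightarrow> real"
  assumes f: "f \<in> borel_measurable M\<Omega>" and g: "\<And>\<kappa>. \<kappa> \<in> \<T> \<Longrightarrow> integrable (lebesgue_on \<kappa>) (g \<kappa>)"
    and AE: "AE x in M\<Omega>. \<forall>\<kappa>\<in>\<T>. x \<in> \<kappa> \<longrightarrow> f x = g \<kappa> x"
  shows "integrable M\<Omega> f" and "(LINT x|M\<Omega>. f x) = (\<Sum>\<kappa>\<in>\<T>. LINT x|lebesgue_on \<kappa>. g \<kappa> x)"
proof -
  let ?F = "\<lambda>x. indicator \<Omega> x *\<^sub>R f x" and ?G = "\<lambda>x. \<Sum>\<kappa>\<in>\<T>. indicator \<kappa> x *\<^sub>R g \<kappa> x"
  have Gi: "integrable lebesgue (\<lambda>x. indicator \<kappa> x *\<^sub>R g \<kappa> x)" if "\<kappa> \<in> \<T>" for \<kappa>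
    using g[OF that] sets_elem[OF that] by (subst (asm) integrable_restrict_space) auto
  then have G: "integrable lebesgue ?G" by (rule Bochner_Integration.integrable_sum)
  have F: "?F \<in> borel_measurable lebesgue"
    using f sets_domain by (subst (asm) borel_measurable_restrict_space_iff) auto
  have 1: "AE x in lebesgue. x \<in> \<Omega> \<longrightarrow> (\<forall>\<kappa>\<in>\<T>. x \<in> \<kappa> \<longrightarrow> f x = g \<kappa> x)"
    using AE sets_domain by (subst (asm) AE_restrict_space_iff) auto
  have 2: "AE x in lebesgue. x \<in> \<Omega> \<longrightarrow> (\<forall>\<kappa>\<in>\<T>. x \<in> \<kappa> \<longrightarrow> elem_at \<T> x = \<kappa>)"
    using AE_elem_at sets_domain by (subst (asm) AE_restrict_space_iff) auto
  have 3: "AE x in lebesgue. x \<notin> frontier \<Omega>"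
    using negligible_boundary by (intro AE_not_in) (simp add: negligible_iff_null_sets)
  have eq: "AE x in lebesgue. ?F x = ?G x"
    using 1 2 3
  proof eventually_elim
    case (elim x)
    show ?case
    proof (cases "x \<in> \<Omega>")
      case True
      let ?k = "elem_at \<T> x"
      have k: "?k \<in> \<T>" "x \<in> ?k" using elem_at_mem[of x] True closure_subset by blast+
      have uniq: "x \<in> \<kappa> \<longleftrightarrow> \<kappa> = ?k" if "\<kappa> \<in> \<T>" for \<kappa> using elim(2) True that k by blast
      have "?G x = (\<Sum>\<kappa>\<in>\<T>. if \<kappa> = ?k then g ?k x else 0)"
        by (intro sum.cong refl) (auto simp: uniq indicator_def)
      also have "\<dots> = g ?k x" using k finite_mesh by simp
      also have "\<dots> = f x" using elim(1) True k by simp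
      finally show ?thesis using True by simp
    next
      case False
      then have "x \<notin> closure \<Omega>" using elim(3) open_domain by (simp add: frontier_def interior_open)
      then have "x \<notin> \<kappa>" if "\<kappa> \<in> \<T>" for \<kappa> using elem_subset[OF that] by blast
      then have "?G x = 0" by (intro sum.neutral) auto
      then show ?thesis using False by simp
    qed
  qed
  have "integrable lebesgue ?F"
    using integrable_cong_AE[OF F borel_measurable_integrable[OF G] eq] G by simp
  then show "integrable M\<Omega> f" using sets_domain by (subst integrable_restrict_space) auto
  have "(LINT x|M\<Omega>. f x) = (LINT x|lebesgue. ?F x)"
    using sets_domain by (subst integral_restrict_space) auto
  also have "\<dots> = (LINT x|lebesgue. ?G x)"
    by (rule integral_cong_AE[OF F borel_measurable_integrable[OF G] eq])
  also have "\<dots> = (\<Sum>\<kappa>\<in>\<T>. LINT x|lebesgue. indicator \<kappa> x *\<^sub>R g \<kappa> x)"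
    by (rule Bochner_Integration.integral_sum) (rule Gi)
  also have "\<dots> = (\<Sum>\<kappa>\<in>\<T>. LINT x|lebesgue_on \<kappa>. g \<kappa> x)"
    using sets_elem by (intro sum.cong refl) (subst integral_restrict_space, auto)
  finally show "(LINT x|M\<Omega>. f x) = (\<Sum>\<kappa>\<in>\<T>. LINT x|lebesgue_on \<kappa>. g \<kappa> x)" .
qed

text \<open>Two candidates may have different degrees, but their difference is a polynomial that
  vanishes almost everywhere on a set with interior points. So the description in
  \<open>on_elem\<close> denotes.\<close>

lemma on_elem_eq:
  assumes \<kappa>: "\<kappa> \<in> \<T>" and P: "P \<in> polys j" "AE x in lebesgue_on \<kappa>. u x = P x"
  shows "on_elem \<kappa> u = P"
  unfolding on_elem_def
proof (rule the_equality)
  show "(\<exists>j. P \<in> polys j) \<and> (AE x in lebesgue_on \<kappa>. u x = P x)" using P by blast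
  fix Q :: "real^'n \<Rightarrow> real"
  assume Q: "(\<exists>j. Q \<in> polys j) \<and> (AE x in lebesgue_on \<kappa>. u x = Q x)"
  then obtain i where "Q \<in> polys i" by blast
  then have "Q \<in> polys (max i j)" "P \<in> polys (max i j)"
    using P(1) polys_mono[of i "max i j"] polys_mono[of j "max i j"] by auto
  then have d: "Q - P \<in> polys (max i j)" by (rule subspace_diff[OF subspace_polys])
  have "AE x in lebesgue_on \<kappa>. (Q - P) x = 0"
    using P(2) conjunct2[OF Q] by eventually_elim simp
  then have "Q - P = 0" by (rule polys_eq_0_if_AE[OF d sets_elem[OF \<kappa>] interior_elem[OF \<kappa>]])
  then show "Q = P" by simp
qed

lemma on_elem:
  assumes "u \<in> broken_polys j \<Omega> \<T>" "\<kappa> \<in> \<T>"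
  shows on_elem_polys: "on_elem \<kappa> u \<in> polys j"
    and AE_on_elem: "AE x in lebesgue_on \<kappa>. u x = on_elem \<kappa> u x"
proof -
  obtain P where P: "P \<in> polys j" "AE x in lebesgue_on \<kappa>. u x = P x"
    using assms by (auto simp: broken_polys_def)
  then show "on_elem \<kappa> u \<in> polys j" "AE x in lebesgue_on \<kappa>. u x = on_elem \<kappa> u x"
    using on_elem_eq[OF assms(2) P] by simp_all
qed

lemma AE_on_elem_domain:
  "u \<in> broken_polys j \<Omega> \<T> \<Longrightarrow> AE x in M\<Omega>. \<forall>\<kappa>\<in>\<T>. x \<in> \<kappa> \<longrightarrow> u x = on_elem \<kappa> u x"
  by (rule AE_domain_if_AE_elem) (rule AE_on_elem)

lemma on_elem_add:
  assumes "u \<in> broken_polys j \<Omega> \<T>" "v \<in> broken_polys j \<Omega> \<T>" "\<kappa> \<in> \<T>"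
  shows "on_elem \<kappa> (u + v) = on_elem \<kappa> u + on_elem \<kappa> v"
proof (rule on_elem_eq[OF assms(3)])
  show "on_elem \<kappa> u + on_elem \<kappa> v \<in> polys j"
    using assms by (intro subspace_add[OF subspace_polys] on_elem_polys)
  show "AE x in lebesgue_on \<kappa>. (u + v) x = (on_elem \<kappa> u + on_elem \<kappa> v) x"
    using AE_on_elem[OF assms(1,3)] AE_on_elem[OF assms(2,3)] by eventually_elim simp
qed

lemma on_elem_scaleR:
  assumes "u \<in> broken_polys j \<Omega> \<T>" "\<kappa> \<in> \<T>"
  shows "on_elem \<kappa> (c *\<^sub>R u) = c *\<^sub>R on_elem \<kappa> u"
proof (rule on_elem_eq[OF assms(2)])
  show "c *\<^sub>R on_elem \<kappa> u \<in> polys j"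
    using assms by (intro subspace_scale[OF subspace_polys] on_elem_polys)
  show "AE x in lebesgue_on \<kappa>. (c *\<^sub>R u) x = (c *\<^sub>R on_elem \<kappa> u) x"
    using AE_on_elem[OF assms] by eventually_elim simp
qed

lemma broken_polys_measurable: "u \<in> broken_polys j \<Omega> \<T> \<Longrightarrow> u \<in> borel_measurable M\<Omega>"
  by (auto simp: broken_polys_def)

lemma subspace_broken_polys: "subspace (broken_polys j \<Omega> \<T>)"
  unfolding subspace_def
proof (intro conjI ballI allI)
  have "\<forall>\<kappa>\<in>\<T>. \<exists>P\<in>polys j. AE x in lebesgue_on \<kappa>. (\<lambda>_. 0) x = P x"
    by (auto intro!: bexI[of _ 0] subspace_0[OF subspace_polys])
  then show "0 \<in> broken_polys j \<Omega> \<T>" unfolding broken_polys_def zero_fun_def by simp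
next
  fix u v assume u: "u \<in> broken_polys j \<Omega> \<T>" and v: "v \<in> broken_polys j \<Omega> \<T>"
  have "integrable M\<Omega> (u + v)" unfolding plus_fun_def using u v by (auto simp: broken_polys_def)
  moreover have "\<exists>P\<in>polys j. AE x in lebesgue_on \<kappa>. (u + v) x = P x" if "\<kappa> \<in> \<T>" for \<kappa>
  proof (rule bexI[of _ "on_elem \<kappa> u + on_elem \<kappa> v"])
    show "AE x in lebesgue_on \<kappa>. (u + v) x = (on_elem \<kappa> u + on_elem \<kappa> v) x"
      using AE_on_elem[OF u that] AE_on_elem[OF v that] by eventually_elim simp
  qed (intro subspace_add[OF subspace_polys] on_elem_polys u v that)
  ultimately show "u + v \<in> broken_polys j \<Omega> \<T>" unfolding broken_polys_def by blast
next
  fix c u assume u: "u \<in> broken_polys j \<Omega> \<T>"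
  have "integrable M\<Omega> (c *\<^sub>R u)" unfolding scaleR_fun_def using u by (auto simp: broken_polys_def)
  moreover have "\<exists>P\<in>polys j. AE x in lebesgue_on \<kappa>. (c *\<^sub>R u) x = P x" if "\<kappa> \<in> \<T>" for \<kappa>
  proof (rule bexI[of _ "c *\<^sub>R on_elem \<kappa> u"])
    show "AE x in lebesgue_on \<kappa>. (c *\<^sub>R u) x = (c *\<^sub>R on_elem \<kappa> u) x"
      using AE_on_elem[OF u that] by eventually_elim simp
  qed (intro subspace_scale[OF subspace_polys] on_elem_polys u that)
  ultimately show "c *\<^sub>R u \<in> broken_polys j \<Omega> \<T>" unfolding broken_polys_def by blast
qed

lemma broken_polys_mult:
  assumes u: "u \<in> broken_polys j \<Omega> \<T>" and v: "v \<in> broken_polys j \<Omega> \<T>"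
  shows broken_polys_mult_integrable: "integrable M\<Omega> (\<lambda>x. u x * v x)"
    and "(LINT x|M\<Omega>. u x * v x) = (\<Sum>\<kappa>\<in>\<T>. LINT x|lebesgue_on \<kappa>. on_elem \<kappa> u x * on_elem \<kappa> v x)"
proof -
  have m: "(\<lambda>x. u x * v x) \<in> borel_measurable M\<Omega>"
    using broken_polys_measurable[OF u] broken_polys_measurable[OF v] by (rule borel_measurable_times)
  have i: "integrable (lebesgue_on \<kappa>) (\<lambda>x. on_elem \<kappa> u x * on_elem \<kappa> v x)" if "\<kappa> \<in> \<T>" for \<kappa>
    using integrable_polys_mult[OF compact_elem on_elem_polys on_elem_polys] u v that by blast
  have AE: "AE x in M\<Omega>. \<forall>\<kappa>\<in>\<T>. x \<in> \<kappa> \<longrightarrow> u x * v x = on_elem \<kappa> u x * on_elem \<kappa> v x"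
    using AE_on_elem_domain[OF u] AE_on_elem_domain[OF v] by eventually_elim simp
  show "integrable M\<Omega> (\<lambda>x. u x * v x)"
    "(LINT x|M\<Omega>. u x * v x) = (\<Sum>\<kappa>\<in>\<T>. LINT x|lebesgue_on \<kappa>. on_elem \<kappa> u x * on_elem \<kappa> v x)"
    by (rule integral_broken[OF m i AE], assumption)+
qed

text \<open>Needed for the variable powers of discrete fields to be integrable.\<close>

lemma broken_polys_AE_bounded:
  assumes u: "u \<in> broken_polys j \<Omega> \<T>"
  shows "\<exists>C. AE x in M\<Omega>. \<bar>u x\<bar> \<le> C"
proof -
  have "\<forall>\<kappa>\<in>\<T>. \<exists>C. \<forall>x\<in>\<kappa>. \<bar>on_elem \<kappa> u x\<bar> \<le> C"
  proof
    fix \<kappa> assume \<kappa>: "\<kappa> \<in> \<T>"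
    have "bounded (on_elem \<kappa> u ` \<kappa>)"
      using compact_elem[OF \<kappa>] continuous_on_polys[OF on_elem_polys[OF u \<kappa>]]
      by (intro compact_imp_bounded compact_continuous_image)
    then show "\<exists>C. \<forall>x\<in>\<kappa>. \<bar>on_elem \<kappa> u x\<bar> \<le> C" by (auto simp: bounded_iff)
  qed
  then obtain C where C: "\<And>\<kappa> x. \<kappa> \<in> \<T> \<Longrightarrow> x \<in> \<kappa> \<Longrightarrow> \<bar>on_elem \<kappa> u x\<bar> \<le> C \<kappa>" by metis
  have "AE x in M\<Omega>. x \<in> \<Omega>" by (rule AE_I2) simp
  then have "AE x in M\<Omega>. \<bar>u x\<bar> \<le> (\<Sum>\<kappa>\<in>\<T>. \<bar>C \<kappa>\<bar>)"
    using AE_on_elem_domain[OF u]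
  proof eventually_elim
    case (elim x)
    then obtain \<kappa> where \<kappa>: "\<kappa> \<in> \<T>" "x \<in> \<kappa>" using domain_subset by blast
    then have "\<bar>u x\<bar> \<le> \<bar>C \<kappa>\<bar>" using C[OF \<kappa>] elim(2) by simp
    also have "\<dots> \<le> (\<Sum>\<kappa>\<in>\<T>. \<bar>C \<kappa>\<bar>)" using \<kappa>(1) finite_mesh by (intro member_le_sum) auto
    finally show ?case .
  qed
  then show ?thesis by blast
qed

lemma L2_norm_on_elem_le:
  assumes u: "u \<in> broken_polys j \<Omega> \<T>" and \<kappa>: "\<kappa> \<in> \<T>"
  shows "L2_norm (lebesgue_on \<kappa>) (on_elem \<kappa> u) \<le> L2_norm M\<Omega> u"
proof -
  have "(LINT x|lebesgue_on \<kappa>. on_elem \<kappa> u x * on_elem \<kappa> u x)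
      \<le> (\<Sum>\<kappa>\<in>\<T>. LINT x|lebesgue_on \<kappa>. on_elem \<kappa> u x * on_elem \<kappa> u x)"
    using \<kappa> finite_mesh by (intro member_le_sum) auto
  also have "\<dots> = (LINT x|M\<Omega>. u x * u x)" by (rule broken_polys_mult(2)[OF u u, symmetric])
  finally show ?thesis by (simp add: L2_norm_eq_sqrt_inner L2_inner_def)
qed

text \<open>The point ranges over the closure of the domain independently of the element, so one
  constant covers the traces from all elements.\<close>

lemma on_elem_sup_bound:
  obtains C where "0 \<le> C"
    "\<And>u \<kappa> x. u \<in> broken_polys j \<Omega> \<T> \<Longrightarrow> \<kappa> \<in> \<T> \<Longrightarrow> x \<in> closure \<Omega> \<Longrightarrow>
      \<bar>on_elem \<kappa> u x\<bar> \<le> C * L2_norm M\<Omega> u"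
    "\<And>u \<kappa> x. u \<in> broken_polys j \<Omega> \<T> \<Longrightarrow> \<kappa> \<in> \<T> \<Longrightarrow> x \<in> closure \<Omega> \<Longrightarrow>
      norm (grad (on_elem \<kappa> u) x) \<le> C * L2_norm M\<Omega> u"
proof -
  have "\<forall>\<kappa>\<in>\<T>. \<exists>C\<ge>0. \<forall>P\<in>polys j. \<forall>x\<in>closure \<Omega>. \<bar>P x\<bar> \<le> C * L2_norm (lebesgue_on \<kappa>) P
      \<and> norm (grad P x) \<le> C * L2_norm (lebesgue_on \<kappa>) P"
  proof
    fix \<kappa> assume \<kappa>: "\<kappa> \<in> \<T>"
    obtain C where "0 \<le> C"
      "\<And>P x. P \<in> polys j \<Longrightarrow> x \<in> closure \<Omega> \<Longrightarrow> \<bar>P x\<bar> \<le> C * L2_norm (lebesgue_on \<kappa>) P"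
      "\<And>P x. P \<in> polys j \<Longrightarrow> x \<in> closure \<Omega> \<Longrightarrow> norm (grad P x) \<le> C * L2_norm (lebesgue_on \<kappa>) P"
      using polys_sup_bound[OF compact_elem[OF \<kappa>] interior_elem[OF \<kappa>] compact_closure_domain] by blast
    then show "\<exists>C\<ge>0. \<forall>P\<in>polys j. \<forall>x\<in>closure \<Omega>. \<bar>P x\<bar> \<le> C * L2_norm (lebesgue_on \<kappa>) P
      \<and> norm (grad P x) \<le> C * L2_norm (lebesgue_on \<kappa>) P" by blast
  qed
  then obtain C where C: "\<And>\<kappa>. \<kappa> \<in> \<T> \<Longrightarrow> 0 \<le> C \<kappa>"
    "\<And>\<kappa> P x. \<kappa> \<in> \<T> \<Longrightarrow> P \<in> polys j \<Longrightarrow> x \<in> closure \<Omega> \<Longrightarrow> \<bar>P x\<bar> \<le> C \<kappa> * L2_norm (lebesgue_on \<kappa>) P"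
    "\<And>\<kappa> P x. \<kappa> \<in> \<T> \<Longrightarrow> P \<in> polys j \<Longrightarrow> x \<in> closure \<Omega> \<Longrightarrow> norm (grad P x) \<le> C \<kappa> * L2_norm (lebesgue_on \<kappa>) P"
    by metis
  have le: "C \<kappa> * L2_norm (lebesgue_on \<kappa>) (on_elem \<kappa> u) \<le> (\<Sum>\<kappa>\<in>\<T>. C \<kappa>) * L2_norm M\<Omega> u"
    if "u \<in> broken_polys j \<Omega> \<T>" "\<kappa> \<in> \<T>" for u \<kappa>
    using that C(1) finite_mesh L2_norm_on_elem_le[OF that]
    by (intro mult_mono) (auto intro: member_le_sum sum_nonneg simp: L2_norm_def)
  show ?thesis
  proof
    show "0 \<le> (\<Sum>\<kappa>\<in>\<T>. C \<kappa>)" using C(1) by (rule sum_nonneg)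
    fix u \<kappa> x assume u: "u \<in> broken_polys j \<Omega> \<T>" and \<kappa>: "\<kappa> \<in> \<T>" and x: "x \<in> closure \<Omega>"
    show "\<bar>on_elem \<kappa> u x\<bar> \<le> (\<Sum>\<kappa>\<in>\<T>. C \<kappa>) * L2_norm M\<Omega> u"
      using C(2)[OF \<kappa> on_elem_polys[OF u \<kappa>] x] le[OF u \<kappa>] by linarith
    show "norm (grad (on_elem \<kappa> u) x) \<le> (\<Sum>\<kappa>\<in>\<T>. C \<kappa>) * L2_norm M\<Omega> u"
      using C(3)[OF \<kappa> on_elem_polys[OF u \<kappa>] x] le[OF u \<kappa>] by linarith
  qed
qed

end

text \<open>Each membership pattern is cut out by finitely many closed sets and complements of
  closed sets. Any choice that depends on \<open>x\<close> only through its pattern is thereby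
  measurable.\<close>

lemma measurable_membership:
  fixes \<C> :: "'a::topological_space set set"
  assumes "finite \<C>" "\<And>C. C \<in> \<C> \<Longrightarrow> closed C"
  shows "(\<lambda>x. {C \<in> \<C>. x \<in> C}) \<in> measurable borel (count_space (Pow \<C>))"
proof -
  have "(\<lambda>x. {C \<in> \<C>. x \<in> C}) -` {S} \<in> sets borel" if S: "S \<in> Pow \<C>" for S
  proof -
    have "(\<lambda>x. {C \<in> \<C>. x \<in> C}) -` {S} = (\<Inter>C\<in>S. C) \<inter> (\<Inter>C\<in>\<C> - S. - C)"
    proof (intro set_eqI iffI)
      fix x assume "x \<in> (\<lambda>x. {C \<in> \<C>. x \<in> C}) -` {S}"
      then have "{C \<in> \<C>. x \<in> C} = S" by simp
      then show "x \<in> (\<Inter>C\<in>S. C) \<inter> (\<Inter>C\<in>\<C> - S. - C)" by blast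
    next
      fix x assume "x \<in> (\<Inter>C\<in>S. C) \<inter> (\<Inter>C\<in>\<C> - S. - C)"
      then have "{C \<in> \<C>. x \<in> C} = S" using S by blast
      then show "x \<in> (\<lambda>x. {C \<in> \<C>. x \<in> C}) -` {S}" by simp
    qed
    moreover have "closed (\<Inter>C\<in>S. C)" using S assms(2) by (intro closed_INT) auto
    moreover have "open (\<Inter>C\<in>\<C> - S. - C)" using assms by (intro open_INT) (auto simp: open_Compl)
    ultimately show ?thesis by (simp only: sets.Int borel_closed borel_open)
  qed
  then show ?thesis using assms(1) by (subst measurable_count_space_eq2) auto
qed

section \<open>Measurability of functions defined element by element\<close>

context broken_mesh
begin

text \<open>\<open>elem_at\<close> picks from the set of elements containing \<open>x\<close>, so it
  depends on a finite pattern only. Off the closure of the domain the pattern is empty and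
  \<open>G\<close> is 0, hence the restricted agreement.\<close>

lemma measurable_elementwise:
  fixes g :: "(real^'n) set \<Rightarrow> real^'n \<Rightarrow> 'b::euclidean_space"
  assumes g: "\<And>\<kappa>. \<kappa> \<in> \<T> \<Longrightarrow> g \<kappa> \<in> borel_measurable borel"
  obtains G where "G \<in> borel_measurable borel" "\<And>x. x \<in> closure \<Omega> \<Longrightarrow> G x = g (elem_at \<T> x) x"
proof
  let ?f = "\<lambda>S x. if S = {} then 0 else g (SOME \<kappa>. \<kappa> \<in> S) x"
  have f: "?f S \<in> borel_measurable borel" if "S \<in> Pow \<T>" for S
  proof (cases "S = {}")
    case False
    then have "(SOME \<kappa>. \<kappa> \<in> S) \<in> \<T>" using that some_in_eq[of S] by blast
    then show ?thesis using False g by simp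
  qed simp
  show "(\<lambda>x. ?f {\<kappa> \<in> \<T>. x \<in> \<kappa>} x) \<in> borel_measurable borel"
    by (rule measurable_compose_countable'[OF f measurable_membership])
      (use finite_mesh closed_elem in \<open>auto intro: countable_finite\<close>)
  fix x assume "x \<in> closure \<Omega>"
  then have "{\<kappa> \<in> \<T>. x \<in> \<kappa>} \<noteq> {}" unfolding Union_mesh[symmetric] by blast
  then show "?f {\<kappa> \<in> \<T>. x \<in> \<kappa>} x = g (elem_at \<T> x) x"
    by (simp only: elem_at_def mem_Collect_eq if_False)
qed

lemma finite_mesh_faces: "finite (mesh_faces \<Omega> \<T>)"
proof -
  have "mesh_faces \<Omega> \<T> \<subseteq> (\<lambda>(\<kappa>, \<kappa>'). \<kappa> \<inter> \<kappa>') ` (\<T> \<times> \<T>) \<union> (\<lambda>\<kappa>. \<kappa> \<inter> frontier \<Omega>) ` \<T>"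
    by (auto simp: mesh_faces_def interior_faces_of_def)
  then show ?thesis by (rule finite_subset) (use finite_mesh in blast)
qed

lemma closed_mesh_face: "e \<in> mesh_faces \<Omega> \<T> \<Longrightarrow> closed e"
  by (auto simp: mesh_faces_def interior_faces_of_def closed_elem)

lemma mesh_face_subset: "e \<in> mesh_faces \<Omega> \<T> \<Longrightarrow> e \<subseteq> closure \<Omega>"
  using elem_subset by (auto simp: mesh_faces_def interior_faces_of_def)

lemma closed_Gamma_int: "closed (Gamma_int \<Omega> \<T>)"
  unfolding Gamma_int_def using finite_mesh_faces closed_mesh_face by (intro closed_Union) auto

lemma Gamma_int_subset: "Gamma_int \<Omega> \<T> \<subseteq> closure \<Omega>"
  using mesh_face_subset by (auto simp: Gamma_int_def)

lemma boundary_subset: "frontier \<Omega> \<subseteq> closure \<Omega>" by (simp add: frontier_def)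

lemma finite_measure_Gamma_int: "finite_measure (surface_on (Gamma_int \<Omega> \<T>))"
  using closed_Gamma_int hausdorff_Gamma_int by (intro finite_measure_surface_on) auto

lemma finite_measure_boundary: "finite_measure (surface_on (frontier \<Omega>))"
  using hausdorff_boundary by (intro finite_measure_surface_on) auto

text \<open>The chosen face depends only on the set of faces through \<open>x\<close>; for the empty
  set the choice is some fixed value.\<close>

lemma measurable_face_size: "face_size \<Omega> \<T> \<in> borel_measurable borel"
proof -
  have "(\<lambda>x. (\<lambda>S _. diameter (SOME e. e \<in> S)) {e \<in> mesh_faces \<Omega> \<T>. x \<in> e} x) \<in> borel_measurable borel"
    by (rule measurable_compose_countable'[OF _ measurable_membership])
      (use finite_mesh_faces closed_mesh_face in \<open>auto intro: countable_finite\<close>)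
  then show ?thesis by (simp add: face_size_def[abs_def])
qed

text \<open>Gluing: on overlaps \<open>elem_at\<close> decides which polynomial is taken, and this
  affects a null set only.\<close>

lemma broken_polysI:
  assumes P: "\<And>\<kappa>. \<kappa> \<in> \<T> \<Longrightarrow> P \<kappa> \<in> polys j"
  shows "(\<lambda>x. P (elem_at \<T> x) x) \<in> broken_polys j \<Omega> \<T>"
    and "\<And>\<kappa>. \<kappa> \<in> \<T> \<Longrightarrow> on_elem \<kappa> (\<lambda>x. P (elem_at \<T> x) x) = P \<kappa>"
proof -
  let ?f = "\<lambda>x. P (elem_at \<T> x) x"
  have "P \<kappa> \<in> borel_measurable borel" if "\<kappa> \<in> \<T>" for \<kappa>
    using continuous_on_polys[OF P[OF that]] by (rule borel_measurable_continuous_onI)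
  then obtain G where G: "G \<in> borel_measurable borel" "\<And>x. x \<in> closure \<Omega> \<Longrightarrow> G x = ?f x"
    using measurable_elementwise[of P] by blast
  have "G \<in> borel_measurable M\<Omega>" by (rule borel_measurable_lebesgue_on[OF G(1)])
  moreover have "G x = ?f x" if "x \<in> space M\<Omega>" for x
    using that closure_subset[of \<Omega>] by (intro G(2)) auto
  ultimately have m: "?f \<in> borel_measurable M\<Omega>" using measurable_cong[of M\<Omega> G ?f borel] by blast
  have AE: "AE x in M\<Omega>. \<forall>\<kappa>\<in>\<T>. x \<in> \<kappa> \<longrightarrow> ?f x = P \<kappa> x"
    using AE_elem_at by eventually_elim auto
  have int: "integrable (lebesgue_on \<kappa>) (P \<kappa>)" if "\<kappa> \<in> \<T>" for \<kappa>
  proof -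
    have "monomial (\<lambda>_. 0) \<in> polys j" by (rule monomial_mem_polys) simp
    from integrable_polys_mult[OF compact_elem[OF that] P[OF that] this]
    show ?thesis by (simp add: monomial_def)
  qed
  have i: "integrable M\<Omega> ?f" by (rule integral_broken(1)[OF m int AE])
  have AE': "AE x in lebesgue_on \<kappa>. ?f x = P \<kappa> x" if "\<kappa> \<in> \<T>" for \<kappa>
  proof -
    have "AE x in lebesgue_on \<kappa>. x \<in> \<kappa>" by (rule AE_I2) simp
    with AE_elem_if_AE_domain[OF that AE] show ?thesis by eventually_elim (use that in blast)
  qed
  show "?f \<in> broken_polys j \<Omega> \<T>" unfolding broken_polys_def using i AE' P by blast
  show "on_elem \<kappa> ?f = P \<kappa>" if "\<kappa> \<in> \<T>" for \<kappa>
    using that AE'[OF that] by (intro on_elem_eq[OF that P])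
qed

end

context broken_mesh
begin

section \<open>Traces, jumps and the lifting operator\<close>

lemma broken_vpolys_component: "\<phi> \<in> broken_vpolys j \<Omega> \<T> \<Longrightarrow> (\<lambda>x. \<phi> x $ i) \<in> broken_polys j \<Omega> \<T>"
  by (simp add: broken_vpolys_def)

lemma component_add: "(\<lambda>x. (\<phi> + \<psi>) x $ i) = (\<lambda>x. \<phi> x $ i) + (\<lambda>x. \<psi> x $ i)"
  for \<phi> \<psi> :: "real^'n \<Rightarrow> real^'n" by (intro ext) simp

lemma component_scaleR: "(\<lambda>x. (c *\<^sub>R \<phi>) x $ i) = c *\<^sub>R (\<lambda>x. \<phi> x $ i)"
  for \<phi> :: "real^'n \<Rightarrow> real^'n" by (intro ext) simp

lemma subspace_broken_vpolys: "subspace (broken_vpolys j \<Omega> \<T>)"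
  unfolding subspace_def
proof (intro conjI ballI allI)
  have "(\<lambda>x. (0 :: real^'n \<Rightarrow> real^'n) x $ i) = 0" for i by (intro ext) simp
  then show "0 \<in> broken_vpolys j \<Omega> \<T>"
    using subspace_0[OF subspace_broken_polys[of j]] unfolding broken_vpolys_def by (simp only: mem_Collect_eq simp_thms)
  show "\<phi> + \<psi> \<in> broken_vpolys j \<Omega> \<T>" if "\<phi> \<in> broken_vpolys j \<Omega> \<T>" "\<psi> \<in> broken_vpolys j \<Omega> \<T>" for \<phi> \<psi>
    using subspace_add[OF subspace_broken_polys that(1)[THEN broken_vpolys_component] that(2)[THEN broken_vpolys_component]]
    unfolding broken_vpolys_def mem_Collect_eq component_add by blast
  show "c *\<^sub>R \<phi> \<in> broken_vpolys j \<Omega> \<T>" if "\<phi> \<in> broken_vpolys j \<Omega> \<T>" for c \<phi>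
    using subspace_scale[OF subspace_broken_polys that[THEN broken_vpolys_component]]
    unfolding broken_vpolys_def mem_Collect_eq component_scaleR by blast
qed

lemma broken_vpolys_measurable:
  assumes "\<phi> \<in> broken_vpolys j \<Omega> \<T>"
  shows "\<phi> \<in> borel_measurable M\<Omega>"
  unfolding borel_measurable_euclidean_space[of \<phi>]
proof
  fix b :: "real^'n" assume "b \<in> Basis"
  then obtain i where "b = axis i 1" by (auto simp: Basis_vec_def)
  then show "(\<lambda>x. \<phi> x \<bullet> b) \<in> borel_measurable M\<Omega>"
    using broken_polys_measurable[OF broken_vpolys_component[OF assms, of i]] by (simp add: inner_axis)
qed

lemma broken_vpolys_inner:
  assumes \<phi>: "\<phi> \<in> broken_vpolys j \<Omega> \<T>" and \<psi>: "\<psi> \<in> broken_vpolys j \<Omega> \<T>"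
  shows broken_vpolys_inner_integrable: "integrable M\<Omega> (\<lambda>x. \<phi> x \<bullet> \<psi> x)"
    and "L2_inner M\<Omega> \<phi> \<psi> = (\<Sum>i\<in>UNIV. LINT x|M\<Omega>. \<phi> x $ i * \<psi> x $ i)"
proof -
  have i: "integrable M\<Omega> (\<lambda>x. \<phi> x $ i * \<psi> x $ i)" for i
    using broken_polys_mult_integrable[OF \<phi>[THEN broken_vpolys_component] \<psi>[THEN broken_vpolys_component]] .
  show "integrable M\<Omega> (\<lambda>x. \<phi> x \<bullet> \<psi> x)"
    unfolding inner_vec_def inner_real_def by (rule Bochner_Integration.integrable_sum) (rule i)
  show "L2_inner M\<Omega> \<phi> \<psi> = (\<Sum>i\<in>UNIV. LINT x|M\<Omega>. \<phi> x $ i * \<psi> x $ i)"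
    unfolding L2_inner_def inner_vec_def inner_real_def
    by (rule Bochner_Integration.integral_sum) (rule i)
qed

lemma semi_inner_broken_vpolys: "semi_inner (broken_vpolys j \<Omega> \<T>) (L2_inner M\<Omega>)"
proof
  fix \<phi> \<psi> \<theta> assume "\<phi> \<in> broken_vpolys j \<Omega> \<T>" "\<psi> \<in> broken_vpolys j \<Omega> \<T>" "\<theta> \<in> broken_vpolys j \<Omega> \<T>"
  then show "L2_inner M\<Omega> (\<phi> + \<psi>) \<theta> = L2_inner M\<Omega> \<phi> \<theta> + L2_inner M\<Omega> \<psi> \<theta>"
    by (simp add: L2_inner_def inner_add_left broken_vpolys_inner_integrable)
qed (rule subspace_broken_vpolys, simp_all add: L2_inner_def inner_commute)

lemma semi_inner_broken_polys: "semi_inner (broken_polys j \<Omega> \<T>) (L2_inner M\<Omega>)"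
proof
  fix \<phi> \<psi> \<theta> assume "\<phi> \<in> broken_polys j \<Omega> \<T>" "\<psi> \<in> broken_polys j \<Omega> \<T>" "\<theta> \<in> broken_polys j \<Omega> \<T>"
  then show "L2_inner M\<Omega> (\<phi> + \<psi>) \<theta> = L2_inner M\<Omega> \<phi> \<theta> + L2_inner M\<Omega> \<psi> \<theta>"
    by (simp add: L2_inner_def distrib_right broken_polys_mult_integrable)
qed (rule subspace_broken_polys, simp_all add: L2_inner_def mult_ac)

lemma broken_vpolys_null:
  assumes "\<phi> \<in> broken_vpolys j \<Omega> \<T>" "L2_inner M\<Omega> \<phi> \<phi> = 0"
  shows "AE x in M\<Omega>. \<phi> x = 0"
proof -
  have "AE x in M\<Omega>. \<phi> x \<bullet> \<phi> x = 0"
    using assms(2) broken_vpolys_inner_integrable[OF assms(1,1)]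
    by (subst (asm) L2_inner_def) (simp only: integral_nonneg_eq_0_iff_AE AE_I2 inner_ge_zero)
  then show ?thesis by simp
qed

lemma broken_polys_L2: "u \<in> broken_polys j \<Omega> \<T> \<Longrightarrow> u \<in> L2 M\<Omega>"
  using broken_polys_mult_integrable[of u j u]
  by (simp add: L2_def broken_polys_measurable power2_eq_square)

lemma broken_vpolys_L2: "\<phi> \<in> broken_vpolys j \<Omega> \<T> \<Longrightarrow> \<phi> \<in> L2 M\<Omega>"
  using broken_vpolys_inner_integrable[of \<phi> j \<phi>]
  by (simp add: L2_def broken_vpolys_measurable power2_norm_eq_inner)

lemma L2_norm_component_le:
  assumes \<phi>: "\<phi> \<in> broken_vpolys j \<Omega> \<T>"
  shows "L2_norm M\<Omega> (\<lambda>x. \<phi> x $ i) \<le> L2_norm M\<Omega> \<phi>"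
proof -
  have "(LINT x|M\<Omega>. \<phi> x $ i * \<phi> x $ i) \<le> (\<Sum>i\<in>UNIV. LINT x|M\<Omega>. \<phi> x $ i * \<phi> x $ i)"
    by (intro member_le_sum) auto
  then show ?thesis
    using broken_vpolys_inner(2)[OF \<phi> \<phi>] by (simp add: L2_norm_eq_sqrt_inner) (simp add: L2_inner_def)
qed

lemma jump_add:
  assumes "u \<in> broken_polys j \<Omega> \<T>" "v \<in> broken_polys j \<Omega> \<T>"
  shows "jump \<T> (u + v) x = jump \<T> u x + jump \<T> v x"
  unfolding jump_def sum.distrib[symmetric]
proof (intro sum.cong refl)
  fix \<kappa> assume "\<kappa> \<in> {\<kappa> \<in> \<T>. x \<in> \<kappa>}"
  then have "on_elem \<kappa> (u + v) = on_elem \<kappa> u + on_elem \<kappa> v" using on_elem_add[OF assms] by blast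
  then have "on_elem \<kappa> (u + v) x = on_elem \<kappa> u x + on_elem \<kappa> v x" by (metis plus_fun_apply)
  then show "on_elem \<kappa> (u + v) x *\<^sub>R outward_normal \<kappa> x
      = on_elem \<kappa> u x *\<^sub>R outward_normal \<kappa> x + on_elem \<kappa> v x *\<^sub>R outward_normal \<kappa> x"
    by (simp only: scaleR_add_left)
qed

lemma jump_scaleR:
  assumes "u \<in> broken_polys j \<Omega> \<T>"
  shows "jump \<T> (c *\<^sub>R u) x = c *\<^sub>R jump \<T> u x"
  unfolding jump_def scaleR_sum_right
proof (intro sum.cong refl)
  fix \<kappa> assume "\<kappa> \<in> {\<kappa> \<in> \<T>. x \<in> \<kappa>}"
  then have "on_elem \<kappa> (c *\<^sub>R u) = c *\<^sub>R on_elem \<kappa> u" using on_elem_scaleR[OF assms] by blast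
  then have "on_elem \<kappa> (c *\<^sub>R u) x = c * on_elem \<kappa> u x" by (metis scaleR_fun_apply real_scaleR_def)
  then show "on_elem \<kappa> (c *\<^sub>R u) x *\<^sub>R outward_normal \<kappa> x = c *\<^sub>R on_elem \<kappa> u x *\<^sub>R outward_normal \<kappa> x"
    by (simp only: scaleR_scaleR)
qed

text \<open>Measurability and the exchange of sum and integral require an index set that does not
  vary with \<open>x\<close>.\<close>

lemma sum_containing: "(\<Sum>\<kappa>\<in>{\<kappa> \<in> \<T>. x \<in> \<kappa>}. f \<kappa>) = (\<Sum>\<kappa>\<in>\<T>. indicator \<kappa> x *\<^sub>R f \<kappa>)"
  for f :: "(real^'n) set \<Rightarrow> 'b::real_vector"
proof -
  have "(\<Sum>\<kappa>\<in>\<T>. indicator \<kappa> x *\<^sub>R f \<kappa>) = (\<Sum>\<kappa>\<in>\<T>. if x \<in> \<kappa> then f \<kappa> else 0)"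
    by (intro sum.cong) auto
  also have "\<dots> = (\<Sum>\<kappa>\<in>{\<kappa> \<in> \<T>. x \<in> \<kappa>}. f \<kappa>)"
    by (rule sum.inter_filter[OF finite_mesh, symmetric])
  finally show ?thesis by (rule sym)
qed

lemma on_elem_borel_measurable:
  "u \<in> broken_polys j \<Omega> \<T> \<Longrightarrow> \<kappa> \<in> \<T> \<Longrightarrow> on_elem \<kappa> u \<in> borel_measurable borel"
  using continuous_on_polys[OF on_elem_polys] by (rule borel_measurable_continuous_onI)

lemma measurable_jump:
  assumes "u \<in> broken_polys j \<Omega> \<T>"
  shows "jump \<T> u \<in> borel_measurable borel"
proof -
  have "(\<lambda>x. indicator \<kappa> x *\<^sub>R on_elem \<kappa> u x *\<^sub>R outward_normal \<kappa> x) \<in> borel_measurable borel" if "\<kappa> \<in> \<T>" for \<kappa>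
    using on_elem_borel_measurable[OF assms that] measurable_outward_normal[OF closed_elem[OF that]]
      borel_closed[OF closed_elem[OF that]]
    by (intro borel_measurable_scaleR borel_measurable_indicator)
  then show ?thesis unfolding jump_def[abs_def] sum_containing by (rule borel_measurable_sum)
qed

text \<open>At most \<open>card \<T>\<close> summands, each with a normal of norm at most 1; where
  no normal exists it is 0.\<close>

lemma jump_bound:
  obtains C where "0 \<le> C"
    "\<And>u x. u \<in> broken_polys j \<Omega> \<T> \<Longrightarrow> x \<in> closure \<Omega> \<Longrightarrow> norm (jump \<T> u x) \<le> C * L2_norm M\<Omega> u"
proof -
  obtain C where C: "0 \<le> C"
    "\<And>u \<kappa> x. u \<in> broken_polys j \<Omega> \<T> \<Longrightarrow> \<kappa> \<in> \<T> \<Longrightarrow> x \<in> closure \<Omega> \<Longrightarrow>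
      \<bar>on_elem \<kappa> u x\<bar> \<le> C * L2_norm M\<Omega> u"
    by (rule on_elem_sup_bound[where j = j], rule that, assumption+)
  show ?thesis
  proof
    show "0 \<le> real (card \<T>) * C" using C(1) by simp
    fix u x assume u: "u \<in> broken_polys j \<Omega> \<T>" and x: "x \<in> closure \<Omega>"
    have "norm (jump \<T> u x) \<le> (\<Sum>\<kappa>\<in>{\<kappa> \<in> \<T>. x \<in> \<kappa>}. C * L2_norm M\<Omega> u)"
      unfolding jump_def
    proof (rule order_trans[OF norm_sum], rule sum_mono)
      fix \<kappa> assume "\<kappa> \<in> {\<kappa> \<in> \<T>. x \<in> \<kappa>}"
      then have "\<bar>on_elem \<kappa> u x\<bar> * norm (outward_normal \<kappa> x) \<le> (C * L2_norm M\<Omega> u) * 1"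
        using C(2)[OF u _ x] by (intro mult_mono norm_outward_normal_le) (auto simp: C(1))
      then show "norm (on_elem \<kappa> u x *\<^sub>R outward_normal \<kappa> x) \<le> C * L2_norm M\<Omega> u" by simp
    qed
    also have "\<dots> \<le> (\<Sum>\<kappa>\<in>\<T>. C * L2_norm M\<Omega> u)"
      using finite_mesh C(1) by (intro sum_mono2) auto
    finally show "norm (jump \<T> u x) \<le> real (card \<T>) * C * L2_norm M\<Omega> u" by simp
  qed
qed

lemma average_component:
  "average \<T> \<phi> x $ i = (\<Sum>\<kappa>\<in>\<T>. (1/2 * indicator \<kappa> x) * on_elem \<kappa> (\<lambda>y. \<phi> y $ i) x)"
proof -
  have "average \<T> \<phi> x $ i = 1/2 * (\<Sum>\<kappa>\<in>{\<kappa> \<in> \<T>. x \<in> \<kappa>}. on_elem \<kappa> (\<lambda>y. \<phi> y $ i) x)"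
    by (simp add: average_def von_elem_def)
  then show ?thesis unfolding sum_containing sum_distrib_left by (simp add: mult.assoc)
qed

lemma measurable_average:
  assumes "\<phi> \<in> broken_vpolys j \<Omega> \<T>"
  shows "average \<T> \<phi> \<in> borel_measurable borel"
  unfolding borel_measurable_euclidean_space[of "average \<T> \<phi>"]
proof
  fix b :: "real^'n" assume "b \<in> Basis"
  then obtain i where b: "b = axis i 1" by (auto simp: Basis_vec_def)
  have "(\<lambda>x. (1/2 * indicator \<kappa> x) * on_elem \<kappa> (\<lambda>y. \<phi> y $ i) x) \<in> borel_measurable borel" if "\<kappa> \<in> \<T>" for \<kappa>
    using on_elem_borel_measurable[OF broken_vpolys_component[OF assms] that] borel_closed[OF closed_elem[OF that]]
    by (intro borel_measurable_times borel_measurable_indicator borel_measurable_const)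
  then have "(\<lambda>x. average \<T> \<phi> x $ i) \<in> borel_measurable borel"
    unfolding average_component by (rule borel_measurable_sum)
  then show "(\<lambda>x. average \<T> \<phi> x \<bullet> b) \<in> borel_measurable borel" by (simp add: b inner_axis)
qed

lemma average_bound:
  obtains C where "0 \<le> C"
    "\<And>\<phi> x. \<phi> \<in> broken_vpolys j \<Omega> \<T> \<Longrightarrow> x \<in> closure \<Omega> \<Longrightarrow> norm (average \<T> \<phi> x) \<le> C * L2_norm M\<Omega> \<phi>"
proof -
  obtain C where C: "0 \<le> C"
    "\<And>u \<kappa> x. u \<in> broken_polys j \<Omega> \<T> \<Longrightarrow> \<kappa> \<in> \<T> \<Longrightarrow> x \<in> closure \<Omega> \<Longrightarrow>
      \<bar>on_elem \<kappa> u x\<bar> \<le> C * L2_norm M\<Omega> u"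
    by (rule on_elem_sup_bound[where j = j], rule that, assumption+)
  show ?thesis
  proof
    show "0 \<le> real CARD('n) * (real (card \<T>) * C)" using C(1) by simp
    fix \<phi> x assume \<phi>: "\<phi> \<in> broken_vpolys j \<Omega> \<T>" and x: "x \<in> closure \<Omega>"
    have comp: "\<bar>average \<T> \<phi> x $ i\<bar> \<le> real (card \<T>) * (C * L2_norm M\<Omega> \<phi>)" for i
    proof -
      have "\<bar>average \<T> \<phi> x $ i\<bar> \<le> (\<Sum>\<kappa>\<in>\<T>. C * L2_norm M\<Omega> \<phi>)"
        unfolding average_component
      proof (rule order_trans[OF sum_abs], rule sum_mono)
        fix \<kappa> assume \<kappa>: "\<kappa> \<in> \<T>"
        have "\<bar>on_elem \<kappa> (\<lambda>y. \<phi> y $ i) x\<bar> \<le> C * L2_norm M\<Omega> (\<lambda>y. \<phi> y $ i)"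
          by (rule C(2)[OF broken_vpolys_component[OF \<phi>] \<kappa> x])
        also have "\<dots> \<le> C * L2_norm M\<Omega> \<phi>"
          using L2_norm_component_le[OF \<phi>] C(1) by (rule mult_left_mono)
        finally have "\<bar>1/2 * indicator \<kappa> x :: real\<bar> * \<bar>on_elem \<kappa> (\<lambda>y. \<phi> y $ i) x\<bar> \<le> 1 * (C * L2_norm M\<Omega> \<phi>)"
          by (intro mult_mono) (auto simp: indicator_def)
        then show "\<bar>(1/2 * indicator \<kappa> x) * on_elem \<kappa> (\<lambda>y. \<phi> y $ i) x\<bar> \<le> C * L2_norm M\<Omega> \<phi>"
          by (simp only: abs_mult mult_1)
      qed
      then show ?thesis by simp
    qed
    have "norm (average \<T> \<phi> x) \<le> (\<Sum>i\<in>(UNIV::'n set). real (card \<T>) * (C * L2_norm M\<Omega> \<phi>))"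
      by (rule order_trans[OF norm_le_l1_cart], rule sum_mono) (rule comp)
    then show "norm (average \<T> \<phi> x) \<le> real CARD('n) * (real (card \<T>) * C) * L2_norm M\<Omega> \<phi>"
      by (simp add: mult.assoc)
  qed
qed

lemma integrable_Gamma_int:
  fixes f :: "real^'n \<Rightarrow> 'b::euclidean_space"
  assumes "f \<in> borel_measurable borel" "\<And>x. x \<in> closure \<Omega> \<Longrightarrow> norm (f x) \<le> C"
  shows "integrable (surface_on (Gamma_int \<Omega> \<T>)) f"
  using assms Gamma_int_subset
  by (intro finite_measure.integrable_const_bound[OF finite_measure_Gamma_int, of _ C] AE_I2)
    (auto intro: measurable_surface_on)

lemma bounded_on_closure:
  fixes f :: "real^'n \<Rightarrow> real"
  assumes "continuous_on UNIV f"
  obtains C where "\<And>x. x \<in> closure \<Omega> \<Longrightarrow> norm (f x) \<le> C"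
proof -
  have "bounded (f ` closure \<Omega>)"
    using compact_closure_domain continuous_on_subset[OF assms]
    by (intro compact_imp_bounded compact_continuous_image) auto
  then show ?thesis using that by (auto simp: bounded_iff)
qed

text \<open>The functional that the lifting of \<open>u\<close> represents. Unlike the lifting it
  involves no choice between almost equal functions, so on broken polynomials it is exactly linear
  in \<open>u\<close>.\<close>

definition jump_form :: "(real^'n \<Rightarrow> real) \<Rightarrow> (real^'n \<Rightarrow> real^'n) \<Rightarrow> real" where
  "jump_form u \<phi> = - (LINT x|surface_on (Gamma_int \<Omega> \<T>). jump \<T> u x \<bullet> average \<T> \<phi> x)"

lemma integrable_jump_average:
  assumes u: "u \<in> broken_polys k \<Omega> \<T>" and \<phi>: "\<phi> \<in> broken_vpolys l \<Omega> \<T>"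
  shows "integrable (surface_on (Gamma_int \<Omega> \<T>)) (\<lambda>x. jump \<T> u x \<bullet> average \<T> \<phi> x)"
proof -
  obtain C where C: "\<And>u x. u \<in> broken_polys k \<Omega> \<T> \<Longrightarrow> x \<in> closure \<Omega> \<Longrightarrow> norm (jump \<T> u x) \<le> C * L2_norm M\<Omega> u"
    using jump_bound by blast
  obtain D where D: "\<And>\<phi> x. \<phi> \<in> broken_vpolys l \<Omega> \<T> \<Longrightarrow> x \<in> closure \<Omega> \<Longrightarrow> norm (average \<T> \<phi> x) \<le> D * L2_norm M\<Omega> \<phi>"
    using average_bound by blast
  show ?thesis
  proof (rule integrable_Gamma_int)
    show "(\<lambda>x. jump \<T> u x \<bullet> average \<T> \<phi> x) \<in> borel_measurable borel"
      using measurable_jump[OF u] measurable_average[OF \<phi>] by (rule borel_measurable_inner)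
    fix x assume x: "x \<in> closure \<Omega>"
    have "norm (jump \<T> u x \<bullet> average \<T> \<phi> x) \<le> norm (jump \<T> u x) * norm (average \<T> \<phi> x)"
      by (simp add: Cauchy_Schwarz_ineq2)
    also have "\<dots> \<le> (C * L2_norm M\<Omega> u) * (D * L2_norm M\<Omega> \<phi>)"
      using C[OF u x] D[OF \<phi> x] order_trans[OF norm_ge_zero C[OF u x]]
      by (intro mult_mono) auto
    finally show "norm (jump \<T> u x \<bullet> average \<T> \<phi> x) \<le> (C * L2_norm M\<Omega> u) * (D * L2_norm M\<Omega> \<phi>)" .
  qed
qed

lemma jump_form_add_left:
  assumes "u \<in> broken_polys k \<Omega> \<T>" "v \<in> broken_polys k \<Omega> \<T>" "\<phi> \<in> broken_vpolys l \<Omega> \<T>"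
  shows "jump_form (u + v) \<phi> = jump_form u \<phi> + jump_form v \<phi>"
  unfolding jump_form_def jump_add[OF assms(1,2)] inner_add_left
  by (subst Bochner_Integration.integral_add[OF integrable_jump_average[OF assms(1,3)] integrable_jump_average[OF assms(2,3)]])
    simp

lemma jump_form_scaleR_left:
  assumes "u \<in> broken_polys k \<Omega> \<T>"
  shows "jump_form (c *\<^sub>R u) \<phi> = c * jump_form u \<phi>"
  unfolding jump_form_def jump_scaleR[OF assms] inner_scaleR_left by simp

lemma jump_form_bound:
  obtains C where "0 \<le> C"
    "\<And>u \<phi>. u \<in> broken_polys k \<Omega> \<T> \<Longrightarrow> \<phi> \<in> broken_vpolys l \<Omega> \<T> \<Longrightarrow>
      \<bar>jump_form u \<phi>\<bar> \<le> C * L2_norm M\<Omega> u * L2_norm M\<Omega> \<phi>"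
proof -
  obtain C where C: "0 \<le> C" "\<And>u x. u \<in> broken_polys k \<Omega> \<T> \<Longrightarrow> x \<in> closure \<Omega> \<Longrightarrow> norm (jump \<T> u x) \<le> C * L2_norm M\<Omega> u"
    using jump_bound by blast
  obtain D where D: "0 \<le> D" "\<And>\<phi> x. \<phi> \<in> broken_vpolys l \<Omega> \<T> \<Longrightarrow> x \<in> closure \<Omega> \<Longrightarrow> norm (average \<T> \<phi> x) \<le> D * L2_norm M\<Omega> \<phi>"
    using average_bound by blast
  let ?S = "surface_on (Gamma_int \<Omega> \<T>)"
  interpret finite_measure ?S by (rule finite_measure_Gamma_int)
  show ?thesis
  proof
    show "0 \<le> measure ?S (Gamma_int \<Omega> \<T>) * (C * D)" using C D by simp
    fix u \<phi> assume u: "u \<in> broken_polys k \<Omega> \<T>" and \<phi>: "\<phi> \<in> broken_vpolys l \<Omega> \<T>"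
    have pt: "norm (jump \<T> u x \<bullet> average \<T> \<phi> x) \<le> (C * L2_norm M\<Omega> u) * (D * L2_norm M\<Omega> \<phi>)"
      if "x \<in> space ?S" for x
    proof -
      have x: "x \<in> closure \<Omega>" using that Gamma_int_subset by auto
      have "norm (jump \<T> u x \<bullet> average \<T> \<phi> x) \<le> norm (jump \<T> u x) * norm (average \<T> \<phi> x)"
        by (simp add: Cauchy_Schwarz_ineq2)
      also have "\<dots> \<le> (C * L2_norm M\<Omega> u) * (D * L2_norm M\<Omega> \<phi>)"
        using C(2)[OF u x] D(2)[OF \<phi> x] C(1) by (intro mult_mono) auto
      finally show ?thesis .
    qed
    have "\<bar>jump_form u \<phi>\<bar> \<le> (LINT x|?S. norm (jump \<T> u x \<bullet> average \<T> \<phi> x))"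
      using integral_norm_bound[of ?S "\<lambda>x. jump \<T> u x \<bullet> average \<T> \<phi> x"] by (simp add: jump_form_def)
    also have "\<dots> \<le> (LINT x|?S. (C * L2_norm M\<Omega> u) * (D * L2_norm M\<Omega> \<phi>))"
      by (rule integral_mono[OF integrable_norm[OF integrable_jump_average[OF u \<phi>]] integrable_const pt])
    also have "\<dots> = measure ?S (Gamma_int \<Omega> \<T>) * (C * D) * L2_norm M\<Omega> u * L2_norm M\<Omega> \<phi>"
      by (simp add: mult_ac)
    finally show "\<bar>jump_form u \<phi>\<bar> \<le> measure ?S (Gamma_int \<Omega> \<T>) * (C * D) * L2_norm M\<Omega> u * L2_norm M\<Omega> \<phi>" .
  qed
qed

text \<open>
  The Riesz representation of \<open>jump_form u\<close> is assembled from Riesz representations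
  on the polynomials over single elements and for single components.
\<close>

lemma jump_form_riesz:
  assumes u: "u \<in> broken_polys k \<Omega> \<T>"
  shows "\<exists>w\<in>broken_vpolys l \<Omega> \<T>. \<forall>\<phi>\<in>broken_vpolys l \<Omega> \<T>. L2_inner M\<Omega> w \<phi> = jump_form u \<phi>"
proof -
  let ?S = "surface_on (Gamma_int \<Omega> \<T>)"
  \<comment> \<open>The share of element \<open>\<kappa>\<close> and component \<open>i\<close> in
    the jump form, as a functional of the polynomial found there; the factor 1/2 comes from the
    average.\<close>
  define f where "f \<kappa> i Q = - (LINT x|?S. jump \<T> u x $ i * ((1/2 * indicator \<kappa> x) * Q x))" for \<kappa> i and Q :: "real^'n \<Rightarrow> real"
  obtain C where C: "\<And>u x. u \<in> broken_polys k \<Omega> \<T> \<Longrightarrow> x \<in> closure \<Omega> \<Longrightarrow> norm (jump \<T> u x) \<le> C * L2_norm M\<Omega> u"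
    using jump_bound by blast
  have int: "integrable ?S (\<lambda>x. jump \<T> u x $ i * ((1/2 * indicator \<kappa> x) * Q x))"
    if \<kappa>: "\<kappa> \<in> \<T>" and Q: "Q \<in> polys l" for \<kappa> i Q
  proof -
    obtain D where D: "\<And>x. x \<in> closure \<Omega> \<Longrightarrow> norm (Q x) \<le> D"
      using bounded_on_closure[OF continuous_on_polys[OF Q]] by blast
    have "(\<lambda>x. jump \<T> u x \<bullet> axis i 1) \<in> borel_measurable borel"
      using measurable_jump[OF u] by (intro borel_measurable_inner borel_measurable_const)
    then have J: "(\<lambda>x. jump \<T> u x $ i) \<in> borel_measurable borel" by (simp add: inner_axis)
    show ?thesis
    proof (rule integrable_Gamma_int)
      show "(\<lambda>x. jump \<T> u x $ i * ((1/2 * indicator \<kappa> x) * Q x)) \<in> borel_measurable borel"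
        using J borel_closed[OF closed_elem[OF \<kappa>]] borel_measurable_continuous_onI[OF continuous_on_polys[OF Q]]
        by (intro borel_measurable_times borel_measurable_indicator borel_measurable_const)
      fix x assume x: "x \<in> closure \<Omega>"
      have "\<bar>jump \<T> u x $ i\<bar> \<le> C * L2_norm M\<Omega> u"
        using C[OF u x] component_le_norm_cart[of "jump \<T> u x" i] by linarith
      moreover have "\<bar>(1/2 * indicator \<kappa> x) * Q x\<bar> \<le> 1 * D"
        using D[OF x] unfolding abs_mult by (intro mult_mono) (auto simp: indicator_def)
      ultimately show "norm (jump \<T> u x $ i * ((1/2 * indicator \<kappa> x) * Q x)) \<le> (C * L2_norm M\<Omega> u) * (1 * D)"
        unfolding real_norm_def abs_mult[of "jump \<T> u x $ i"] by (intro mult_mono) auto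
    qed
  qed
  have "\<forall>\<kappa>\<in>\<T>. \<forall>i. \<exists>W\<in>polys l. \<forall>Q\<in>polys l. L2_inner (lebesgue_on \<kappa>) W Q = f \<kappa> i Q"
  proof (intro ballI allI)
    fix \<kappa> i assume \<kappa>: "\<kappa> \<in> \<T>"
    show "\<exists>W\<in>polys l. \<forall>Q\<in>polys l. L2_inner (lebesgue_on \<kappa>) W Q = f \<kappa> i Q"
    proof (rule polys_riesz[OF compact_elem[OF \<kappa>] interior_elem[OF \<kappa>]])
      fix P Q :: "real^'n \<Rightarrow> real" assume "P \<in> polys l" "Q \<in> polys l"
      note Bochner_Integration.integral_add[OF int[OF \<kappa> this(1)] int[OF \<kappa> this(2)]]
      then show "f \<kappa> i (P + Q) = f \<kappa> i P + f \<kappa> i Q"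
        unfolding f_def plus_fun_apply distrib_left by simp
    next
      fix c and P :: "real^'n \<Rightarrow> real"
      show "f \<kappa> i (c *\<^sub>R P) = c * f \<kappa> i P"
        unfolding f_def scaleR_fun_apply real_scaleR_def mult.left_commute[of _ c] integral_mult_right_zero by simp
    qed
  qed
  then obtain W where W: "\<And>\<kappa> i. \<kappa> \<in> \<T> \<Longrightarrow> W \<kappa> i \<in> polys l"
    "\<And>\<kappa> i Q. \<kappa> \<in> \<T> \<Longrightarrow> Q \<in> polys l \<Longrightarrow> L2_inner (lebesgue_on \<kappa>) (W \<kappa> i) Q = f \<kappa> i Q"
    by metis
  define w where "w x = (\<chi> i. W (elem_at \<T> x) i x)" for x
  have wi: "(\<lambda>x. w x $ i) = (\<lambda>x. W (elem_at \<T> x) i x)" for i by (simp add: w_def)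
  have w: "w \<in> broken_vpolys l \<Omega> \<T>"
    unfolding broken_vpolys_def mem_Collect_eq wi using broken_polysI(1)[of "\<lambda>\<kappa>. W \<kappa> _"] W(1) by blast
  have we: "on_elem \<kappa> (\<lambda>x. w x $ i) = W \<kappa> i" if "\<kappa> \<in> \<T>" for \<kappa> i
    unfolding wi using broken_polysI(2)[of "\<lambda>\<kappa>. W \<kappa> i", OF W(1) that] .
  have "L2_inner M\<Omega> w \<phi> = jump_form u \<phi>" if \<phi>: "\<phi> \<in> broken_vpolys l \<Omega> \<T>" for \<phi>
  proof -
    let ?p = "\<lambda>i. (\<lambda>y. \<phi> y $ i)"
    have p: "on_elem \<kappa> (?p i) \<in> polys l" if "\<kappa> \<in> \<T>" for \<kappa> i
      by (rule on_elem_polys[OF broken_vpolys_component[OF \<phi>] that])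
    have "L2_inner M\<Omega> w \<phi> = (\<Sum>i\<in>UNIV. LINT x|M\<Omega>. w x $ i * \<phi> x $ i)"
      by (rule broken_vpolys_inner(2)[OF w \<phi>])
    also have "\<dots> = (\<Sum>i\<in>UNIV. \<Sum>\<kappa>\<in>\<T>. LINT x|lebesgue_on \<kappa>. W \<kappa> i x * on_elem \<kappa> (?p i) x)"
    proof (rule sum.cong[OF refl])
      fix i
      show "(LINT x|M\<Omega>. w x $ i * \<phi> x $ i) = (\<Sum>\<kappa>\<in>\<T>. LINT x|lebesgue_on \<kappa>. W \<kappa> i x * on_elem \<kappa> (?p i) x)"
        unfolding broken_polys_mult(2)[OF broken_vpolys_component[OF w] broken_vpolys_component[OF \<phi>]]
        by (intro sum.cong refl) (simp only: we)
    qed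
    also have "\<dots> = (\<Sum>i\<in>UNIV. \<Sum>\<kappa>\<in>\<T>. f \<kappa> i (on_elem \<kappa> (?p i)))"
      using W(2)[OF _ p] by (intro sum.cong refl) (simp only: L2_inner_def inner_real_def)
    also have "\<dots> = - (\<Sum>i\<in>UNIV. \<Sum>\<kappa>\<in>\<T>. LINT x|?S. jump \<T> u x $ i * ((1/2 * indicator \<kappa> x) * on_elem \<kappa> (?p i) x))"
      by (simp only: f_def sum_negf)
    also have "(\<Sum>i\<in>UNIV. \<Sum>\<kappa>\<in>\<T>. LINT x|?S. jump \<T> u x $ i * ((1/2 * indicator \<kappa> x) * on_elem \<kappa> (?p i) x))
      = (LINT x|?S. (\<Sum>i\<in>UNIV. \<Sum>\<kappa>\<in>\<T>. jump \<T> u x $ i * ((1/2 * indicator \<kappa> x) * on_elem \<kappa> (?p i) x)))"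
    proof -
      have h: "integrable ?S (\<lambda>x. jump \<T> u x $ i * ((1/2 * indicator \<kappa> x) * on_elem \<kappa> (?p i) x))"
        if "\<kappa> \<in> \<T>" for i \<kappa> by (rule int[OF that p[OF that]])
      have "(LINT x|?S. (\<Sum>i\<in>UNIV. \<Sum>\<kappa>\<in>\<T>. jump \<T> u x $ i * ((1/2 * indicator \<kappa> x) * on_elem \<kappa> (?p i) x)))
        = (\<Sum>i\<in>UNIV. LINT x|?S. (\<Sum>\<kappa>\<in>\<T>. jump \<T> u x $ i * ((1/2 * indicator \<kappa> x) * on_elem \<kappa> (?p i) x)))"
        by (rule Bochner_Integration.integral_sum, rule Bochner_Integration.integrable_sum, rule h)
      also have "\<dots> = (\<Sum>i\<in>UNIV. \<Sum>\<kappa>\<in>\<T>. LINT x|?S. jump \<T> u x $ i * ((1/2 * indicator \<kappa> x) * on_elem \<kappa> (?p i) x))"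
        by (rule sum.cong[OF refl], rule Bochner_Integration.integral_sum, rule h)
      finally show ?thesis by (rule sym)
    qed
    also have "(\<lambda>x. \<Sum>i\<in>UNIV. \<Sum>\<kappa>\<in>\<T>. jump \<T> u x $ i * ((1/2 * indicator \<kappa> x) * on_elem \<kappa> (?p i) x))
      = (\<lambda>x. jump \<T> u x \<bullet> average \<T> \<phi> x)"
      unfolding inner_vec_def inner_real_def average_component sum_distrib_left ..
    finally show ?thesis by (simp only: jump_form_def)
  qed
  then show ?thesis using w by blast
qed

text \<open>A representative exists by \<open>jump_form_riesz\<close>, so the choice in
  \<open>lifting\<close> satisfies its description. It is fixed only up to null functions; hence
  pairings are what is recorded.\<close>

lemma lifting:
  assumes u: "u \<in> broken_polys k \<Omega> \<T>"
  shows lifting_mem: "lifting l \<Omega> \<T> u \<in> broken_vpolys l \<Omega> \<T>"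
    and L2_inner_lifting: "\<phi> \<in> broken_vpolys l \<Omega> \<T> \<Longrightarrow> L2_inner M\<Omega> (lifting l \<Omega> \<T> u) \<phi> = jump_form u \<phi>"
proof -
  have "\<exists>w. w \<in> broken_vpolys l \<Omega> \<T> \<and>
      (\<forall>\<phi>\<in>broken_vpolys l \<Omega> \<T>. (LINT x|M\<Omega>. w x \<bullet> \<phi> x) = jump_form u \<phi>)"
    using jump_form_riesz[OF u, of l] unfolding L2_inner_def by blast
  from someI_ex[OF this, folded jump_form_def]
  show "lifting l \<Omega> \<T> u \<in> broken_vpolys l \<Omega> \<T>"
    "\<phi> \<in> broken_vpolys l \<Omega> \<T> \<Longrightarrow> L2_inner M\<Omega> (lifting l \<Omega> \<T> u) \<phi> = jump_form u \<phi>"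
    unfolding lifting_def jump_form_def[symmetric] L2_inner_def by blast+
qed

text \<open>Here the relation between \<open>k\<close> and \<open>l\<close> enters: differentiation
  lowers the degree by one, and truncation is harmless for \<open>k = 0\<close>.\<close>

lemma grad_on_elem_mem:
  assumes u: "u \<in> broken_polys k \<Omega> \<T>" and kl: "int l \<ge> int k - 1"
  shows "broken_grad \<T> u \<in> broken_vpolys l \<Omega> \<T>"
proof -
  have "partial i (on_elem \<kappa> u) \<in> polys l" if "\<kappa> \<in> \<T>" for \<kappa> i
  proof -
    have "k - 1 \<le> l" using kl by linarith
    then show ?thesis using partial_polys[OF on_elem_polys[OF u that]] polys_mono by blast
  qed
  then have "(\<lambda>x. partial i (on_elem (elem_at \<T> x) u) x) \<in> broken_polys l \<Omega> \<T>" for i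
    by (rule broken_polysI(1)[of "\<lambda>\<kappa>. partial i (on_elem \<kappa> u)" l])
  then show ?thesis by (simp add: broken_vpolys_def broken_grad_def grad_def)
qed

lemma broken_grad_add:
  assumes "u \<in> broken_polys j \<Omega> \<T>" "v \<in> broken_polys j \<Omega> \<T>" and x: "x \<in> closure \<Omega>"
  shows "broken_grad \<T> (u + v) x = broken_grad \<T> u x + broken_grad \<T> v x"
proof -
  have \<kappa>: "elem_at \<T> x \<in> \<T>" using elem_at_mem[OF x] by blast
  show ?thesis
    unfolding broken_grad_def on_elem_add[OF assms(1,2) \<kappa>]
    by (intro grad_add differentiable_polys[OF on_elem_polys[OF assms(1) \<kappa>]]
        differentiable_polys[OF on_elem_polys[OF assms(2) \<kappa>]])
qed

lemma broken_grad_scaleR: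
  assumes "u \<in> broken_polys j \<Omega> \<T>" and x: "x \<in> closure \<Omega>"
  shows "broken_grad \<T> (c *\<^sub>R u) x = c *\<^sub>R broken_grad \<T> u x"
proof -
  have \<kappa>: "elem_at \<T> x \<in> \<T>" using elem_at_mem[OF x] by blast
  show ?thesis
    unfolding broken_grad_def on_elem_scaleR[OF assms(1) \<kappa>]
    by (intro grad_scaleR differentiable_polys[OF on_elem_polys[OF assms(1) \<kappa>]])
qed

lemma bdry_trace_add:
  assumes "u \<in> broken_polys j \<Omega> \<T>" "v \<in> broken_polys j \<Omega> \<T>" and x: "x \<in> closure \<Omega>"
  shows "bdry_trace \<T> (u + v) x = bdry_trace \<T> u x + bdry_trace \<T> v x"
proof -
  have \<kappa>: "elem_at \<T> x \<in> \<T>" using elem_at_mem[OF x] by blast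
  show ?thesis unfolding bdry_trace_def on_elem_add[OF assms(1,2) \<kappa>] by (rule plus_fun_apply)
qed

lemma bdry_trace_scaleR:
  assumes "u \<in> broken_polys j \<Omega> \<T>" and x: "x \<in> closure \<Omega>"
  shows "bdry_trace \<T> (c *\<^sub>R u) x = c * bdry_trace \<T> u x"
proof -
  have \<kappa>: "elem_at \<T> x \<in> \<T>" using elem_at_mem[OF x] by blast
  show ?thesis
    unfolding bdry_trace_def on_elem_scaleR[OF assms(1) \<kappa>] scaleR_fun_apply real_scaleR_def ..
qed

lemma measurable_bdry_trace:
  assumes "u \<in> broken_polys j \<Omega> \<T>"
  shows "bdry_trace \<T> u \<in> borel_measurable (surface_on (frontier \<Omega>))"
proof -
  obtain G where G: "G \<in> borel_measurable borel" "\<And>x. x \<in> closure \<Omega> \<Longrightarrow> G x = on_elem (elem_at \<T> x) u x"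
    using measurable_elementwise[of "\<lambda>\<kappa>. on_elem \<kappa> u"] on_elem_borel_measurable[OF assms] by blast
  have "G x = bdry_trace \<T> u x" if "x \<in> space (surface_on (frontier \<Omega>))" for x
    using that boundary_subset G(2) by (auto simp: bdry_trace_def)
  then show ?thesis
    using measurable_cong[of "surface_on (frontier \<Omega>)" G "bdry_trace \<T> u" borel]
      measurable_surface_on[OF G(1)] by blast
qed

end

section \<open>Convexity of the energies\<close>

text \<open>The logarithm in the denominator grows without bound as the two points approach each
  other.\<close>

lemma continuous_on_log_hoelder:
  fixes p :: "real^'n \<Rightarrow> real"
  assumes "log_hoelder_on S p"
  shows "continuous_on S p"
proof -
  obtain C where C: "\<And>x y. x \<in> S \<Longrightarrow> y \<in> S \<Longrightarrow> x \<noteq> y \<Longrightarrow> \<bar>p x - p y\<bar> \<le> C / ln (exp 1 + 1 / norm (x - y))"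
    using assms unfolding log_hoelder_on_def by blast
  show ?thesis unfolding continuous_on_iff
  proof (intro ballI allI impI)
    fix x and \<epsilon> :: real assume x: "x \<in> S" and \<epsilon>: "0 < \<epsilon>"
    \<comment> \<open>Within distance \<open>1 / K\<close> the logarithm exceeds
      \<open>(\<bar>C\<bar> + 1) / \<epsilon>\<close>; the added 1 covers \<open>C = 0\<close> and
      makes the final inequality strict.\<close>
    define K where "K = exp ((\<bar>C\<bar> + 1) / \<epsilon>)"
    have K: "0 < K" "ln K = (\<bar>C\<bar> + 1) / \<epsilon>" by (simp_all add: K_def)
    have "dist (p y) (p x) < \<epsilon>" if y: "y \<in> S" "dist y x < 1 / K" for y
    proof (cases "y = x")
      case False
      define s where "s = 1 / norm (y - x)"
      have n: "0 < norm (y - x)" using False by simp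
      have "K < s" using y(2) K(1) n by (simp add: s_def dist_norm field_simps)
      then have "ln K < ln (exp 1 + s)" using K(1) by (subst ln_less_cancel_iff) (auto intro: add_pos_pos less_trans)
      then have L: "(\<bar>C\<bar> + 1) / \<epsilon> < ln (exp 1 + s)" by (simp only: K(2))
      have L0: "0 < (\<bar>C\<bar> + 1) / \<epsilon>" using \<epsilon> by simp
      have "\<bar>p y - p x\<bar> \<le> C / ln (exp 1 + s)" using C[OF y(1) x False] by (simp add: s_def)
      also have "\<dots> \<le> \<bar>C\<bar> / ln (exp 1 + s)" using L L0 by (intro divide_right_mono) auto
      also have "\<dots> \<le> \<bar>C\<bar> / ((\<bar>C\<bar> + 1) / \<epsilon>)" using L L0 by (intro divide_left_mono mult_pos_pos) linarith+
      also have "\<dots> = \<epsilon> * (\<bar>C\<bar> / (\<bar>C\<bar> + 1))" by simp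
      also have "\<dots> < \<epsilon> * 1" using \<epsilon> by (intro mult_strict_left_mono) auto
      finally show ?thesis by (simp add: dist_real_def)
    qed (use \<epsilon> in simp)
    then show "\<exists>d>0. \<forall>y\<in>S. dist y x < d \<longrightarrow> dist (p y) (p x) < \<epsilon>"
      using K(1) by (intro exI[of _ "1 / K"]) auto
  qed
qed

text \<open>With a zero endpoint the claim reduces to \<open>s powr p \<le> s\<close> on the unit
  interval; otherwise it is convexity of the power.\<close>

lemma powr_convex_combination:
  fixes a b t p :: real
  assumes a: "0 \<le> a" and b: "0 \<le> b" and t: "0 \<le> t" "t \<le> 1" and p: "1 \<le> p"
  shows "((1 - t) * a + t * b) powr p \<le> (1 - t) * a powr p + t * b powr p"
proof -
  have scale: "(s * c) powr p \<le> s * c powr p" if "0 \<le> s" "s \<le> 1" "0 \<le> c" for s c :: real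
  proof -
    have "s powr p \<le> s"
    proof (cases "s = 0")
      case False
      then have "s powr p \<le> s powr 1" using that p by (intro powr_mono') auto
      then show ?thesis using that False by simp
    qed simp
    then show ?thesis using that by (simp add: powr_mult mult_right_mono)
  qed
  consider "a = 0" | "b = 0" | "0 < a" "0 < b" using a b by linarith
  then show ?thesis
  proof cases
    case 1
    then show ?thesis using scale[of t b] t b by simp
  next
    case 2
    then show ?thesis using scale[of "1 - t" a] t a by simp
  next
    case 3
    then show ?thesis
      using convex_onD[OF powr_convex[OF p], of t a b] t by simp
  qed
qed

lemma norm_powr_convex:
  fixes a b :: "'a::real_normed_vector"
  assumes t: "0 \<le> t" "t \<le> 1" and p: "1 \<le> p"
  shows "norm (a + t *\<^sub>R (b - a)) powr p \<le> norm a powr p + t * (norm b powr p - norm a powr p)"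
proof -
  have "norm (a + t *\<^sub>R (b - a)) = norm ((1 - t) *\<^sub>R a + t *\<^sub>R b)" by (simp add: algebra_simps)
  also have "\<dots> \<le> (1 - t) * norm a + t * norm b"
    using norm_triangle_ineq[of "(1 - t) *\<^sub>R a" "t *\<^sub>R b"] t by simp
  finally have "norm (a + t *\<^sub>R (b - a)) powr p \<le> ((1 - t) * norm a + t * norm b) powr p"
    using p by (intro powr_mono2) auto
  also have "\<dots> \<le> (1 - t) * norm a powr p + t * norm b powr p"
    using t p by (intro powr_convex_combination) auto
  finally show ?thesis by (simp add: algebra_simps)
qed

text \<open>The squared distance to a point is quadratic along a segment, with the squared length as
  leading coefficient. The last term is the source of the strong convexity of
  \<open>G\<close>.\<close>

lemma integral_weighted_square_convex:
  fixes a b c :: "'a \<Rightarrow> 'b::real_inner" and w :: "'a \<Rightarrow> real"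
  assumes "integrable M (\<lambda>x. (norm (a x - c x))\<^sup>2 * w x)" "integrable M (\<lambda>x. (norm (b x - c x))\<^sup>2 * w x)"
    and "integrable M (\<lambda>x. (norm (b x - a x))\<^sup>2 * w x)"
  shows "(LINT x|M. (norm (a x + t *\<^sub>R (b x - a x) - c x))\<^sup>2 * w x) =
    (LINT x|M. (norm (a x - c x))\<^sup>2 * w x)
    + t * ((LINT x|M. (norm (b x - c x))\<^sup>2 * w x) - (LINT x|M. (norm (a x - c x))\<^sup>2 * w x))
    - t * (1 - t) * (LINT x|M. (norm (b x - a x))\<^sup>2 * w x)"
proof -
  have sq: "(norm (x + t *\<^sub>R (y - x) - z))\<^sup>2 = (norm (x - z))\<^sup>2 + t * ((norm (y - z))\<^sup>2 - (norm (x - z))\<^sup>2)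
      - t * (1 - t) * (norm (y - x))\<^sup>2" for x y z :: 'b
    unfolding power2_norm_eq_inner
    by (simp add: inner_diff_left inner_diff_right inner_add_left inner_add_right inner_commute algebra_simps)
  have "(\<lambda>x. (norm (a x + t *\<^sub>R (b x - a x) - c x))\<^sup>2 * w x) =
      (\<lambda>x. ((norm (a x - c x))\<^sup>2 * w x + t * ((norm (b x - c x))\<^sup>2 * w x - (norm (a x - c x))\<^sup>2 * w x))
        - t * (1 - t) * ((norm (b x - a x))\<^sup>2 * w x))"
    unfolding sq by (simp add: algebra_simps)
  then show ?thesis using assms by simp
qed

lemma L2_diff_integrable:
  fixes f g :: "'a \<Rightarrow> 'b::euclidean_space"
  assumes f: "f \<in> L2 M" and g: "g \<in> L2 M"
  shows "integrable M (\<lambda>x. (norm (f x - g x))\<^sup>2)"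
proof (rule Bochner_Integration.integrable_bound)
  show "integrable M (\<lambda>x. 2 * (norm (f x))\<^sup>2 + 2 * (norm (g x))\<^sup>2)" using f g by (auto simp: L2_def)
  show "(\<lambda>x. (norm (f x - g x))\<^sup>2) \<in> borel_measurable M" using f g by (auto simp: L2_def)
  have "(norm (f x - g x))\<^sup>2 \<le> 2 * (norm (f x))\<^sup>2 + 2 * (norm (g x))\<^sup>2" for x
  proof -
    have "(norm (f x - g x))\<^sup>2 \<le> (norm (f x) + norm (g x))\<^sup>2" by (intro power_mono norm_triangle_ineq4) simp
    also have "\<dots> \<le> 2 * (norm (f x))\<^sup>2 + 2 * (norm (g x))\<^sup>2"
      using sum_squares_bound[of "norm (f x)" "norm (g x)"] by (simp add: power2_sum)
    finally show ?thesis .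
  qed
  then show "AE x in M. norm ((norm (f x - g x))\<^sup>2) \<le> norm (2 * (norm (f x))\<^sup>2 + 2 * (norm (g x))\<^sup>2)"
    by (intro AE_I2) (simp add: order_trans[OF _ abs_ge_self])
qed

lemma integrable_mult_bounded:
  fixes f w :: "'a \<Rightarrow> real"
  assumes "integrable M f" "w \<in> borel_measurable M" "\<And>x. x \<in> space M \<Longrightarrow> \<bar>w x\<bar> \<le> C"
  shows "integrable M (\<lambda>x. f x * w x)"
proof (rule Bochner_Integration.integrable_bound)
  show "integrable M (\<lambda>x. C * f x)" using assms(1) by simp
  show "(\<lambda>x. f x * w x) \<in> borel_measurable M" using assms(1,2) by auto
  show "AE x in M. norm (f x * w x) \<le> norm (C * f x)"
  proof (rule AE_I2)
    fix x assume "x \<in> space M"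
    then have "\<bar>w x\<bar> \<le> \<bar>C\<bar>" using assms(3) by force
    then have "\<bar>f x\<bar> * \<bar>w x\<bar> \<le> \<bar>f x\<bar> * \<bar>C\<bar>" by (rule mult_left_mono) simp
    then show "norm (f x * w x) \<le> norm (C * f x)" by (simp add: abs_mult mult.commute)
  qed
qed

lemma (in finite_measure) L2_norm_bounded:
  fixes f :: "'a \<Rightarrow> 'b::euclidean_space"
  assumes f: "f \<in> borel_measurable M" and C: "\<And>x. x \<in> space M \<Longrightarrow> norm (f x) \<le> C" and "0 \<le> C"
  shows "f \<in> L2 M" and "L2_norm M f \<le> sqrt (measure M (space M)) * C"
proof -
  have C2: "(norm (f x))\<^sup>2 \<le> C\<^sup>2" if "x \<in> space M" for x using C[OF that] by (intro power_mono) auto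
  then have i: "integrable M (\<lambda>x. (norm (f x))\<^sup>2)"
    using f by (intro integrable_const_bound[of _ "C\<^sup>2"] AE_I2) auto
  then show "f \<in> L2 M" using f by (simp add: L2_def)
  have "(LINT x|M. (norm (f x))\<^sup>2) \<le> (LINT x|M. C\<^sup>2)" by (rule integral_mono[OF i integrable_const C2])
  then have "L2_norm M f \<le> sqrt (measure M (space M) * C\<^sup>2)" unfolding L2_norm_def by simp
  then show "L2_norm M f \<le> sqrt (measure M (space M)) * C" using \<open>0 \<le> C\<close> by (simp add: real_sqrt_mult)
qed

context broken_mesh
begin

text \<open>\<open>face_size\<close> takes finitely many values and the exponent lies between -2 and
  0. A face size of 0 is harmless, since \<open>0 powr _\<close> is 0.\<close>

lemma weight_bounded:
  assumes p: "continuous_on (closure \<Omega>) p" "\<And>x. x \<in> closure \<Omega> \<Longrightarrow> 1 \<le> p x"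
    and S: "S \<subseteq> closure \<Omega>"
  obtains C where "(\<lambda>x. face_size \<Omega> \<T> x powr (- 2 / conj_exponent p x)) \<in> borel_measurable (surface_on S)"
    "\<And>x. x \<in> S \<Longrightarrow> \<bar>face_size \<Omega> \<T> x powr (- 2 / conj_exponent p x)\<bar> \<le> C"
proof -
  let ?w = "\<lambda>x. face_size \<Omega> \<T> x powr (- 2 / conj_exponent p x)"
  \<comment> \<open>\<open>p\<close> is controlled on the closure only; cutting it off there gives a
    Borel function.\<close>
  define q where "q x = indicator (closure \<Omega>) x *\<^sub>R p x" for x
  have q: "q \<in> borel_measurable borel" unfolding q_def[abs_def]
    by (rule borel_measurable_continuous_on_indicator[OF _ p(1)]) simp
  have "(\<lambda>x. face_size \<Omega> \<T> x powr (- 2 / (q x / (q x - 1)))) \<in> borel_measurable borel"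
    using measurable_face_size q by measurable
  from measurable_surface_on[OF this]
  have "(\<lambda>x. face_size \<Omega> \<T> x powr (- 2 / (q x / (q x - 1)))) \<in> borel_measurable (surface_on S)" .
  moreover have "face_size \<Omega> \<T> x powr (- 2 / (q x / (q x - 1))) = ?w x" if "x \<in> space (surface_on S)" for x
  proof -
    have "x \<in> closure \<Omega>" using that S by auto
    then show ?thesis by (simp add: q_def conj_exponent_def)
  qed
  ultimately have m: "?w \<in> borel_measurable (surface_on S)"
    using measurable_cong[of "surface_on S" "\<lambda>x. face_size \<Omega> \<T> x powr (- 2 / (q x / (q x - 1)))" ?w borel] by blast
  define D where "D = (\<lambda>E. diameter (SOME e. e \<in> E)) ` Pow (mesh_faces \<Omega> \<T>)"
  have D: "finite D" using finite_mesh_faces by (simp add: D_def)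
  have fD: "face_size \<Omega> \<T> x \<in> D" for x
  proof -
    have "face_size \<Omega> \<T> x = diameter (SOME e. e \<in> {e \<in> mesh_faces \<Omega> \<T>. x \<in> e})"
      by (simp add: face_size_def)
    then show ?thesis unfolding D_def by (rule image_eqI) blast
  qed
  have "\<bar>?w x\<bar> \<le> (\<Sum>d\<in>D. exp (2 * \<bar>ln d\<bar>))" if x: "x \<in> S" for x
  proof -
    have p1: "1 \<le> p x" using x S p(2) by blast
    then have "0 \<le> 2 / conj_exponent p x" "2 / conj_exponent p x \<le> 2"
      by (auto simp: conj_exponent_def field_simps)
    then have e: "\<bar>- 2 / conj_exponent p x\<bar> \<le> 2" by simp
    let ?d = "face_size \<Omega> \<T> x"
    have "- 2 / conj_exponent p x * ln ?d \<le> \<bar>- 2 / conj_exponent p x * ln ?d\<bar>" by (rule abs_ge_self)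
    also have "\<dots> \<le> 2 * \<bar>ln ?d\<bar>" unfolding abs_mult using e by (intro mult_right_mono) auto
    finally have "?w x \<le> exp (2 * \<bar>ln ?d\<bar>)" by (simp add: powr_def)
    then have "\<bar>?w x\<bar> \<le> exp (2 * \<bar>ln ?d\<bar>)" by simp
    also have "\<dots> \<le> (\<Sum>d\<in>D. exp (2 * \<bar>ln d\<bar>))" using fD D by (intro member_le_sum) auto
    finally show ?thesis .
  qed
  with m show ?thesis by (rule that)
qed

text \<open>Pointwise convexity is integrated. The integrals exist because discrete fields are
  bounded almost everywhere and the domain has finite measure.\<close>

lemma energy_F_convex:
  assumes p: "continuous_on (closure \<Omega>) p" "\<And>x. x \<in> closure \<Omega> \<Longrightarrow> 1 \<le> p x" "\<And>x. x \<in> closure \<Omega> \<Longrightarrow> p x \<le> 2"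
    and \<phi>: "\<phi> \<in> broken_vpolys l \<Omega> \<T>" and \<psi>: "\<psi> \<in> broken_vpolys l \<Omega> \<T>" and t: "0 \<le> t" "t \<le> 1"
  shows "energy_F \<Omega> p (\<phi> + t *\<^sub>R (\<psi> - \<phi>)) \<le> energy_F \<Omega> p \<phi> + t * (energy_F \<Omega> p \<psi> - energy_F \<Omega> p \<phi>)"
proof -
  have \<Omega>: "x \<in> closure \<Omega>" if "x \<in> space M\<Omega>" for x using that closure_subset[of \<Omega>] by auto
  have "(\<lambda>x. indicator (closure \<Omega>) x *\<^sub>R p x) \<in> borel_measurable M\<Omega>"
    by (rule borel_measurable_lebesgue_on, rule borel_measurable_continuous_on_indicator[OF _ p(1)]) simp
  moreover have "indicator (closure \<Omega>) x *\<^sub>R p x = p x" if "x \<in> space M\<Omega>" for x using \<Omega>[OF that] by simp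
  ultimately have pm: "p \<in> borel_measurable M\<Omega>"
    using measurable_cong[of M\<Omega> "\<lambda>x. indicator (closure \<Omega>) x *\<^sub>R p x" p borel] by blast
  have int: "integrable M\<Omega> (\<lambda>x. norm (\<theta> x) powr p x)" if \<theta>: "\<theta> \<in> broken_vpolys l \<Omega> \<T>" for \<theta>
  proof -
    have "\<forall>i. \<exists>C. AE x in M\<Omega>. \<bar>\<theta> x $ i\<bar> \<le> C"
      using broken_polys_AE_bounded[OF broken_vpolys_component[OF \<theta>]] by blast
    then obtain C where C: "\<And>i. AE x in M\<Omega>. \<bar>\<theta> x $ i\<bar> \<le> C i" by metis
    \<comment> \<open>The summand 1 makes the bound at least 1, so that the exponent
      \<open>p x\<close> may be raised to 2.\<close>
    let ?K = "1 + (\<Sum>i\<in>UNIV. \<bar>C i\<bar>)"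
    have "AE x in M\<Omega>. \<forall>i\<in>UNIV. \<bar>\<theta> x $ i\<bar> \<le> C i" using C by (intro AE_finite_allI) auto
    then have "AE x in M\<Omega>. norm (norm (\<theta> x) powr p x) \<le> ?K powr 2"
      using AE_space
    proof eventually_elim
      case (elim x)
      have "norm (\<theta> x) \<le> (\<Sum>i\<in>UNIV. \<bar>\<theta> x $ i\<bar>)" by (rule norm_le_l1_cart)
      also have "\<dots> \<le> (\<Sum>i\<in>UNIV. \<bar>C i\<bar>)" using elim(1) by (intro sum_mono) (auto intro: order_trans[OF _ abs_ge_self])
      finally have n: "norm (\<theta> x) \<le> ?K" by simp
      have K: "1 \<le> ?K" by (simp add: sum_nonneg)
      have "norm (\<theta> x) powr p x \<le> ?K powr p x" using n p(2)[OF \<Omega>[OF elim(2)]] by (intro powr_mono2) auto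
      also have "\<dots> \<le> ?K powr 2" using K p(3)[OF \<Omega>[OF elim(2)]] by (intro powr_mono) auto
      finally show ?case by simp
    qed
    moreover have "(\<lambda>x. norm (\<theta> x) powr p x) \<in> borel_measurable M\<Omega>"
      using broken_vpolys_measurable[OF \<theta>] pm by measurable
    ultimately show ?thesis by (intro integrable_lebesgue_on_bounded[OF lmeasurable_domain])
  qed
  have mem: "\<phi> + t *\<^sub>R (\<psi> - \<phi>) \<in> broken_vpolys l \<Omega> \<T>"
    by (intro subspace_add subspace_scale subspace_diff subspace_broken_vpolys \<phi> \<psi>)
  have "energy_F \<Omega> p (\<phi> + t *\<^sub>R (\<psi> - \<phi>))
      \<le> (LINT x|M\<Omega>. norm (\<phi> x) powr p x + t * (norm (\<psi> x) powr p x - norm (\<phi> x) powr p x))"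
    unfolding energy_F_def
  proof (rule integral_mono[OF int[OF mem]])
    show "integrable M\<Omega> (\<lambda>x. norm (\<phi> x) powr p x + t * (norm (\<psi> x) powr p x - norm (\<phi> x) powr p x))"
      using int[OF \<phi>] int[OF \<psi>] by simp
    fix x assume "x \<in> space M\<Omega>"
    then show "norm ((\<phi> + t *\<^sub>R (\<psi> - \<phi>)) x) powr p x
        \<le> norm (\<phi> x) powr p x + t * (norm (\<psi> x) powr p x - norm (\<phi> x) powr p x)"
      using norm_powr_convex[OF t p(2)[OF \<Omega>], of x "\<phi> x" "\<psi> x"] by (simp add: fun_diff_def)
  qed
  also have "\<dots> = energy_F \<Omega> p \<phi> + t * (energy_F \<Omega> p \<psi> - energy_F \<Omega> p \<phi>)"
    using int[OF \<phi>] int[OF \<psi>] by (simp add: energy_F_def)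
  finally show ?thesis .
qed

text \<open>All three terms are squared distances of quantities affine in the argument. The first
  contributes its exact deficit, a squared \<open>L2\<close> distance; the deficits of the two face
  terms are nonnegative and are dropped.\<close>

lemma energy_G_strongly_convex:
  assumes p: "continuous_on (closure \<Omega>) p" "\<And>x. x \<in> closure \<Omega> \<Longrightarrow> 1 \<le> p x"
    and \<xi>: "\<xi> \<in> L2 M\<Omega>" and g: "g \<in> L2 (surface_on (frontier \<Omega>))"
    and u: "u \<in> broken_polys k \<Omega> \<T>" and v: "v \<in> broken_polys k \<Omega> \<T>" and t: "0 \<le> t" "t \<le> 1"
  shows "energy_G \<Omega> \<T> p \<xi> g (u + t *\<^sub>R (v - u)) \<le> energy_G \<Omega> \<T> p \<xi> g u
    + t * (energy_G \<Omega> \<T> p \<xi> g v - energy_G \<Omega> \<T> p \<xi> g u) - t * (1 - t) * L2_inner M\<Omega> (v - u) (v - u)"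
proof -
  let ?z = "u + t *\<^sub>R (v - u)" and ?w = "\<lambda>x. face_size \<Omega> \<T> x powr (- 2 / conj_exponent p x)"
  let ?S = "surface_on (Gamma_int \<Omega> \<T>)" and ?D = "surface_on (frontier \<Omega>)"
  note sub = subspace_broken_polys[of k]
  have vu: "v - u \<in> broken_polys k \<Omega> \<T>" by (rule subspace_diff[OF sub v u])
  have tvu: "t *\<^sub>R (v - u) \<in> broken_polys k \<Omega> \<T>" by (rule subspace_scale[OF sub vu])
  \<comment> \<open>Written this way, additivity on sums also gives the jump and the trace of a
    difference.\<close>
  have vdec: "v = u + (v - u)" by simp
  have jz: "jump \<T> ?z x = jump \<T> u x + t *\<^sub>R (jump \<T> v x - jump \<T> u x)" for x
  proof -
    have "jump \<T> v x = jump \<T> u x + jump \<T> (v - u) x" by (subst vdec) (rule jump_add[OF u vu])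
    then show ?thesis unfolding jump_add[OF u tvu] jump_scaleR[OF vu] by simp
  qed
  have bz: "bdry_trace \<T> ?z x = bdry_trace \<T> u x + t *\<^sub>R (bdry_trace \<T> v x - bdry_trace \<T> u x)"
    if x: "x \<in> closure \<Omega>" for x
  proof -
    have "bdry_trace \<T> v x = bdry_trace \<T> u x + bdry_trace \<T> (v - u) x"
      by (subst vdec) (rule bdry_trace_add[OF u vu x])
    then show ?thesis unfolding bdry_trace_add[OF u tvu x] bdry_trace_scaleR[OF vu x] by simp
  qed
  obtain C1 where w1: "?w \<in> borel_measurable ?S" "\<And>x. x \<in> Gamma_int \<Omega> \<T> \<Longrightarrow> \<bar>?w x\<bar> \<le> C1"
    using weight_bounded[OF p Gamma_int_subset] by blast
  obtain C2 where w2: "?w \<in> borel_measurable ?D" "\<And>x. x \<in> frontier \<Omega> \<Longrightarrow> \<bar>?w x\<bar> \<le> C2"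
    using weight_bounded[OF p boundary_subset] by blast
  have jL2: "jump \<T> y \<in> L2 ?S" if y: "y \<in> broken_polys k \<Omega> \<T>" for y
  proof -
    obtain C where C: "0 \<le> C" "\<And>u x. u \<in> broken_polys k \<Omega> \<T> \<Longrightarrow> x \<in> closure \<Omega> \<Longrightarrow> norm (jump \<T> u x) \<le> C * L2_norm M\<Omega> u"
      using jump_bound by blast
    show ?thesis
      by (rule finite_measure.L2_norm_bounded(1)[OF finite_measure_Gamma_int measurable_surface_on[OF measurable_jump[OF y]],
            of "C * L2_norm M\<Omega> y"]) (use C Gamma_int_subset y in auto)
  qed
  have bL2: "bdry_trace \<T> y \<in> L2 ?D" if y: "y \<in> broken_polys k \<Omega> \<T>" for y
  proof -
    obtain C where C: "0 \<le> C"
      "\<And>u \<kappa> x. u \<in> broken_polys k \<Omega> \<T> \<Longrightarrow> \<kappa> \<in> \<T> \<Longrightarrow> x \<in> closure \<Omega> \<Longrightarrow> \<bar>on_elem \<kappa> u x\<bar> \<le> C * L2_norm M\<Omega> u"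
      by (rule on_elem_sup_bound[where j = k], rule that, assumption+)
    have "norm (bdry_trace \<T> y x) \<le> C * L2_norm M\<Omega> y" if "x \<in> space ?D" for x
    proof -
      have "x \<in> closure \<Omega>" using that boundary_subset by auto
      then show ?thesis unfolding bdry_trace_def real_norm_def using C(2)[OF y] elem_at_mem by blast
    qed
    then show ?thesis
      by (rule finite_measure.L2_norm_bounded(1)[OF finite_measure_boundary measurable_bdry_trace[OF y]])
        (assumption, rule mult_nonneg_nonneg[OF C(1) L2_norm_nonneg])
  qed
  have j0: "(\<lambda>_. 0) \<in> L2 ?S" by (simp add: L2_def)
  note ji = integrable_mult_bounded[OF L2_diff_integrable w1(1), of _ _ C1]
  note bi = integrable_mult_bounded[OF L2_diff_integrable w2(1), of _ _ C2]
  have E1: "(LINT x|M\<Omega>. \<bar>?z x - \<xi> x\<bar>\<^sup>2) = (LINT x|M\<Omega>. \<bar>u x - \<xi> x\<bar>\<^sup>2)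
      + t * ((LINT x|M\<Omega>. \<bar>v x - \<xi> x\<bar>\<^sup>2) - (LINT x|M\<Omega>. \<bar>u x - \<xi> x\<bar>\<^sup>2)) - t * (1 - t) * L2_inner M\<Omega> (v - u) (v - u)"
    using integral_weighted_square_convex[of M\<Omega> u \<xi> "\<lambda>_. 1" v t]
      L2_diff_integrable[OF broken_polys_L2[OF u] \<xi>] L2_diff_integrable[OF broken_polys_L2[OF v] \<xi>]
      L2_diff_integrable[OF broken_polys_L2[OF v] broken_polys_L2[OF u]]
    by (simp add: L2_inner_def fun_diff_def power2_eq_square)
  have nn1: "0 \<le> (LINT x|?S. (norm (jump \<T> v x - jump \<T> u x))\<^sup>2 * ?w x)"
    and nn2: "0 \<le> (LINT x|?D. (norm (bdry_trace \<T> v x - bdry_trace \<T> u x))\<^sup>2 * ?w x)"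
    by (intro Bochner_Integration.integral_nonneg, simp)+
  have t1: "0 \<le> t * (1 - t)" using t by simp
  have E2: "(LINT x|?S. (norm (jump \<T> ?z x))\<^sup>2 * ?w x) \<le> (LINT x|?S. (norm (jump \<T> u x))\<^sup>2 * ?w x)
      + t * ((LINT x|?S. (norm (jump \<T> v x))\<^sup>2 * ?w x) - (LINT x|?S. (norm (jump \<T> u x))\<^sup>2 * ?w x))"
    using integral_weighted_square_convex[OF ji[OF jL2[OF u] j0] ji[OF jL2[OF v] j0] ji[OF jL2[OF v] jL2[OF u]], of t]
      w1(2) mult_nonneg_nonneg[OF t1 nn1]
    unfolding jz by simp
  have "(LINT x|?D. \<bar>bdry_trace \<T> ?z x - g x\<bar>\<^sup>2 * ?w x)
      = (LINT x|?D. (norm (bdry_trace \<T> u x + t *\<^sub>R (bdry_trace \<T> v x - bdry_trace \<T> u x) - g x))\<^sup>2 * ?w x)"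
    by (intro Bochner_Integration.integral_cong refl) (use bz boundary_subset in auto)
  also have "\<dots> \<le> (LINT x|?D. \<bar>bdry_trace \<T> u x - g x\<bar>\<^sup>2 * ?w x)
      + t * ((LINT x|?D. \<bar>bdry_trace \<T> v x - g x\<bar>\<^sup>2 * ?w x) - (LINT x|?D. \<bar>bdry_trace \<T> u x - g x\<bar>\<^sup>2 * ?w x))"
    using integral_weighted_square_convex[OF bi[OF bL2[OF u] g] bi[OF bL2[OF v] g] bi[OF bL2[OF v] bL2[OF u]], of t]
      w2(2) mult_nonneg_nonneg[OF t1 nn2]
    by simp
  finally have E3: "(LINT x|?D. \<bar>bdry_trace \<T> ?z x - g x\<bar>\<^sup>2 * ?w x) \<le> (LINT x|?D. \<bar>bdry_trace \<T> u x - g x\<bar>\<^sup>2 * ?w x)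
      + t * ((LINT x|?D. \<bar>bdry_trace \<T> v x - g x\<bar>\<^sup>2 * ?w x) - (LINT x|?D. \<bar>bdry_trace \<T> u x - g x\<bar>\<^sup>2 * ?w x))" .
  show ?thesis unfolding energy_G_def using E1 E2 E3 by (simp add: algebra_simps)
qed

end

section \<open>Convergence\<close>

lemma L2_inner_self_nonneg: "0 \<le> L2_inner M f f"
  by (simp add: L2_inner_def)

lemma aug_lagrangian_eq:
  "aug_lagrangian \<Omega> F G B r v q \<mu> = F q + G v + L2_inner (lebesgue_on \<Omega>) \<mu> (B v - q)
    + r / 2 * L2_inner (lebesgue_on \<Omega>) (B v - q) (B v - q)"
  by (simp add: aug_lagrangian_def fun_diff_def L2_norm_eq_sqrt_inner L2_inner_self_nonneg)

text \<open>
  Testing a variational inequality or a minimization problem along a segment and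
  dividing by its parameter.
\<close>

lemma le_if_segment:
  fixes A c D :: real
  assumes "\<And>t. 0 < t \<Longrightarrow> t \<le> 1 \<Longrightarrow> 0 \<le> t * A - t * (1 - t) * c + t\<^sup>2 * D"
  shows "c \<le> A"
proof (rule ccontr)
  assume "\<not> c \<le> A"
  \<comment> \<open>Dividing the hypothesis by \<open>t\<close> gives
    \<open>c - A \<le> t * (c + D)\<close>; this \<open>t\<close> makes the right-hand side less
    than half of the left. The added 1 keeps the denominator positive.\<close>
  define t where "t = min 1 ((c - A) / (2 * (\<bar>c + D\<bar> + 1)))"
  have t: "0 < t" "t \<le> 1" using \<open>\<not> c \<le> A\<close> by (auto simp: t_def intro!: divide_pos_pos add_nonneg_pos)
  have "0 < 2 * (\<bar>c + D\<bar> + 1)" by (intro mult_pos_pos add_nonneg_pos) auto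
  moreover have "t \<le> (c - A) / (2 * (\<bar>c + D\<bar> + 1))" by (simp only: t_def min.cobounded2)
  ultimately have "t * (2 * (\<bar>c + D\<bar> + 1)) \<le> c - A" by (simp only: pos_le_divide_eq)
  moreover have "t * (c + D) \<le> t * \<bar>c + D\<bar>" using t by (intro mult_left_mono) auto
  ultimately have "2 * (t * (c + D)) < c - A" using t by (simp add: algebra_simps)
  moreover have "0 \<le> A - (1 - t) * c + t * D"
  proof -
    have "0 \<le> t * (A - (1 - t) * c + t * D)"
      using assms[OF t] by (simp add: power2_eq_square algebra_simps)
    then show ?thesis using t by (simp add: zero_le_mult_iff)
  qed
  ultimately show False using \<open>\<not> c \<le> A\<close> by (simp add: algebra_simps)
qed

section \<open>The discrete gradient and bounds of the operators by the norm of
  \<open>V\<close>\<close>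

context broken_mesh
begin

lemma dg_grad_eq: "dg_grad l \<Omega> \<T> v = lifting l \<Omega> \<T> v + broken_grad \<T> v"
  by (intro ext) (simp add: dg_grad_def)

lemma dg_grad_mem:
  assumes "int l \<ge> int k - 1" "v \<in> broken_polys k \<Omega> \<T>"
  shows "dg_grad l \<Omega> \<T> v \<in> broken_vpolys l \<Omega> \<T>"
  unfolding dg_grad_eq
  by (rule subspace_add[OF subspace_broken_vpolys lifting_mem[OF assms(2)] grad_on_elem_mem[OF assms(2,1)]])

text \<open>Linearity is claimed after pairing only: \<open>lifting\<close> picks a representative
  for each argument separately, so the discrete gradient of a sum may differ from the sum on a null
  set.\<close>

lemma L2_inner_dg_grad_linear:
  assumes kl: "int l \<ge> int k - 1" and u: "u \<in> broken_polys k \<Omega> \<T>" and v: "v \<in> broken_polys k \<Omega> \<T>"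
    and \<phi>: "\<phi> \<in> broken_vpolys l \<Omega> \<T>"
  shows "L2_inner M\<Omega> (dg_grad l \<Omega> \<T> (u + c *\<^sub>R v)) \<phi>
    = L2_inner M\<Omega> (dg_grad l \<Omega> \<T> u) \<phi> + c * L2_inner M\<Omega> (dg_grad l \<Omega> \<T> v) \<phi>"
proof -
  interpret H: semi_inner "broken_vpolys l \<Omega> \<T>" "L2_inner M\<Omega>" by (rule semi_inner_broken_vpolys)
  have cv: "c *\<^sub>R v \<in> broken_polys k \<Omega> \<T>" by (rule subspace_scale[OF subspace_broken_polys v])
  have w: "u + c *\<^sub>R v \<in> broken_polys k \<Omega> \<T>" by (rule subspace_add[OF subspace_broken_polys u cv])
  have split: "L2_inner M\<Omega> (dg_grad l \<Omega> \<T> y) \<phi> = jump_form y \<phi> + L2_inner M\<Omega> (broken_grad \<T> y) \<phi>"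
    if "y \<in> broken_polys k \<Omega> \<T>" for y
    unfolding dg_grad_eq H.ip_add_left[OF lifting_mem[OF that] grad_on_elem_mem[OF that kl] \<phi>]
      L2_inner_lifting[OF that \<phi>] ..
  have "broken_grad \<T> (u + c *\<^sub>R v) x = (broken_grad \<T> u + c *\<^sub>R broken_grad \<T> v) x"
    if "x \<in> space M\<Omega>" for x
  proof -
    have x: "x \<in> closure \<Omega>" using that closure_subset[of \<Omega>] by auto
    show ?thesis unfolding broken_grad_add[OF u cv x] broken_grad_scaleR[OF v x] by simp
  qed
  then have "L2_inner M\<Omega> (broken_grad \<T> (u + c *\<^sub>R v)) \<phi> = L2_inner M\<Omega> (broken_grad \<T> u + c *\<^sub>R broken_grad \<T> v) \<phi>"
    unfolding L2_inner_def by (intro Bochner_Integration.integral_cong refl) metis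
  also have "\<dots> = L2_inner M\<Omega> (broken_grad \<T> u) \<phi> + c * L2_inner M\<Omega> (broken_grad \<T> v) \<phi>"
    using grad_on_elem_mem[OF u kl] grad_on_elem_mem[OF v kl] \<phi>
    by (simp only: H.ip_add_left H.ip_scaleR_left H.mem_scaleR)
  finally show ?thesis
    unfolding split[OF w] split[OF u] split[OF v] jump_form_add_left[OF u cv \<phi>] jump_form_scaleR_left[OF v]
    by (simp add: algebra_simps)
qed

text \<open>Test the difference of the liftings with itself: its squared norm is a value of the jump
  form of \<open>v - u\<close>, whose bound leaves one factor to cancel.\<close>

lemma lifting_norm_le:
  obtains C where "0 \<le> C" "\<And>u v. u \<in> broken_polys k \<Omega> \<T> \<Longrightarrow> v \<in> broken_polys k \<Omega> \<T> \<Longrightarrow>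
    L2_norm M\<Omega> (lifting l \<Omega> \<T> v - lifting l \<Omega> \<T> u) \<le> C * L2_norm M\<Omega> (v - u)"
proof -
  interpret H: semi_inner "broken_vpolys l \<Omega> \<T>" "L2_inner M\<Omega>" by (rule semi_inner_broken_vpolys)
  obtain C where C: "0 \<le> C" "\<And>u \<phi>. u \<in> broken_polys k \<Omega> \<T> \<Longrightarrow> \<phi> \<in> broken_vpolys l \<Omega> \<T> \<Longrightarrow>
      \<bar>jump_form u \<phi>\<bar> \<le> C * L2_norm M\<Omega> u * L2_norm M\<Omega> \<phi>"
    using jump_form_bound by blast
  show ?thesis
  proof
    show "0 \<le> C" by fact
    fix u v assume u: "u \<in> broken_polys k \<Omega> \<T>" and v: "v \<in> broken_polys k \<Omega> \<T>"
    have vu: "v - u \<in> broken_polys k \<Omega> \<T>" by (rule subspace_diff[OF subspace_broken_polys v u])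
    let ?w = "lifting l \<Omega> \<T> v - lifting l \<Omega> \<T> u"
    have w: "?w \<in> broken_vpolys l \<Omega> \<T>" by (rule H.mem_diff[OF lifting_mem[OF v] lifting_mem[OF u]])
    have "jump_form (u + (v - u)) ?w = jump_form u ?w + jump_form (v - u) ?w"
      by (rule jump_form_add_left[OF u vu w])
    then have "jump_form v ?w = jump_form u ?w + jump_form (v - u) ?w" by simp
    then have "L2_inner M\<Omega> ?w ?w = jump_form (v - u) ?w"
      using H.ip_diff_left[OF lifting_mem[OF v] lifting_mem[OF u] w]
        L2_inner_lifting[OF u w] L2_inner_lifting[OF v w] by linarith
    then have "L2_norm M\<Omega> ?w * L2_norm M\<Omega> ?w \<le> C * L2_norm M\<Omega> (v - u) * L2_norm M\<Omega> ?w"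
      using C(2)[OF vu w] L2_inner_self_nonneg[of M\<Omega> ?w] by (simp add: L2_norm_eq_sqrt_inner[of M\<Omega> ?w])
    then show "L2_norm M\<Omega> ?w \<le> C * L2_norm M\<Omega> (v - u)"
      using C(1) L2_norm_nonneg[of M\<Omega> ?w] L2_norm_nonneg[of M\<Omega> "v - u"]
      by (cases "L2_norm M\<Omega> ?w = 0") (auto simp: mult_le_cancel_right)
  qed
qed

lemma finite_measure_domain: "finite_measure M\<Omega>"
  using lmeasurable_domain by (rule finite_measure_lebesgue_on)

text \<open>An inverse inequality on the fixed mesh: the pointwise bound of gradients of polynomials
  is integrated over a domain of finite measure.\<close>

lemma broken_grad_norm_le:
  assumes kl: "int l \<ge> int k - 1"
  obtains C where "0 \<le> C" "\<And>u v. u \<in> broken_polys k \<Omega> \<T> \<Longrightarrow> v \<in> broken_polys k \<Omega> \<T> \<Longrightarrow>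
    L2_norm M\<Omega> (broken_grad \<T> v - broken_grad \<T> u) \<le> C * L2_norm M\<Omega> (v - u)"
proof -
  obtain C where C: "0 \<le> C"
    "\<And>u \<kappa> x. u \<in> broken_polys k \<Omega> \<T> \<Longrightarrow> \<kappa> \<in> \<T> \<Longrightarrow> x \<in> closure \<Omega> \<Longrightarrow> norm (grad (on_elem \<kappa> u) x) \<le> C * L2_norm M\<Omega> u"
    by (rule on_elem_sup_bound[where j = k], rule that, assumption+)
  show ?thesis
  proof
    show "0 \<le> sqrt (measure M\<Omega> (space M\<Omega>)) * C" using C(1) by simp
    fix u v assume u: "u \<in> broken_polys k \<Omega> \<T>" and v: "v \<in> broken_polys k \<Omega> \<T>"
    have vu: "v - u \<in> broken_polys k \<Omega> \<T>" by (rule subspace_diff[OF subspace_broken_polys v u])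
    have m: "broken_grad \<T> v - broken_grad \<T> u \<in> borel_measurable M\<Omega>"
      using broken_vpolys_measurable grad_on_elem_mem[OF u kl] grad_on_elem_mem[OF v kl]
        subspace_diff[OF subspace_broken_vpolys] by blast
    have "norm ((broken_grad \<T> v - broken_grad \<T> u) x) \<le> C * L2_norm M\<Omega> (v - u)" if "x \<in> space M\<Omega>" for x
    proof -
      have x: "x \<in> closure \<Omega>" using that closure_subset[of \<Omega>] by auto
      have "broken_grad \<T> (u + (v - u)) x = broken_grad \<T> u x + broken_grad \<T> (v - u) x"
        by (rule broken_grad_add[OF u vu x])
      then have "(broken_grad \<T> v - broken_grad \<T> u) x = broken_grad \<T> (v - u) x" by simp
      then show ?thesis unfolding broken_grad_def using C(2)[OF vu _ x] elem_at_mem[OF x] by simp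
    qed
    from finite_measure.L2_norm_bounded(2)[OF finite_measure_domain m this mult_nonneg_nonneg[OF C(1) L2_norm_nonneg]]
    show "L2_norm M\<Omega> (broken_grad \<T> v - broken_grad \<T> u) \<le> sqrt (measure M\<Omega> (space M\<Omega>)) * C * L2_norm M\<Omega> (v - u)"
      by (simp only: mult.assoc)
  qed
qed

lemma jump_norm_le:
  obtains C where "0 \<le> C" "\<And>v. v \<in> broken_polys k \<Omega> \<T> \<Longrightarrow> jump \<T> v \<in> L2 (surface_on (Gamma_int \<Omega> \<T>))"
    "\<And>v. v \<in> broken_polys k \<Omega> \<T> \<Longrightarrow> L2_norm (surface_on (Gamma_int \<Omega> \<T>)) (jump \<T> v) \<le> C * L2_norm M\<Omega> v"
proof -
  let ?S = "surface_on (Gamma_int \<Omega> \<T>)"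
  obtain C where C: "0 \<le> C" "\<And>u x. u \<in> broken_polys k \<Omega> \<T> \<Longrightarrow> x \<in> closure \<Omega> \<Longrightarrow> norm (jump \<T> u x) \<le> C * L2_norm M\<Omega> u"
    using jump_bound by blast
  have b: "norm (jump \<T> v x) \<le> C * L2_norm M\<Omega> v" if "v \<in> broken_polys k \<Omega> \<T>" "x \<in> space ?S" for v x
    using that C(2) Gamma_int_subset by auto
  show ?thesis
  proof
    show "0 \<le> sqrt (measure ?S (space ?S)) * C" using C(1) by simp
    fix v assume v: "v \<in> broken_polys k \<Omega> \<T>"
    note L = finite_measure.L2_norm_bounded[OF finite_measure_Gamma_int measurable_surface_on[OF measurable_jump[OF v]]
        b[OF v] mult_nonneg_nonneg[OF C(1) L2_norm_nonneg]]
    show "jump \<T> v \<in> L2 ?S" by (rule L(1))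
    show "L2_norm ?S (jump \<T> v) \<le> sqrt (measure ?S (space ?S)) * C * L2_norm M\<Omega> v"
      using L(2) by (simp add: mult.assoc)
  qed
qed

text \<open>The difference of the traces is the trace of \<open>v - u\<close>, since the element
  chosen at a point does not depend on the function.\<close>

lemma bdry_trace_norm_le:
  obtains C where "0 \<le> C" "\<And>v. v \<in> broken_polys k \<Omega> \<T> \<Longrightarrow> bdry_trace \<T> v \<in> L2 (surface_on (frontier \<Omega>))"
    "\<And>u v. u \<in> broken_polys k \<Omega> \<T> \<Longrightarrow> v \<in> broken_polys k \<Omega> \<T> \<Longrightarrow>
      L2_norm (surface_on (frontier \<Omega>)) (\<lambda>x. bdry_trace \<T> v x - bdry_trace \<T> u x) \<le> C * L2_norm M\<Omega> (v - u)"
proof -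
  let ?S = "surface_on (frontier \<Omega>)"
  obtain C where C: "0 \<le> C"
    "\<And>u \<kappa> x. u \<in> broken_polys k \<Omega> \<T> \<Longrightarrow> \<kappa> \<in> \<T> \<Longrightarrow> x \<in> closure \<Omega> \<Longrightarrow> \<bar>on_elem \<kappa> u x\<bar> \<le> C * L2_norm M\<Omega> u"
    by (rule on_elem_sup_bound[where j = k], rule that, assumption+)
  have b: "norm (bdry_trace \<T> v x) \<le> C * L2_norm M\<Omega> v" if "v \<in> broken_polys k \<Omega> \<T>" "x \<in> space ?S" for v x
  proof -
    have x: "x \<in> closure \<Omega>" using that(2) boundary_subset by auto
    show ?thesis unfolding bdry_trace_def real_norm_def using C(2)[OF that(1) _ x] elem_at_mem[OF x] by blast
  qed
  show ?thesis
  proof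
    show "0 \<le> sqrt (measure ?S (space ?S)) * C" using C(1) by simp
    show "bdry_trace \<T> v \<in> L2 ?S" if "v \<in> broken_polys k \<Omega> \<T>" for v
      by (rule finite_measure.L2_norm_bounded(1)[OF finite_measure_boundary measurable_bdry_trace[OF that]
          b[OF that] mult_nonneg_nonneg[OF C(1) L2_norm_nonneg]])
    fix u v assume u: "u \<in> broken_polys k \<Omega> \<T>" and v: "v \<in> broken_polys k \<Omega> \<T>"
    have vu: "v - u \<in> broken_polys k \<Omega> \<T>" by (rule subspace_diff[OF subspace_broken_polys v u])
    have "norm (bdry_trace \<T> v x - bdry_trace \<T> u x) \<le> C * L2_norm M\<Omega> (v - u)" if "x \<in> space ?S" for x
    proof -
      have x: "x \<in> closure \<Omega>" using that boundary_subset by auto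
      have "bdry_trace \<T> (u + (v - u)) x = bdry_trace \<T> u x + bdry_trace \<T> (v - u) x"
        by (rule bdry_trace_add[OF u vu x])
      then have "bdry_trace \<T> v x - bdry_trace \<T> u x = bdry_trace \<T> (v - u) x" by simp
      then show ?thesis using b[OF vu that] by simp
    qed
    from finite_measure.L2_norm_bounded(2)[OF finite_measure_boundary
        borel_measurable_diff[OF measurable_bdry_trace[OF v] measurable_bdry_trace[OF u]] this
        mult_nonneg_nonneg[OF C(1) L2_norm_nonneg]]
    show "L2_norm ?S (\<lambda>x. bdry_trace \<T> v x - bdry_trace \<T> u x) \<le> sqrt (measure ?S (space ?S)) * C * L2_norm M\<Omega> (v - u)"
      by (simp add: mult.assoc)
  qed
qed

text \<open>The energies enter through their convexity, so \<open>F\<close> and \<open>G\<close> are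
  left abstract. Saddle point and iterates are turned into the inequalities between errors that
  \<open>alternating_direction_decay\<close> accepts.\<close>

theorem alternating_direction_convergence:
  fixes k l :: nat and F :: "(real^'n \<Rightarrow> real^'n) \<Rightarrow> real" and G :: "(real^'n \<Rightarrow> real) \<Rightarrow> real"
  defines "V \<equiv> broken_polys k \<Omega> \<T>" and "H \<equiv> broken_vpolys l \<Omega> \<T>" and "B \<equiv> dg_grad l \<Omega> \<T>"
  assumes kl: "int l \<ge> int k - 1"
    and convex_F: "\<And>\<phi> \<psi> t. \<lbrakk>\<phi> \<in> H; \<psi> \<in> H; 0 \<le> t; t \<le> 1\<rbrakk> \<Longrightarrow> F (\<phi> + t *\<^sub>R (\<psi> - \<phi>)) \<le> F \<phi> + t * (F \<psi> - F \<phi>)"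
    and convex_G: "\<And>v w t. \<lbrakk>v \<in> V; w \<in> V; 0 \<le> t; t \<le> 1\<rbrakk> \<Longrightarrow>
      G (v + t *\<^sub>R (w - v)) \<le> G v + t * (G w - G v) - t * (1 - t) * L2_inner M\<Omega> (w - v) (w - v)"
    and saddle: "saddle_point V H (aug_lagrangian \<Omega> F G B r) u \<eta> lam"
    and step: "\<forall>n\<ge>1. \<rho>n n = \<rho>" "0 < \<rho>" "\<rho> < r * ((1 + sqrt 5) / 2)"
    and iterates: "algorithm2 \<Omega> V H F G B r \<rho>n un \<eta>n lamn"
  shows "(\<lambda>n. L2_norm M\<Omega> (\<eta>n n - \<eta>)) \<longlonglongrightarrow> 0"
    and "AE x in M\<Omega>. \<eta> x = B u x"
    and "(\<lambda>n. L2_norm M\<Omega> (lamn (Suc n) - lamn n)) \<longlonglongrightarrow> 0"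
    and "\<exists>C. \<forall>n\<ge>1. L2_norm M\<Omega> (lamn n) \<le> C"
    and "(\<lambda>n. L2_norm M\<Omega> (un n - u)) \<longlonglongrightarrow> 0"
proof -
  let ?ip = "L2_inner M\<Omega>"
  interpret H: semi_inner H ?ip unfolding H_def by (rule semi_inner_broken_vpolys)
  interpret V: semi_inner V ?ip unfolding V_def by (rule semi_inner_broken_polys)
  have u: "u \<in> V" and \<eta>: "\<eta> \<in> H" and lam: "lam \<in> H"
    and sp: "\<And>v q \<mu>. \<lbrakk>v \<in> V; q \<in> H; \<mu> \<in> H\<rbrakk> \<Longrightarrow> aug_lagrangian \<Omega> F G B r u \<eta> \<mu> \<le> aug_lagrangian \<Omega> F G B r u \<eta> lam
      \<and> aug_lagrangian \<Omega> F G B r u \<eta> lam \<le> aug_lagrangian \<Omega> F G B r v q lam"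
    using saddle unfolding saddle_point_def by blast+
  have B: "B v \<in> H" if "v \<in> V" for v
    using that dg_grad_mem[OF kl] unfolding V_def H_def B_def by blast
  have Blin: "?ip (B (v + c *\<^sub>R w)) x = ?ip (B v) x + c * ?ip (B w) x" if "v \<in> V" "w \<in> V" "x \<in> H" for v w x c
    using that L2_inner_dg_grad_linear[OF kl] unfolding V_def H_def B_def by blast
  have Bdiff: "?ip (B (v - w)) x = ?ip (B v) x - ?ip (B w) x" if "v \<in> V" "w \<in> V" "x \<in> H" for v w x
    using Blin[OF that, of "- 1"] by simp
  have Bscale: "?ip (B (c *\<^sub>R w)) x = c * ?ip (B w) x" if "w \<in> V" "x \<in> H" for w x c
    using Blin[OF that(1,1,2), of "c - 1"] by (simp add: algebra_simps scaleR_left_diff_distrib)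
  have rpos: "0 < r"
  proof (rule ccontr)
    assume "\<not> 0 < r"
    then have "r * ((1 + sqrt 5) / 2) \<le> 0" by (intro mult_nonpos_nonneg) auto
    then show False using step(2,3) by linarith
  qed

  \<comment> \<open>Testing the saddle point with \<open>lam + (B u - \<eta>)\<close> forces the
    residual to have norm 0. It is then orthogonal to all of \<open>H\<close>, the form used
    below.\<close>
  have null: "?ip (B u - \<eta>) x = 0" if "x \<in> H" for x
  proof (rule H.ip_null_left[OF _ that])
    have d: "B u - \<eta> \<in> H" by (intro H.mem_diff B u \<eta>)
    have "?ip (lam + (B u - \<eta>)) (B u - \<eta>) \<le> ?ip lam (B u - \<eta>)"
      using sp[OF u \<eta> H.mem_add[OF lam d]] unfolding aug_lagrangian_eq by linarith
    then show "?ip (B u - \<eta>) (B u - \<eta>) = 0"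
      unfolding H.ip_add_left[OF lam d d] using H.ip_nonneg[OF d] by linarith
    show "B u - \<eta> \<in> H" by (rule d)
  qed
  have null': "?ip x (B u - \<eta>) = 0" if "x \<in> H" for x
    using null[OF that] H.ip_commute[OF that H.mem_diff[OF B[OF u] \<eta>]] by simp
  have L0: "aug_lagrangian \<Omega> F G B r u \<eta> lam = F \<eta> + G u"
    unfolding aug_lagrangian_eq null'[OF lam] null[OF H.mem_diff[OF B[OF u] \<eta>]] by simp
  show "AE x in M\<Omega>. \<eta> x = B u x"
  proof -
    have "AE x in M\<Omega>. (B u - \<eta>) x = 0"
      using broken_vpolys_null[OF H.mem_diff[OF B[OF u] \<eta>, unfolded H_def]] null[OF H.mem_diff[OF B[OF u] \<eta>]] by blast
    then show ?thesis by eventually_elim simp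
  qed

  \<comment> \<open>On the segment from \<open>\<eta>\<close> to \<open>q\<close> the residual is
    proportional to \<open>t\<close> up to a null vector, so the augmentation is quadratic in
    \<open>t\<close> and disappears in the limit.\<close>
  have saddle_F: "0 \<le> F q - F \<eta> - ?ip lam (q - \<eta>)" if q: "q \<in> H" for q
  proof (rule le_if_segment[where c = 0 and D = "r / 2 * ?ip (q - \<eta>) (q - \<eta>)"])
    fix t :: real assume t: "0 < t" "t \<le> 1"
    let ?q = "\<eta> + t *\<^sub>R (q - \<eta>)" and ?d = "B u - \<eta>"
    have d: "?d \<in> H" and qe: "q - \<eta> \<in> H" using B u \<eta> q by (auto intro: H.mem_diff)
    have tq: "t *\<^sub>R (q - \<eta>) \<in> H" by (rule H.mem_scaleR[OF qe])
    have qH: "?q \<in> H" by (rule H.mem_add[OF \<eta> tq])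
    have eq: "B u - ?q = ?d - t *\<^sub>R (q - \<eta>)" by simp
    have 1: "?ip lam (B u - ?q) = - t * ?ip lam (q - \<eta>)"
      unfolding eq H.ip_diff_right[OF lam d tq] null'[OF lam] H.ip_scaleR_right[OF lam qe] by simp
    have 2: "?ip (B u - ?q) (B u - ?q) = t\<^sup>2 * ?ip (q - \<eta>) (q - \<eta>)"
      unfolding eq H.ip_diff_left[OF d tq H.mem_diff[OF d tq]] null[OF H.mem_diff[OF d tq]]
        H.ip_diff_right[OF tq d tq] null'[OF tq] H.ip_scaleR_left[OF qe tq] H.ip_scaleR_right[OF qe qe]
      by (simp add: power2_eq_square)
    have "F \<eta> + G u \<le> aug_lagrangian \<Omega> F G B r u ?q lam" using sp[OF u qH lam] L0 by simp
    then have "F \<eta> \<le> F ?q - t * ?ip lam (q - \<eta>) + r / 2 * (t\<^sup>2 * ?ip (q - \<eta>) (q - \<eta>))"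
      unfolding aug_lagrangian_eq 1 2 by simp
    then show "0 \<le> t * (F q - F \<eta> - ?ip lam (q - \<eta>)) - t * (1 - t) * 0 + t\<^sup>2 * (r / 2 * ?ip (q - \<eta>) (q - \<eta>))"
      using convex_F[OF \<eta> q, of t] t by (simp add: algebra_simps)
  qed

  \<comment> \<open>The same along a segment from \<open>u\<close>; the strong convexity of
    \<open>G\<close> survives as the squared distance on the left.\<close>
  have saddle_G: "?ip (v - u) (v - u) \<le> G v - G u + ?ip lam (B (v - u))" if v: "v \<in> V" for v
  proof (rule le_if_segment[where D = "r / 2 * ?ip (B (v - u)) (B (v - u))"])
    fix t :: real assume t: "0 < t" "t \<le> 1"
    let ?v = "u + t *\<^sub>R (v - u)"
    have vu: "v - u \<in> V" by (rule V.mem_diff[OF v u])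
    have vV: "?v \<in> V" by (rule V.mem_add[OF u V.mem_scaleR[OF vu]])
    have b: "B (v - u) \<in> H" and c: "B ?v - \<eta> \<in> H" using B vu vV \<eta> by (auto intro: H.mem_diff)
    have *: "?ip (B ?v - \<eta>) x = t * ?ip (B (v - u)) x" if "x \<in> H" for x
      using null[OF that] H.ip_diff_left[OF B[OF u] \<eta> that] H.ip_diff_left[OF B[OF vV] \<eta> that] Blin[OF u vu that, of t]
      by linarith
    have 1: "?ip lam (B ?v - \<eta>) = t * ?ip lam (B (v - u))"
      using *[OF lam] H.ip_commute[OF lam c] H.ip_commute[OF lam b] by simp
    have 2: "?ip (B ?v - \<eta>) (B ?v - \<eta>) = t\<^sup>2 * ?ip (B (v - u)) (B (v - u))"
      using *[OF c] *[OF b] H.ip_commute[OF c b] by (simp add: power2_eq_square)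
    have "F \<eta> + G u \<le> aug_lagrangian \<Omega> F G B r ?v \<eta> lam" using sp[OF vV \<eta> lam] L0 by simp
    then have "G u \<le> G ?v + t * ?ip lam (B (v - u)) + r / 2 * (t\<^sup>2 * ?ip (B (v - u)) (B (v - u)))"
      unfolding aug_lagrangian_eq 1 2 by simp
    then show "0 \<le> t * (G v - G u + ?ip lam (B (v - u))) - t * (1 - t) * ?ip (v - u) (v - u)
        + t\<^sup>2 * (r / 2 * ?ip (B (v - u)) (B (v - u)))"
      using convex_G[OF u v, of t] t by (simp add: algebra_simps)
  qed

  have eta0: "\<eta>n 0 \<in> H" and lam1: "lamn 1 \<in> H"
    and un1: "\<And>n. 1 \<le> n \<Longrightarrow> un n \<in> V" and etan1: "\<And>n. 1 \<le> n \<Longrightarrow> \<eta>n n \<in> H" and lamS: "\<And>n. 1 \<le> n \<Longrightarrow> lamn (Suc n) \<in> H"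
    using iterates unfolding algorithm2_def by blast+
  have algG: "0 \<le> G v - G (un n) + ?ip (lamn n) (B (v - un n)) + r * ?ip (B (un n) - \<eta>n (n - 1)) (B (v - un n))"
    if "1 \<le> n" "v \<in> V" for n v
    using iterates that unfolding algorithm2_def fun_diff_def by blast
  have algF: "0 \<le> F q - F (\<eta>n n) - ?ip (lamn n) (q - \<eta>n n) + r * ?ip (\<eta>n n - B (un n)) (q - \<eta>n n)"
    if "1 \<le> n" "q \<in> H" for n q
    using iterates that unfolding algorithm2_def fun_diff_def by blast
  have algL: "AE x in M\<Omega>. lamn (Suc n) x = lamn n x + \<rho> *\<^sub>R (B (un n) x - \<eta>n n x)" if "1 \<le> n" for n
  proof -
    have "AE x in M\<Omega>. lamn (Suc n) x = lamn n x + \<rho>n n *\<^sub>R (B (un n) x - \<eta>n n x)"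
      using iterates that unfolding algorithm2_def by blast
    then show ?thesis using step(1) that by simp
  qed
  have etan: "\<eta>n n \<in> H" for n using eta0 etan1[of n] by (cases n) auto
  have lamn: "lamn n \<in> H" if "1 \<le> n" for n
    using lam1 lamS[of "n - 1"] that by (cases "n = 1") auto

  define b where "b n = B (un n) - B u" for n
  define e where "e n = \<eta>n n - \<eta>" for n
  define m where "m n = lamn n - lam" for n
  have bH: "b n \<in> H" if "1 \<le> n" for n using that by (simp add: b_def H.mem_diff B un1 u)
  have eH: "e n \<in> H" for n by (simp add: e_def H.mem_diff etan \<eta>)
  have mH: "m n \<in> H" if "1 \<le> n" for n using that by (simp add: m_def H.mem_diff lamn lam)

  have meas: "x \<in> borel_measurable M\<Omega>" if "x \<in> H" for x
    using that broken_vpolys_measurable unfolding H_def by blast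
  \<comment> \<open>The update is known almost everywhere, which suffices for integrals against a
    vector of \<open>H\<close>.\<close>
  have update: "?ip (lamn (Suc n)) x = ?ip (lamn n) x + \<rho> * ?ip (b n - e n) x" if n: "1 \<le> n" and x: "x \<in> H" for n x
  proof -
    let ?y = "lamn n + \<rho> *\<^sub>R (B (un n) - \<eta>n n)"
    have y: "B (un n) - \<eta>n n \<in> H" using B un1 n etan by (auto intro: H.mem_diff)
    have yH: "?y \<in> H" by (rule H.mem_add[OF lamn[OF n] H.mem_scaleR[OF y]])
    have "?ip (lamn (Suc n)) x = ?ip ?y x"
      unfolding L2_inner_def
    proof (rule integral_cong_AE)
      show "(\<lambda>z. lamn (Suc n) z \<bullet> x z) \<in> borel_measurable M\<Omega>" "(\<lambda>z. ?y z \<bullet> x z) \<in> borel_measurable M\<Omega>"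
        by (rule borel_measurable_inner[OF meas[OF lamS[OF n]] meas[OF x]],
            rule borel_measurable_inner[OF meas[OF yH] meas[OF x]])
      show "AE z in M\<Omega>. lamn (Suc n) z \<bullet> x z = ?y z \<bullet> x z" using algL[OF n] by eventually_elim simp
    qed
    also have "\<dots> = ?ip (lamn n) x + \<rho> * ?ip (B (un n) - \<eta>n n) x"
      unfolding H.ip_add_left[OF lamn[OF n] H.mem_scaleR[OF y] x] H.ip_scaleR_left[OF y x] ..
    also have "?ip (B (un n) - \<eta>n n) x = ?ip (b n - e n) x"
      using null[OF x] H.ip_diff_left[OF B[OF u] \<eta> x] H.ip_diff_left[OF B[OF un1[OF n]] etan x, of n]
        H.ip_diff_left[OF bH[OF n] eH x, of n] H.ip_diff_left[OF B[OF un1[OF n]] B[OF u] x]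
        H.ip_diff_left[OF etan \<eta> x, of n]
      unfolding b_def e_def by linarith
    finally show ?thesis .
  qed

  \<comment> \<open>One squared distance comes from the inequality of the algorithm, tested along
    the segment from \<open>un n\<close> to \<open>u\<close>, and one from \<open>saddle_G\<close>
    at \<open>un n\<close>.\<close>
  have vi_b: "2 * ?ip (un n - u) (un n - u) \<le> - ?ip (m n) (b n) - r * ?ip (b n - e (n - 1)) (b n)" if n: "1 \<le> n" for n
  proof -
    note un = un1[OF n] and ln = lamn[OF n] and bn = bH[OF n]
    have w: "u - un n \<in> V" by (rule V.mem_diff[OF u un])
    let ?c = "B (un n) - \<eta>n (n - 1)"
    have c: "?c \<in> H" by (rule H.mem_diff[OF B[OF un] etan])
    have "?ip (u - un n) (u - un n) \<le> G u - G (un n) + ?ip (lamn n) (B (u - un n)) + r * ?ip ?c (B (u - un n))"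
    proof (rule le_if_segment[where D = 0])
      fix t :: real assume t: "0 < t" "t \<le> 1"
      let ?v = "un n + t *\<^sub>R (u - un n)"
      have "?v \<in> V" by (rule V.mem_add[OF un V.mem_scaleR[OF w]])
      moreover have "?v - un n = t *\<^sub>R (u - un n)" by simp
      moreover have "?ip x (B (t *\<^sub>R (u - un n))) = t * ?ip x (B (u - un n))" if x: "x \<in> H" for x
        using Bscale[OF w x, of t] H.ip_commute[OF x B[OF w]] H.ip_commute[OF x B[OF V.mem_scaleR[OF w]], of t] by simp
      ultimately have "0 \<le> G ?v - G (un n) + t * ?ip (lamn n) (B (u - un n)) + r * (t * ?ip ?c (B (u - un n)))"
        using algG[OF n, of ?v] ln c by simp
      then show "0 \<le> t * (G u - G (un n) + ?ip (lamn n) (B (u - un n)) + r * ?ip ?c (B (u - un n)))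
          - t * (1 - t) * ?ip (u - un n) (u - un n) + t\<^sup>2 * 0"
        using convex_G[OF un u, of t] t by (simp add: algebra_simps)
    qed
    moreover have neg: "?ip x (B (u - un n)) = - ?ip x (b n)" if x: "x \<in> H" for x
      using Bdiff[OF u un x] H.ip_commute[OF x B[OF w]] H.ip_commute[OF x bn]
        H.ip_diff_left[OF B[OF un] B[OF u] x] by (simp add: b_def)
    moreover have pos: "?ip lam (B (un n - u)) = ?ip lam (b n)"
      using Bdiff[OF un u lam] H.ip_commute[OF lam B[OF V.mem_diff[OF un u]]] H.ip_commute[OF lam bn]
        H.ip_diff_left[OF B[OF un] B[OF u] lam] by (simp add: b_def)
    moreover have "?ip (u - un n) (u - un n) = ?ip (un n - u) (un n - u)"
      using V.ip_diff_left[OF u un w] V.ip_diff_left[OF un u V.mem_diff[OF un u]]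
        V.ip_diff_right[OF u u un] V.ip_diff_right[OF un u un] V.ip_diff_right[OF u un u] V.ip_diff_right[OF un un u]
      by linarith
    \<comment> \<open>\<open>B u\<close> and \<open>\<eta>\<close> differ by a null vector, so
      subtracting one from \<open>B (un n)\<close> and the other from \<open>\<eta>n (n - 1)\<close>
      does not change the pairing.\<close>
    moreover have "?ip ?c (b n) = ?ip (b n - e (n - 1)) (b n)"
      using null[OF bn] H.ip_diff_left[OF B[OF u] \<eta> bn] H.ip_diff_left[OF B[OF un] etan bn, of "n - 1"]
        H.ip_diff_left[OF bn eH bn, of "n - 1"] H.ip_diff_left[OF B[OF un] B[OF u] bn]
        H.ip_diff_left[OF etan \<eta> bn, of "n - 1"]
      unfolding b_def[of n, symmetric] e_def[of "n - 1", symmetric] by linarith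
    moreover have "?ip (m n) (b n) = ?ip (lamn n) (b n) - ?ip lam (b n)"
      unfolding m_def by (rule H.ip_diff_left[OF ln lam bn])
    ultimately show ?thesis using saddle_G[OF un] neg[OF ln] neg[OF c] by simp
  qed

  have res: "?ip (\<eta>n n - B (un n)) x = - ?ip (b n - e n) x" if n: "1 \<le> n" and x: "x \<in> H" for n x
    using null[OF x] H.ip_diff_left[OF B[OF u] \<eta> x] H.ip_diff_left[OF etan B[OF un1[OF n]] x, of n]
      H.ip_diff_left[OF bH[OF n] eH x, of n] H.ip_diff_left[OF B[OF un1[OF n]] B[OF u] x]
      H.ip_diff_left[OF etan \<eta> x, of n]
    unfolding b_def[of n, symmetric] e_def[of n, symmetric] by linarith

  \<comment> \<open>The inequality of the algorithm at \<open>\<eta>\<close> plus that of the saddle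
    point at \<open>\<eta>n n\<close>; the values of \<open>F\<close> cancel.\<close>
  have vi_e: "0 \<le> ?ip (m n) (e n) - r * ?ip (e n - b n) (e n)" if n: "1 \<le> n" for n
  proof -
    note ln = lamn[OF n]
    have minus: "?ip x (\<eta> - \<eta>n n) = - ?ip x (e n)" if x: "x \<in> H" for x
      unfolding e_def H.ip_diff_right[OF x \<eta> etan] H.ip_diff_right[OF x etan \<eta>] by simp
    have c: "\<eta>n n - B (un n) \<in> H" by (rule H.mem_diff[OF etan B[OF un1[OF n]]])
    have "?ip (e n - b n) (e n) = - ?ip (b n - e n) (e n)"
      unfolding H.ip_diff_left[OF eH bH[OF n] eH] H.ip_diff_left[OF bH[OF n] eH eH] by simp
    moreover have "?ip (m n) (e n) = ?ip (lamn n) (e n) - ?ip lam (e n)"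
      unfolding m_def by (rule H.ip_diff_left[OF ln lam eH])
    ultimately show ?thesis
      using algF[OF n \<eta>] saddle_F[OF etan, of n] minus[OF ln] minus[OF c] res[OF n eH, of n]
      unfolding e_def[of n, symmetric] by simp
  qed

  \<comment> \<open>Steps \<open>n\<close> and \<open>Suc n\<close> are each tested with the
    \<open>\<eta>n\<close> of the other; the values of \<open>F\<close> cancel again.\<close>
  have vi_step: "0 \<le> ?ip (m (Suc n) - m n) (e (Suc n) - e n)
      + r * ?ip ((b (Suc n) - e (Suc n)) - (b n - e n)) (e (Suc n) - e n)" if n: "1 \<le> n" for n
  proof -
    let ?D = "e (Suc n) - e n"
    have D: "?D \<in> H" by (rule H.mem_diff[OF eH eH])
    have S: "1 \<le> Suc n" by simp
    have D1: "\<eta>n (Suc n) - \<eta>n n = ?D" by (simp add: e_def)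
    have D2: "?ip x (\<eta>n n - \<eta>n (Suc n)) = - ?ip x ?D" if x: "x \<in> H" for x
      unfolding D1[symmetric] H.ip_diff_right[OF x etan etan] by simp
    have mm: "m (Suc n) - m n = lamn (Suc n) - lamn n" by (simp add: m_def)
    have c: "\<eta>n (Suc n) - B (un (Suc n)) \<in> H" by (rule H.mem_diff[OF etan B[OF un1[OF S]]])
    have bS: "b (Suc n) - e (Suc n) \<in> H" "b n - e n \<in> H" by (intro H.mem_diff bH eH n S)+
    show ?thesis
      using algF[OF n etan, of "Suc n"] algF[OF S etan, of n]
      unfolding D1 D2[OF lamS[OF n]] D2[OF c] res[OF n D] res[OF S D] mm
        H.ip_diff_left[OF lamS[OF n] lamn[OF n] D] H.ip_diff_left[OF bS D]
      by (simp add: right_diff_distrib)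
  qed

  have golden: "\<rho>\<^sup>2 < r\<^sup>2 + r * \<rho>"
  proof -
    \<comment> \<open>The golden ratio, the positive root of \<open>a\<^sup>2 = a + 1\<close>. The
      quadratic in \<open>\<rho>\<close> has the roots \<open>r * a\<close> and
      \<open>- r * (a - 1)\<close>, and \<open>\<rho>\<close> lies between them.\<close>
    define a where "a = (1 + sqrt 5) / 2"
    have "a\<^sup>2 = a + 1" by (simp add: a_def power2_eq_square field_simps)
    have a1: "1 < a" by (simp add: a_def)
    have "(\<rho> - r * a) * (\<rho> + r * (a - 1)) < 0"
      using step(2,3) rpos a1 by (intro mult_neg_pos add_pos_pos) (auto simp: a_def)
    also have "(\<rho> - r * a) * (\<rho> + r * (a - 1)) = \<rho>\<^sup>2 - r * \<rho> - r\<^sup>2 * (a\<^sup>2 - a)"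
      by (simp add: power2_eq_square algebra_simps)
    finally show ?thesis using \<open>a\<^sup>2 = a + 1\<close> by simp
  qed
  have m_update: "?ip (m (Suc n)) x = ?ip (m n) x + \<rho> * ?ip (b n - e n) x" if n: "1 \<le> n" and x: "x \<in> H" for n x
    unfolding m_def H.ip_diff_left[OF lamS[OF n] lam x] H.ip_diff_left[OF lamn[OF n] lam x] using update[OF n x] by simp
  have unn: "0 \<le> ?ip (un n - u) (un n - u)" for n by (rule L2_inner_self_nonneg)
  note decay = H.alternating_direction_decay[OF rpos step(2) golden bH eH mH unn vi_b vi_e vi_step m_update]
  have s0: "(\<lambda>n. ?ip (un n - u) (un n - u)) \<longlonglongrightarrow> 0" by (rule decay(1))
  have d0: "(\<lambda>n. ?ip (b n - e n) (b n - e n)) \<longlonglongrightarrow> 0" by (rule decay(2))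
  show un_lim: "(\<lambda>n. L2_norm M\<Omega> (un n - u)) \<longlonglongrightarrow> 0"
    unfolding L2_norm_eq_sqrt_inner using tendsto_real_sqrt[OF s0] by simp

  have d_lim: "(\<lambda>n. L2_norm M\<Omega> (b n - e n)) \<longlonglongrightarrow> 0"
    unfolding L2_norm_eq_sqrt_inner using tendsto_real_sqrt[OF d0] by simp
  obtain C where C: "0 \<le> C" "\<And>u v. u \<in> V \<Longrightarrow> v \<in> V \<Longrightarrow> L2_norm M\<Omega> (lifting l \<Omega> \<T> v - lifting l \<Omega> \<T> u) \<le> C * L2_norm M\<Omega> (v - u)"
    using lifting_norm_le unfolding V_def by blast
  obtain D where D: "0 \<le> D" "\<And>u v. u \<in> V \<Longrightarrow> v \<in> V \<Longrightarrow> L2_norm M\<Omega> (broken_grad \<T> v - broken_grad \<T> u) \<le> D * L2_norm M\<Omega> (v - u)"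
    using broken_grad_norm_le[OF kl] unfolding V_def by blast
  have tri: "L2_norm M\<Omega> (x + y) \<le> L2_norm M\<Omega> x + L2_norm M\<Omega> y" if "x \<in> H" "y \<in> H" for x y
    unfolding L2_norm_eq_sqrt_inner by (rule H.sqrt_ip_triangle[OF that])
  have tri': "L2_norm M\<Omega> (x - y) \<le> L2_norm M\<Omega> x + L2_norm M\<Omega> y" if "x \<in> H" "y \<in> H" for x y
  proof -
    have "L2_norm M\<Omega> (- y) = L2_norm M\<Omega> y" by (simp add: L2_norm_def)
    then show ?thesis using tri[OF that(1) H.mem_uminus[OF that(2)]] by simp
  qed
  \<comment> \<open>The decay gives convergence of \<open>un n - u\<close> and of the residual only.
    So \<open>e n\<close> is recovered as \<open>b n\<close> minus the residual, with
    \<open>b n\<close> bounded by \<open>un n - u\<close> through the lifting and the elementwise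
    gradient.\<close>
  have e_le: "L2_norm M\<Omega> (e n) \<le> (C + D) * L2_norm M\<Omega> (un n - u) + L2_norm M\<Omega> (b n - e n)" if n: "1 \<le> n" for n
  proof -
    let ?R = "lifting l \<Omega> \<T> (un n) - lifting l \<Omega> \<T> u" and ?g = "broken_grad \<T> (un n) - broken_grad \<T> u"
    have "?R \<in> H" "?g \<in> H"
      using un1[OF n] u lifting_mem grad_on_elem_mem kl H.mem_diff unfolding V_def H_def by blast+
    moreover have "b n = ?R + ?g" by (simp add: b_def B_def dg_grad_eq)
    ultimately have "L2_norm M\<Omega> (b n) \<le> L2_norm M\<Omega> ?R + L2_norm M\<Omega> ?g" using tri by simp
    then have "L2_norm M\<Omega> (b n) \<le> (C + D) * L2_norm M\<Omega> (un n - u)"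
      using C(2)[OF u un1[OF n]] D(2)[OF u un1[OF n]] by (simp add: distrib_right)
    moreover have "L2_norm M\<Omega> (b n - (b n - e n)) \<le> L2_norm M\<Omega> (b n) + L2_norm M\<Omega> (b n - e n)"
      by (rule tri'[OF bH[OF n] H.mem_diff[OF bH[OF n] eH]])
    ultimately show ?thesis by simp
  qed
  have "(\<lambda>n. (C + D) * L2_norm M\<Omega> (un n - u) + L2_norm M\<Omega> (b n - e n)) \<longlonglongrightarrow> (C + D) * 0 + 0"
    by (intro tendsto_intros un_lim d_lim)
  then have lim: "(\<lambda>n. (C + D) * L2_norm M\<Omega> (un n - u) + L2_norm M\<Omega> (b n - e n)) \<longlonglongrightarrow> 0" by simp
  have "(\<lambda>n. L2_norm M\<Omega> (e n)) \<longlonglongrightarrow> 0"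
    by (rule tendsto_sandwich[OF _ _ tendsto_const lim])
      (use e_le in \<open>auto simp: eventually_sequentially intro!: exI[of _ 1]\<close>)
  then show "(\<lambda>n. L2_norm M\<Omega> (\<eta>n n - \<eta>)) \<longlonglongrightarrow> 0" by (simp only: e_def)

  \<comment> \<open>Pairing the increment with itself and with the residual takes the place of an
    identity of vectors.\<close>
  have "L2_norm M\<Omega> (lamn (Suc n) - lamn n) = \<rho> * L2_norm M\<Omega> (b n - e n)" if n: "1 \<le> n" for n
  proof -
    let ?w = "lamn (Suc n) - lamn n" and ?d = "b n - e n"
    have w: "?w \<in> H" by (rule H.mem_diff[OF lamS[OF n] lamn[OF n]])
    have d: "?d \<in> H" by (rule H.mem_diff[OF bH[OF n] eH])
    have wx: "?ip ?w x = \<rho> * ?ip ?d x" if "x \<in> H" for x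
      unfolding H.ip_diff_left[OF lamS[OF n] lamn[OF n] that] using update[OF n that] by simp
    have "?ip ?w ?w = \<rho>\<^sup>2 * ?ip ?d ?d"
      using wx[OF w] wx[OF d] H.ip_commute[OF w d] by (simp add: power2_eq_square)
    then show ?thesis using step(2) by (simp add: L2_norm_eq_sqrt_inner real_sqrt_mult)
  qed
  then have "\<forall>\<^sub>F n in sequentially. \<rho> * L2_norm M\<Omega> (b n - e n) = L2_norm M\<Omega> (lamn (Suc n) - lamn n)"
    by (auto simp: eventually_sequentially intro!: exI[of _ 1])
  moreover have "(\<lambda>n. \<rho> * L2_norm M\<Omega> (b n - e n)) \<longlonglongrightarrow> 0"
    using tendsto_mult_left[OF d_lim, of \<rho>] by simp
  ultimately show "(\<lambda>n. L2_norm M\<Omega> (lamn (Suc n) - lamn n)) \<longlonglongrightarrow> 0"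
    by (rule Lim_transform_eventually[rotated])

  obtain K where K: "\<And>n. 1 \<le> n \<Longrightarrow> ?ip (m n) (m n) \<le> K" using decay(3) by blast
  have "L2_norm M\<Omega> (lamn n) \<le> sqrt K + L2_norm M\<Omega> lam" if n: "1 \<le> n" for n
  proof -
    have "L2_norm M\<Omega> (m n + lam) \<le> L2_norm M\<Omega> (m n) + L2_norm M\<Omega> lam" by (rule tri[OF mH[OF n] lam])
    moreover have "L2_norm M\<Omega> (m n) \<le> sqrt K"
      unfolding L2_norm_eq_sqrt_inner using K[OF n] by (rule real_sqrt_le_mono)
    ultimately show ?thesis by (simp add: m_def)
  qed
  then show "\<exists>C. \<forall>n\<ge>1. L2_norm M\<Omega> (lamn n) \<le> C" by blast
qed

end

text \<open>Interior faces lie in the frontier of an element, boundary faces in that of the closed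
  domain. All of these are polyhedral bodies, so skeleton and boundary are flat: Lebesgue null and
  of finite surface measure.\<close>

lemma broken_mesh_of_mesh_family:
  fixes \<Omega> :: "(real^'n) set"
  assumes domain: "polyhedral_domain \<Omega>" and mesh: "mesh_family \<Omega> T" and h: "0 < h" "h \<le> 1"
  shows "broken_mesh \<Omega> (T h)"
proof -
  have \<Omega>: "open \<Omega>" "bounded \<Omega>" "polyhedral_body (closure \<Omega>)" "lipschitz_boundary \<Omega>"
    using domain by (auto simp: polyhedral_domain_def)
  have "\<exists>Ref. (\<forall>K\<in>Ref. polyhedral_body K) \<and>
      (\<forall>h\<in>{0<..1}. partition_of_domain \<Omega> (T h) \<and> (\<forall>\<kappa>\<in>T h. \<exists>K\<in>Ref. affine_image_of K \<kappa>))"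
    using mesh unfolding mesh_family_def
  proof (elim exE conjE, goal_cases)
    case (1 Ref C1 C2 c C)
    have "partition_of_domain \<Omega> (T h) \<and> (\<forall>\<kappa>\<in>T h. \<exists>K\<in>Ref. affine_image_of K \<kappa>)" if "h \<in> {0<..1}" for h
    proof -
      note conj = bspec[OF 1(7) that]
      show ?thesis using conjunct1[OF conj] conjunct1[OF conjunct2[OF conj]] by blast
    qed
    then show ?case using 1(2) by (intro exI[of _ Ref] conjI ballI) auto
  qed
  then obtain Ref where Ref: "\<forall>K\<in>Ref. polyhedral_body K"
    and fam: "\<forall>h\<in>{0<..1}. partition_of_domain \<Omega> (T h) \<and> (\<forall>\<kappa>\<in>T h. \<exists>K\<in>Ref. affine_image_of K \<kappa>)"
    by (elim exE conjE) (rule that)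
  have part: "partition_of_domain \<Omega> (T h)" and img: "\<forall>\<kappa>\<in>T h. \<exists>K\<in>Ref. affine_image_of K \<kappa>"
    using fam h by auto
  have body: "polyhedral_body \<kappa>" if "\<kappa> \<in> T h" for \<kappa>
    using that img Ref polyhedral_body_affine_image by blast
  have inter: "\<kappa> \<inter> \<kappa>' \<subseteq> frontier \<kappa>" if "\<kappa> \<in> T h" "\<kappa>' \<in> T h" "\<kappa> \<noteq> \<kappa>'" for \<kappa> \<kappa>'
    using that part body by (intro Int_polyhedral_subset_frontier) (auto simp: partition_of_domain_def)
  have bd: "frontier \<Omega> \<subseteq> frontier (closure \<Omega>)"
    using \<Omega>(1,4) by (rule frontier_subset_frontier_closure)
  have flat_bd: "flat (frontier \<Omega>)"
    using flat_frontier_polyhedral_body[OF \<Omega>(3)] bd by (rule flat_subset)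
  have bounded_bd: "bounded (frontier \<Omega>)"
    using bounded_subset[OF bounded_closure[OF \<Omega>(2)]] by (simp add: frontier_def)
  have fin: "finite (T h)" and Un: "\<Union>(T h) = closure \<Omega>" using part by (auto simp: partition_of_domain_def)
  have "Gamma_int \<Omega> (T h) \<subseteq> (\<Union>K\<in>insert (closure \<Omega>) (T h). frontier K)"
  proof
    fix x assume "x \<in> Gamma_int \<Omega> (T h)"
    then obtain e where e: "e \<in> mesh_faces \<Omega> (T h)" "x \<in> e" by (auto simp: Gamma_int_def)
    then consider \<kappa> \<kappa>' where "\<kappa> \<in> T h" "\<kappa>' \<in> T h" "\<kappa> \<noteq> \<kappa>'" "e = \<kappa> \<inter> \<kappa>'" | \<kappa> where "e = \<kappa> \<inter> frontier \<Omega>"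
      unfolding mesh_faces_def interior_faces_of_def by blast
    then show "x \<in> (\<Union>K\<in>insert (closure \<Omega>) (T h). frontier K)"
    proof cases
      case 1
      then have "x \<in> frontier \<kappa>" using e(2) inter by blast
      then show ?thesis using 1(1) by blast
    next
      case 2
      then show ?thesis using e(2) bd by blast
    qed
  qed
  moreover have "flat (\<Union>K\<in>insert (closure \<Omega>) (T h). frontier K)"
  proof (rule flat_UN)
    show "finite (insert (closure \<Omega>) (T h))" using fin by simp
    show "flat (frontier K)" if "K \<in> insert (closure \<Omega>) (T h)" for K
      using that \<Omega>(3) body flat_frontier_polyhedral_body by blast
  qed
  ultimately have flat_Gamma: "flat (Gamma_int \<Omega> (T h))" by (rule flat_subset[rotated])
  have "e \<subseteq> closure \<Omega>" if "e \<in> mesh_faces \<Omega> (T h)" for e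
    using that Un unfolding mesh_faces_def interior_faces_of_def by blast
  then have "Gamma_int \<Omega> (T h) \<subseteq> closure \<Omega>" unfolding Gamma_int_def by blast
  then have bounded_Gamma: "bounded (Gamma_int \<Omega> (T h))"
    using bounded_closure[OF \<Omega>(2)] bounded_subset by blast
  show ?thesis
  proof
    show "open \<Omega>" "bounded \<Omega>" "finite (T h)" "\<Union>(T h) = closure \<Omega>" by fact+
    show "compact \<kappa>" "interior \<kappa> \<noteq> {}" if "\<kappa> \<in> T h" for \<kappa>
      using compact_polyhedral_body[OF body[OF that]] interior_polyhedral_body[OF body[OF that]] .
    show "negligible (\<kappa> \<inter> \<kappa>')" if "\<kappa> \<in> T h" "\<kappa>' \<in> T h" "\<kappa> \<noteq> \<kappa>'" for \<kappa> \<kappa>'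
      using negligible_flat[OF flat_frontier_polyhedral_body[OF body[OF that(1)]]] inter[OF that]
      by (rule negligible_subset)
    show "negligible (frontier \<Omega>)" using flat_bd by (rule negligible_flat)
    show "hausdorff_outer (real CARD('n) - 1) (frontier \<Omega>) < \<infinity>"
      by (rule hausdorff_outer_flat[OF flat_bd bounded_bd])
    show "hausdorff_outer (real CARD('n) - 1) (Gamma_int \<Omega> (T h)) < \<infinity>"
      by (rule hausdorff_outer_flat[OF flat_Gamma bounded_Gamma])
  qed
qed

text \<open>Everything is asked from index 1 on: \<open>un 0\<close> and \<open>lamn 0\<close> are
  unconstrained, and the limit sees only large indices.\<close>

lemma L2_tendstoI:
  assumes "g \<in> L2 M" "\<And>n. 1 \<le> n \<Longrightarrow> f n \<in> L2 M"
    and le: "\<And>n. 1 \<le> n \<Longrightarrow> L2_norm M (\<lambda>x. f n x - g x) \<le> C * a n" and a: "a \<longlonglongrightarrow> 0"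
  shows "L2_tendsto M f g"
  unfolding L2_tendsto_def
proof (intro conjI)
  show "\<forall>\<^sub>F n in sequentially. f n \<in> L2 M" using assms(2) eventually_sequentially by blast
  have lim: "(\<lambda>n. C * a n) \<longlonglongrightarrow> 0" using tendsto_mult_left[OF a, of C] by simp
  have upper: "\<forall>\<^sub>F n in sequentially. L2_norm M (\<lambda>x. f n x - g x) \<le> C * a n"
    using le eventually_sequentially by blast
  have lower: "\<forall>\<^sub>F n in sequentially. 0 \<le> L2_norm M (\<lambda>x. f n x - g x)"
    by (simp add: L2_norm_def)
  show "(\<lambda>n. L2_norm M (\<lambda>x. f n x - g x)) \<longlonglongrightarrow> 0"
    by (rule tendsto_sandwich[OF lower upper tendsto_const lim])
qed (rule assms(1))

theorem theorem1p4:
  fixes \<Omega> :: "(real^'n) set"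
    and T :: "real \<Rightarrow> (real^'n) set set"
    and p \<xi> uD gD :: "real^'n \<Rightarrow> real"
    and p1 h r \<rho> :: real
    and k l :: nat
    and u :: "real^'n \<Rightarrow> real" and \<eta> lam :: "real^'n \<Rightarrow> real^'n"
    and \<rho>n :: "nat \<Rightarrow> real"
    and un :: "nat \<Rightarrow> real^'n \<Rightarrow> real" and \<eta>n lamn :: "nat \<Rightarrow> real^'n \<Rightarrow> real^'n"
  assumes domain: "polyhedral_domain \<Omega>"
    and p1: "1 < p1" "p1 \<le> 2"
    and p_range: "\<forall>x\<in>closure \<Omega>. p1 \<le> p x \<and> p x \<le> 2"
    and p_log: "log_hoelder_on (closure \<Omega>) p"
    and \<xi>: "\<xi> \<in> L2 (lebesgue_on \<Omega>)"
    and uD: "uD \<in> W1p \<Omega> p" "has_trace \<Omega> uD gD" "gD \<in> L2 (surface_on (frontier \<Omega>))"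
    and mesh: "mesh_family \<Omega> T"
    and h: "0 < h" "h \<le> 1"
    and kl: "int l \<ge> int k - 1"
    and V: "V = broken_polys k \<Omega> (T h)"
    and H: "H = broken_vpolys l \<Omega> (T h)"
    and R: "R = lifting l \<Omega> (T h)"
    and B: "B = dg_grad l \<Omega> (T h)"
    and F: "F = energy_F \<Omega> p"
    and G: "G = energy_G \<Omega> (T h) p \<xi> gD"
    and r: "0 \<le> r"
    and saddle: "saddle_point V H (aug_lagrangian \<Omega> F G B r) u \<eta> lam"
    and step: "\<forall>n\<ge>1. \<rho>n n = \<rho>" "0 < \<rho>" "\<rho> < r * ((1 + sqrt 5) / 2)"
    and iterates: "algorithm2 \<Omega> V H F G B r \<rho>n un \<eta>n lamn"
  shows "L2_tendsto (lebesgue_on \<Omega>) \<eta>n \<eta>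
    \<and> (AE x in lebesgue_on \<Omega>. \<eta> x = B u x)
    \<and> L2_tendsto (lebesgue_on \<Omega>) (\<lambda>n x. lamn (Suc n) x - lamn n x) (\<lambda>x. 0)
    \<and> (\<exists>C. \<forall>n\<ge>1. L2_norm (lebesgue_on \<Omega>) (lamn n) \<le> C)
    \<and> L2_tendsto (lebesgue_on \<Omega>) un u
    \<and> L2_tendsto (surface_on (Gamma_int \<Omega> (T h))) (\<lambda>n. jump (T h) (\<lambda>x. un n x - u x)) (\<lambda>x. 0)
    \<and> L2_tendsto (surface_on (frontier \<Omega>)) (\<lambda>n. bdry_trace (T h) (un n)) (bdry_trace (T h) u)
    \<and> L2_tendsto (lebesgue_on \<Omega>) (\<lambda>n. R (un n)) (R u)
    \<and> L2_tendsto (lebesgue_on \<Omega>) (\<lambda>n. broken_grad (T h) (un n)) (broken_grad (T h) u)"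
proof -
  interpret broken_mesh \<Omega> "T h" using domain mesh h by (rule broken_mesh_of_mesh_family)
  have p: "continuous_on (closure \<Omega>) p" "\<And>x. x \<in> closure \<Omega> \<Longrightarrow> 1 \<le> p x" "\<And>x. x \<in> closure \<Omega> \<Longrightarrow> p x \<le> 2"
    using continuous_on_log_hoelder[OF p_log] p_range p1 by force+
  have convex_F: "F (\<phi> + t *\<^sub>R (\<psi> - \<phi>)) \<le> F \<phi> + t * (F \<psi> - F \<phi>)"
    if "\<phi> \<in> broken_vpolys l \<Omega> (T h)" "\<psi> \<in> broken_vpolys l \<Omega> (T h)" "0 \<le> t" "t \<le> 1" for \<phi> \<psi> t
    unfolding F using p that by (rule energy_F_convex)
  have convex_G: "G (v + t *\<^sub>R (w - v))
      \<le> G v + t * (G w - G v) - t * (1 - t) * L2_inner (lebesgue_on \<Omega>) (w - v) (w - v)"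
    if "v \<in> broken_polys k \<Omega> (T h)" "w \<in> broken_polys k \<Omega> (T h)" "0 \<le> t" "t \<le> 1" for v w t
    unfolding G using p(1,2) \<xi> uD(3) that by (rule energy_G_strongly_convex)
  note convergence = alternating_direction_convergence[OF kl convex_F convex_G
      saddle[unfolded V H B] step iterates[unfolded V H B], folded B]
  have u: "u \<in> V" and \<eta>: "\<eta> \<in> H" using saddle unfolding saddle_point_def by blast+
  have lam1: "lamn 1 \<in> H" and un: "\<And>n. 1 \<le> n \<Longrightarrow> un n \<in> V" and etan: "\<And>n. 1 \<le> n \<Longrightarrow> \<eta>n n \<in> H"
    and lamS: "\<And>n. 1 \<le> n \<Longrightarrow> lamn (Suc n) \<in> H"
    using iterates unfolding algorithm2_def by blast+
  have lamn: "lamn n \<in> H" if "1 \<le> n" for n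
    using lam1 lamS[of "n - 1"] that by (cases "n = 1") auto
  have diff: "un n - u \<in> V" if "1 \<le> n" for n
    using subspace_diff[OF subspace_broken_polys un[OF that, unfolded V] u[unfolded V]] unfolding V .
  have H_diff: "\<phi> - \<psi> \<in> H" if "\<phi> \<in> H" "\<psi> \<in> H" for \<phi> \<psi>
    using subspace_diff[OF subspace_broken_vpolys that[unfolded H]] unfolding H .
  have VL2: "v \<in> L2 (lebesgue_on \<Omega>)" if "v \<in> V" for v using that broken_polys_L2 unfolding V by blast
  have HL2: "\<phi> \<in> L2 (lebesgue_on \<Omega>)" if "\<phi> \<in> H" for \<phi> using that broken_vpolys_L2 unfolding H by blast
  have RH: "R v \<in> H" and grad: "broken_grad (T h) v \<in> H" if "v \<in> V" for v
    using that lifting_mem grad_on_elem_mem kl unfolding V H R by blast+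
  let ?a = "\<lambda>n. L2_norm (lebesgue_on \<Omega>) (un n - u)"
  \<comment> \<open>This limit drives the limits of jumps, traces, liftings and gradients below:
    each is bounded by a constant times \<open>?a n\<close>.\<close>
  note a = convergence(5)
  have eta_lim: "L2_tendsto (lebesgue_on \<Omega>) \<eta>n \<eta>"
    by (rule L2_tendstoI[OF HL2[OF \<eta>] HL2[OF etan] _ convergence(1), where C = 1]) (auto simp: fun_diff_def)
  have lam_lim: "L2_tendsto (lebesgue_on \<Omega>) (\<lambda>n x. lamn (Suc n) x - lamn n x) (\<lambda>x. 0)"
  proof (rule L2_tendstoI[OF _ _ _ convergence(3), where C = 1])
    show "(\<lambda>x. 0) \<in> L2 (lebesgue_on \<Omega>)" by (simp add: L2_def)
    show "(\<lambda>x. lamn (Suc n) x - lamn n x) \<in> L2 (lebesgue_on \<Omega>)" if "1 \<le> n" for n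
      using HL2[OF H_diff[OF lamS[OF that] lamn[OF that]]] unfolding fun_diff_def .
  qed (simp add: fun_diff_def)
  have u_lim: "L2_tendsto (lebesgue_on \<Omega>) un u"
    by (rule L2_tendstoI[OF VL2[OF u] VL2[OF un] _ a, where C = 1]) (auto simp: fun_diff_def)
  obtain C1 where C1: "\<And>v. v \<in> V \<Longrightarrow> jump (T h) v \<in> L2 (surface_on (Gamma_int \<Omega> (T h)))"
    "\<And>v. v \<in> V \<Longrightarrow> L2_norm (surface_on (Gamma_int \<Omega> (T h))) (jump (T h) v) \<le> C1 * L2_norm (lebesgue_on \<Omega>) v"
    using jump_norm_le unfolding V by blast
  have jump_eq: "(\<lambda>n. jump (T h) (\<lambda>x. un n x - u x)) = (\<lambda>n. jump (T h) (un n - u))"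
    by (simp only: fun_diff_def)
  have jump_lim: "L2_tendsto (surface_on (Gamma_int \<Omega> (T h))) (\<lambda>n. jump (T h) (\<lambda>x. un n x - u x)) (\<lambda>x. 0)"
    unfolding jump_eq
  proof (rule L2_tendstoI[OF _ _ _ a, where C = C1])
    show "(\<lambda>x. 0) \<in> L2 (surface_on (Gamma_int \<Omega> (T h)))" by (simp add: L2_def)
    show "jump (T h) (un n - u) \<in> L2 (surface_on (Gamma_int \<Omega> (T h)))" if "1 \<le> n" for n
      by (rule C1(1)[OF diff[OF that]])
    show "L2_norm (surface_on (Gamma_int \<Omega> (T h))) (\<lambda>x. jump (T h) (un n - u) x - 0) \<le> C1 * ?a n" if "1 \<le> n" for n
      using C1(2)[OF diff[OF that]] by simp
  qed
  obtain C2 where C2: "\<And>v. v \<in> V \<Longrightarrow> bdry_trace (T h) v \<in> L2 (surface_on (frontier \<Omega>))"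
    "\<And>u v. u \<in> V \<Longrightarrow> v \<in> V \<Longrightarrow> L2_norm (surface_on (frontier \<Omega>)) (\<lambda>x. bdry_trace (T h) v x - bdry_trace (T h) u x)
      \<le> C2 * L2_norm (lebesgue_on \<Omega>) (v - u)"
    using bdry_trace_norm_le unfolding V by blast
  have trace_lim: "L2_tendsto (surface_on (frontier \<Omega>)) (\<lambda>n. bdry_trace (T h) (un n)) (bdry_trace (T h) u)"
    by (rule L2_tendstoI[OF C2(1)[OF u] C2(1)[OF un] C2(2)[OF u un] a])
  obtain C3 where C3: "\<And>u v. u \<in> V \<Longrightarrow> v \<in> V \<Longrightarrow>
      L2_norm (lebesgue_on \<Omega>) (R v - R u) \<le> C3 * L2_norm (lebesgue_on \<Omega>) (v - u)"
    using lifting_norm_le unfolding V R by blast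
  have R_lim: "L2_tendsto (lebesgue_on \<Omega>) (\<lambda>n. R (un n)) (R u)"
    by (rule L2_tendstoI[OF HL2[OF RH[OF u]] HL2[OF RH[OF un]] C3[OF u un, unfolded fun_diff_def[of "R _"]] a])
  obtain C4 where "0 \<le> C4" and C4: "\<And>u v. u \<in> V \<Longrightarrow> v \<in> V \<Longrightarrow>
      L2_norm (lebesgue_on \<Omega>) (broken_grad (T h) v - broken_grad (T h) u) \<le> C4 * L2_norm (lebesgue_on \<Omega>) (v - u)"
    using broken_grad_norm_le[OF kl] unfolding V by blast
  have grad_lim: "L2_tendsto (lebesgue_on \<Omega>) (\<lambda>n. broken_grad (T h) (un n)) (broken_grad (T h) u)"
    by (rule L2_tendstoI[OF HL2[OF grad[OF u]] HL2[OF grad[OF un]]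
          C4[OF u un, unfolded fun_diff_def[of "broken_grad _ _"]] a])
  show ?thesis
    using eta_lim convergence(2) lam_lim convergence(4) u_lim jump_lim trace_lim R_lim grad_lim by blast
qed

end
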